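(* Let $(\mathcal{A}_j,\mathcal{H}_j,\mathfrak{D}_j,\overline{\mathfrak{D}}_j,\gamma_j,\star_j)$, $j=1,2$, be two $N=(1,1)$ spectral data. Then $$\big(\mathcal{A}_1\otimes\mathcal{A}_2,\ \mathcal{H}_1\otimes\mathcal{H}_2,\ \mathfrak{D}:=\mathfrak{D}_1\otimes1+\star_1\otimes\mathfrak{D}_2,\ \overline{\mathfrak{D}}:=\overline{\mathfrak{D}}_1\otimes\star_2+\gamma_1\otimes\overline{\mathfrak{D}}_2,\ \gamma:=\gamma_1\otimes\gamma_2,\ \star:=\star_1\otimes\star_2\big)$$ is again an $N=(1,1)$ spectral data.
   Context: An $N=(1,1)$ spectral data is a sextuple $(\mathcal{A},\mathcal{H},\mathfrak{D},\overline{\mathfrak{D}},\gamma,\star)$ where: $\mathcal{A}$ is a unital associative $*$-algebra represented faithfully on a separable Hilbert space $\mathcal{H}$ by bounded operators; $\mathfrak{D},\overline{\mathfrak{D}}$ are (essentially) self-adjoint operators on $\mathcal{H}$ ($\overline{\mathfrak{D}}$ is a second operator, not the closure of $\mathfrak{D}$) with $\mathfrak{D}^2=\overline{\mathfrak{D}}^2$ and $\{\mathfrak{D},\overline{\mathfrak{D}}\}=0$; for each $a\in\mathcal{A}$ the commutators $[\mathfrak{D},a]$ and $[\overline{\mathfrak{D}},a]$ extend to bounded operators; $\exp(-\varepsilon\mathfrak{D}^2)$ is trace class for all $\varepsilon>0$; $\gamma$ is a $\mathbb{Z}_2$-grading with $[\gamma,a]=0$ for all $a\in\mathcal{A}$ and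 $\{\gamma,\mathfrak{D}\}=\{\gamma,\overline{\mathfrak{D}}\}=0$; $\star$ is a self-adjoint unitary with $[\star,a]=0$ for all $a\in\mathcal{A}$, $[\star,\gamma]=0$, $\{\star,\mathfrak{D}\}=0$ and $[\star,\overline{\mathfrak{D}}]=0$. (This is equivalent to a quintuple $(\mathcal{A},\mathcal{H},d,\gamma,\star)$ with $d=\frac12(\mathfrak{D}-i\overline{\mathfrak{D}})$ closed, $d^2=0$, $[d,a]$ bounded, $\exp(-\varepsilon(dd^*+d^*d))$ trace class, $\{\gamma,d\}=0$, $\star d=-d^*\star$.) Tensor products of algebras are over $\mathbb{C}$ and tensor products of Hilbert spaces are Hilbert space tensor products. *)

theory Defs
  imports "HOL-Analysis.Analysis"
begin

section \<open>Complex vector spaces, *-algebras and Hilbert spaces\<close>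

class complex_vector = ab_group_add +
  fixes scaleC :: "complex \<Rightarrow> 'a \<Rightarrow> 'a"  (infixr "*\<^sub>C" 75)
  assumes scaleC_add_right: "a *\<^sub>C (x + y) = a *\<^sub>C x + a *\<^sub>C y"
    and scaleC_add_left: "(a + b) *\<^sub>C x = a *\<^sub>C x + b *\<^sub>C x"
    and scaleC_scaleC: "a *\<^sub>C b *\<^sub>C x = (a * b) *\<^sub>C x"
    and scaleC_one: "1 *\<^sub>C x = x"

global_interpretation cvec: vector_space "scaleC :: complex \<Rightarrow> 'a \<Rightarrow> 'a :: complex_vector"
  by standard (fact scaleC_add_right scaleC_add_left scaleC_scaleC scaleC_one)+

instantiation complex :: complex_vector
begin
definition scaleC_complex :: "complex \<Rightarrow> complex \<Rightarrow> complex" where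
  "scaleC_complex c z = c * z"
instance
  by standard (simp_all add: scaleC_complex_def algebra_simps)
end

instantiation prod :: (complex_vector, complex_vector) complex_vector
begin
definition scaleC_prod :: "complex \<Rightarrow> 'a \<times> 'b \<Rightarrow> 'a \<times> 'b" where
  "scaleC_prod c p = (c *\<^sub>C fst p, c *\<^sub>C snd p)"
instance
  by standard (simp_all add: scaleC_prod_def prod_eq_iff scaleC_add_right scaleC_add_left
      scaleC_scaleC scaleC_one)
end

text \<open>Complex-linear and complex-bilinear maps.\<close>

definition clinear :: "('a::complex_vector \<Rightarrow> 'b::complex_vector) \<Rightarrow> bool" where
  "clinear f \<longleftrightarrow> (\<forall>x y. f (x + y) = f x + f y) \<and> (\<forall>c x. f (c *\<^sub>C x) = c *\<^sub>C f x)"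

definition cbilinear ::
  "('a::complex_vector \<Rightarrow> 'b::complex_vector \<Rightarrow> 'c::complex_vector) \<Rightarrow> bool" where
  "cbilinear f \<longleftrightarrow> (\<forall>y. clinear (\<lambda>x. f x y)) \<and> (\<forall>x. clinear (f x))"

text \<open>Unital associative complex *-algebras. The class \<open>ring_1\<close> is avoided because it
  would exclude the zero algebra.\<close>

class complex_star_algebra = complex_vector + ring + monoid_mult +
  fixes involution :: "'a \<Rightarrow> 'a"
  assumes mult_scaleC_left: "(c *\<^sub>C x) * y = c *\<^sub>C (x * y)"
    and mult_scaleC_right: "x * (c *\<^sub>C y) = c *\<^sub>C (x * y)"
    and involution_add: "involution (x + y) = involution x + involution y"
    and involution_scaleC: "involution (c *\<^sub>C x) = cnj c *\<^sub>C involution x"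
    and involution_mult: "involution (x * y) = involution y * involution x"
    and involution_involution: "involution (involution x) = x"

text \<open>The complex inner product is conjugate-linear in its first argument; its real part is
  the inner product of \<open>real_inner\<close>, which supplies positivity, norm and topology.\<close>

class complex_hilbert = complex_vector + real_inner + complete_space +
  fixes cinner :: "'a \<Rightarrow> 'a \<Rightarrow> complex"
  assumes scaleR_scaleC: "r *\<^sub>R x = complex_of_real r *\<^sub>C x"
    and inner_eq_Re_cinner: "inner x y = Re (cinner x y)"
    and cinner_commute: "cinner x y = cnj (cinner y x)"
    and cinner_add_right: "cinner x (y + z) = cinner x y + cinner x z"
    and cinner_scaleC_right: "cinner x (c *\<^sub>C y) = c * cinner x y"

section \<open>Bounded operators\<close>

definition bounded_op :: "('h::complex_hilbert \<Rightarrow> 'k::complex_hilbert) \<Rightarrow> bool" where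
  "bounded_op S \<longleftrightarrow> bounded_linear S \<and> clinear S"

definition is_adjoint :: "('h::complex_hilbert \<Rightarrow> 'h) \<Rightarrow> ('h \<Rightarrow> 'h) \<Rightarrow> bool" where
  "is_adjoint S S' \<longleftrightarrow> (\<forall>x y. cinner (S x) y = cinner x (S' y))"

definition self_adjoint_unitary :: "('h::complex_hilbert \<Rightarrow> 'h) \<Rightarrow> bool" where
  "self_adjoint_unitary U \<longleftrightarrow> bounded_op U \<and> is_adjoint U U \<and> U \<circ> U = id"

definition positive_op :: "('h::complex_hilbert \<Rightarrow> 'h) \<Rightarrow> bool" where
  "positive_op R \<longleftrightarrow> bounded_op R \<and> (\<forall>x. cinner x (R x) \<in> \<real> \<and> 0 \<le> Re (cinner x (R x)))"

definition orthonormal_basis :: "'h::complex_hilbert set \<Rightarrow> bool" where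
  "orthonormal_basis B \<longleftrightarrow>
     (\<forall>e\<in>B. \<forall>f\<in>B. cinner e f = (if e = f then 1 else 0)) \<and> closure (cvec.span B) = UNIV"

text \<open>\<open>is_abs_op S R\<close> says that \<open>R\<close> is the positive square root of \<open>S\<^sup>* S\<close>.\<close>

definition is_abs_op :: "('h::complex_hilbert \<Rightarrow> 'h) \<Rightarrow> ('h \<Rightarrow> 'h) \<Rightarrow> bool" where
  "is_abs_op S R \<longleftrightarrow> positive_op R \<and> (\<exists>S'. is_adjoint S S' \<and> R \<circ> R = S' \<circ> S)"

definition trace_class :: "('h::complex_hilbert \<Rightarrow> 'h) \<Rightarrow> bool" where
  "trace_class S \<longleftrightarrow> bounded_op S \<and>
     (\<exists>R B. is_abs_op S R \<and> orthonormal_basis B \<and> (\<lambda>e. Re (cinner e (R e))) summable_on B)"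

section \<open>Unbounded operators\<close>

text \<open>An unbounded operator is given by its graph, so that \<open>Domain T\<close> is its domain, equality
  and inclusion take domains into account, and \<open>closure T\<close>, the closure of the graph in
  the product topology, is the operator closure. Since relations compose from left to right,
  the operator product \<open>S T\<close> (first apply \<open>T\<close>) is \<open>T O S\<close>.\<close>

type_synonym 'h operator = "('h \<times> 'h) set"

definition graph :: "('h \<Rightarrow> 'h) \<Rightarrow> 'h operator" where
  "graph S = {(x, S x) | x. True}"

definition linear_operator :: "'h::complex_hilbert operator \<Rightarrow> bool" where
  "linear_operator T \<longleftrightarrow> cvec.subspace T \<and> single_valued T"

definition op_adjoint :: "'h::complex_hilbert operator \<Rightarrow> 'h operator" where
  "op_adjoint T = {(y, z). \<forall>(x, w)\<in>T. cinner w y = cinner x z}"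

definition essentially_self_adjoint :: "'h::complex_hilbert operator \<Rightarrow> bool" where
  "essentially_self_adjoint T \<longleftrightarrow> linear_operator T \<and> closure (Domain T) = UNIV \<and>
     op_adjoint (closure T) = closure T"

definition op_prod :: "'h operator \<Rightarrow> 'h operator \<Rightarrow> 'h operator"  (infixr "\<cdot>" 75) where
  "S \<cdot> T = T O S"

definition op_sum :: "'h::complex_hilbert operator \<Rightarrow> 'h operator \<Rightarrow> 'h operator"
    (infixl "\<oplus>" 65) where
  "S \<oplus> T = {(x, y + z) | x y z. (x, y) \<in> S \<and> (x, z) \<in> T}"

definition op_neg :: "'h::complex_hilbert operator \<Rightarrow> 'h operator" where
  "op_neg T = {(x, - y) | x y. (x, y) \<in> T}"

text \<open>(Anti)commutation includes equality of domains. For a self-adjoint unitary \<open>U\<close>,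
  \<open>commute (graph U) T\<close> and \<open>anticommute (graph U) T\<close> thus include that \<open>U\<close> maps the domain
  of \<open>T\<close> onto itself.\<close>

definition commute :: "'h operator \<Rightarrow> 'h operator \<Rightarrow> bool" where
  "commute S T \<longleftrightarrow> S \<cdot> T = T \<cdot> S"

definition anticommute :: "'h::complex_hilbert operator \<Rightarrow> 'h operator \<Rightarrow> bool" where
  "anticommute S T \<longleftrightarrow> S \<cdot> T = op_neg (T \<cdot> S)"

text \<open>\<open>a\<close> preserves the domain of \<open>T\<close>, and \<open>[T, a]\<close> is there the restriction of a bounded
  operator.\<close>

definition bounded_commutator ::
  "'h::complex_hilbert operator \<Rightarrow> ('h \<Rightarrow> 'h) \<Rightarrow> bool" where
  "bounded_commutator T a \<longleftrightarrow>
     (\<exists>C. bounded_op C \<and> (\<forall>(x, y)\<in>T. \<exists>z. (a x, z) \<in> T \<and> z - a y = C x))"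

section \<open>Functional calculus\<close>

definition projection_valued_measure :: "(real set \<Rightarrow> 'h::complex_hilbert \<Rightarrow> 'h) \<Rightarrow> bool" where
  "projection_valued_measure P \<longleftrightarrow>
     (\<forall>B\<in>sets borel. bounded_op (P B) \<and> is_adjoint (P B) (P B) \<and> P B \<circ> P B = P B) \<and>
     P UNIV = id \<and>
     (\<forall>B. range B \<subseteq> sets borel \<longrightarrow> disjoint_family B \<longrightarrow>
        (\<forall>x. (\<lambda>n::nat. P (B n) x) sums P (\<Union>n. B n) x))"

text \<open>The scalar measure \<open>B \<mapsto> \<langle>x, P B x\<rangle>\<close>.\<close>

definition scalar_measure ::
  "(real set \<Rightarrow> 'h::complex_hilbert \<Rightarrow> 'h) \<Rightarrow> 'h \<Rightarrow> real measure" where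
  "scalar_measure P x = measure_of UNIV (sets borel) (\<lambda>B. ennreal (Re (cinner x (P B x))))"

text \<open>\<open>T = \<integral> f dP\<close> for a real Borel function \<open>f\<close>. The domain and the quadratic form of the linear
  operator \<open>T\<close> are prescribed; by polarization and density of the domain this determines \<open>T\<close>.\<close>

definition is_spectral_integral ::
  "(real set \<Rightarrow> 'h::complex_hilbert \<Rightarrow> 'h) \<Rightarrow> (real \<Rightarrow> real) \<Rightarrow> 'h operator \<Rightarrow> bool" where
  "is_spectral_integral P f T \<longleftrightarrow> linear_operator T \<and>
     Domain T = {x. integrable (scalar_measure P x) (\<lambda>t. (f t)\<^sup>2)} \<and>
     (\<forall>(x, y)\<in>T. cinner x y = complex_of_real (\<integral>t. f t \<partial>scalar_measure P x))"

text \<open>\<open>F = f(T)\<close>, where \<open>T = \<integral> t dP(t)\<close> is the spectral resolution of \<open>T\<close>.\<close>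

definition is_function_of ::
  "'h::complex_hilbert operator \<Rightarrow> (real \<Rightarrow> real) \<Rightarrow> 'h operator \<Rightarrow> bool" where
  "is_function_of T f F \<longleftrightarrow>
     (\<exists>P. projection_valued_measure P \<and> is_spectral_integral P (\<lambda>t. t) T \<and>
          is_spectral_integral P f F)"

section \<open>Representations and spectral data\<close>

definition faithful_representation ::
  "('a::complex_star_algebra \<Rightarrow> 'h::complex_hilbert \<Rightarrow> 'h) \<Rightarrow> bool" where
  "faithful_representation \<pi> \<longleftrightarrow>
     (\<forall>a. bounded_op (\<pi> a)) \<and> (\<forall>x. clinear (\<lambda>a. \<pi> a x)) \<and>
     \<pi> 1 = id \<and> (\<forall>a b. \<pi> (a * b) = \<pi> a \<circ> \<pi> b) \<and>
     (\<forall>a. is_adjoint (\<pi> a) (\<pi> (involution a))) \<and> inj \<pi>"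

text \<open>The algebra and the Hilbert space are the types \<open>'a\<close> and \<open>'h\<close>; \<open>D\<close> and \<open>D'\<close> are the
  operators \<open>\<DD>\<close> and its barred partner (not its closure), and \<open>\<sigma>\<close> is the Hodge operator \<open>\<star>\<close>. As \<open>D\<close> and \<open>D'\<close> are only assumed essentially self-adjoint, all further conditions
  are imposed on the self-adjoint closures.\<close>

locale N11_spectral_data =
  fixes \<pi> :: "'a::complex_star_algebra \<Rightarrow> 'h::complex_hilbert \<Rightarrow> 'h"
    and D D' :: "'h operator"
    and \<gamma> \<sigma> :: "'h \<Rightarrow> 'h"
  assumes separable: "\<exists>X :: 'h set. countable X \<and> closure X = UNIV"
    and faithful: "faithful_representation \<pi>"
    and self_adjoint: "essentially_self_adjoint D" "essentially_self_adjoint D'"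
    and squares_eq: "closure D \<cdot> closure D = closure D' \<cdot> closure D'"
    and D_D': "anticommute (closure D) (closure D')"
    and commutators: "\<And>a. bounded_commutator (closure D) (\<pi> a)"
      "\<And>a. bounded_commutator (closure D') (\<pi> a)"
    and heat_trace_class: "\<And>\<epsilon>::real. \<epsilon> > 0 \<Longrightarrow>
      \<exists>E. is_function_of (closure D \<cdot> closure D) (\<lambda>t. exp (- \<epsilon> * t)) (graph E) \<and> trace_class E"
    and grading: "self_adjoint_unitary \<gamma>"
    and grading_algebra: "\<And>a. \<gamma> \<circ> \<pi> a = \<pi> a \<circ> \<gamma>"
    and grading_D: "anticommute (graph \<gamma>) (closure D)" "anticommute (graph \<gamma>) (closure D')"
    and hodge: "self_adjoint_unitary \<sigma>"
    and hodge_algebra: "\<And>a. \<sigma> \<circ> \<pi> a = \<pi> a \<circ> \<sigma>"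
    and hodge_grading: "\<sigma> \<circ> \<gamma> = \<gamma> \<circ> \<sigma>"
    and hodge_D: "anticommute (graph \<sigma>) (closure D)" "commute (graph \<sigma>) (closure D')"

section \<open>Tensor products\<close>

text \<open>\<open>hilbert_tensor tp\<close> says that \<open>'k\<close> with the canonical map \<open>tp x y = x \<otimes> y\<close> is the Hilbert
  space tensor product of \<open>'h\<^sub>1\<close> and \<open>'h\<^sub>2\<close>, i.e. the completion of their algebraic tensor product
  under the product inner product. Any two such \<open>'k\<close> are identified by a unique unitary map
  compatible with the canonical maps.\<close>

definition hilbert_tensor ::
  "('h1::complex_hilbert \<Rightarrow> 'h2::complex_hilbert \<Rightarrow> 'k::complex_hilbert) \<Rightarrow> bool" where
  "hilbert_tensor tp \<longleftrightarrow> cbilinear tp \<and>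
     (\<forall>x x' y y'. cinner (tp x y) (tp x' y') = cinner x x' * cinner y y') \<and>
     closure (cvec.span {tp x y | x y. True}) = UNIV"

text \<open>\<open>algebra_tensor ta\<close> says that \<open>'t\<close> with the canonical map \<open>ta a b = a \<otimes> b\<close> is the algebraic
  tensor product of \<open>'a\<close> and \<open>'b\<close> over the complex numbers, with its *-algebra structure. Since
  linear functionals separate the points of a vector space, it suffices to require the universal
  property for scalar-valued bilinear maps.\<close>

definition algebra_tensor ::
  "('a::complex_star_algebra \<Rightarrow> 'b::complex_star_algebra \<Rightarrow> 't::complex_star_algebra) \<Rightarrow> bool" where
  "algebra_tensor ta \<longleftrightarrow> cbilinear ta \<and>
     cvec.span {ta a b | a b. True} = UNIV \<and>
     (\<forall>f :: 'a \<Rightarrow> 'b \<Rightarrow> complex. cbilinear f \<longrightarrow> (\<exists>g. clinear g \<and> (\<forall>a b. g (ta a b) = f a b))) \<and>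
     (\<forall>a a' b b'. ta a b * ta a' b' = ta (a * a') (b * b')) \<and>
     ta 1 1 = 1 \<and>
     (\<forall>a b. involution (ta a b) = ta (involution a) (involution b))"

text \<open>Tensor product of bounded operators.\<close>

definition bounded_tensor ::
  "('h1::complex_hilbert \<Rightarrow> 'h2::complex_hilbert \<Rightarrow> 'k::complex_hilbert) \<Rightarrow>
   ('h1 \<Rightarrow> 'h1) \<Rightarrow> ('h2 \<Rightarrow> 'h2) \<Rightarrow> 'k \<Rightarrow> 'k" where
  "bounded_tensor tp S T =
     (THE F. bounded_op F \<and> (\<forall>x y. F (tp x y) = tp (S x) (T y)))"

text \<open>Tensor product of unbounded operators, defined on the algebraic tensor product of the
  domains.\<close>

definition op_tensor ::
  "('h1::complex_hilbert \<Rightarrow> 'h2::complex_hilbert \<Rightarrow> 'k::complex_hilbert) \<Rightarrow>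
   'h1 operator \<Rightarrow> 'h2 operator \<Rightarrow> 'k operator" where
  "op_tensor tp S T =
     cvec.span {(tp x y, tp x' y') | x x' y y'. (x, x') \<in> S \<and> (y, y') \<in> T}"

definition tensor_representation ::
  "('a::complex_star_algebra \<Rightarrow> 'b::complex_star_algebra \<Rightarrow> 't::complex_star_algebra) \<Rightarrow>
   ('h1::complex_hilbert \<Rightarrow> 'h2::complex_hilbert \<Rightarrow> 'k::complex_hilbert) \<Rightarrow>
   ('a \<Rightarrow> 'h1 \<Rightarrow> 'h1) \<Rightarrow> ('b \<Rightarrow> 'h2 \<Rightarrow> 'h2) \<Rightarrow> 't \<Rightarrow> 'k \<Rightarrow> 'k" where
  "tensor_representation ta tp \<pi>1 \<pi>2 =
     (THE \<pi>. (\<forall>x. clinear (\<lambda>t. \<pi> t x)) \<and>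
             (\<forall>a b. \<pi> (ta a b) = bounded_tensor tp (\<pi>1 a) (\<pi>2 b)))"

end

(* The operator D^2 of each factor has an orthonormal basis of eigenvectors b with eigenvalues l(b)
   such that exp(-eps l(b)) is summable for every eps > 0. Indeed exp(-eps D^2) is Hilbert-Schmidt
   for every eps, so by Jensen's inequality orthonormal systems of bounded energy have bounded
   size, and this forces the spectral measure of D^2 to be purely atomic.

   On the tensor product both operators have the form D1 (x) beta + alpha (x) D2, where alpha
   anticommutes with D1 and beta commutes with D2. Hence the cross terms of the square cancel, and
   the vectors b (x) c are eigenvectors of both squares with eigenvalue l1(b) + l2(c). A symmetric
   operator R with a total set of such vectors is essentially self-adjoint, because the ranges of
   R + i and R - i contain all of them. For the same reason the square of its closure is the
   diagonal operator in this basis, so the two squares agree, including their domains. It follows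
   that the two closures have the same domain, and anticommutation only needs to be checked on the
   eigenvectors. The heat trace factorizes. *)
theory Submission
  imports Defs
begin

section \<open>Complex Hilbert spaces\<close>

text \<open>The hypotheses provide a spectral resolution of the square
  \<open>closure D \<cdot> closure D\<close> only, and a spectral integral is prescribed just by its
  domain and quadratic form. Hence no functional calculus of \<open>D\<close> is used: the vectors
  \<open>b\<close> are eigenvectors of squares, and what replaces it is the identity
  \<open>(R + c) (R - c) u = (1 + l u) u\<close> for \<open>c * c = -1\<close>.

  Trace class is tested on one basis and on the absolute value of the operator.

  The product operators start from the algebraic tensor products of the original domains, which need
  not contain the eigenvectors; the elements over the closed factors have to be recovered by
  continuity. The domains of the two closures are compared through \<open>cinner x y\<close>, where
  \<open>y\<close> is the common value of the squares at \<open>x\<close>: it is the squared norm of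
  either image of \<open>x\<close>, and the domain of the square is a core for both.\<close>

lemma cinner_add_left:
  fixes x y z :: "'h::complex_hilbert"
  shows "cinner (x + y) z = cinner x z + cinner y z"
  by (metis cinner_commute cinner_add_right complex_cnj_add)

lemma cinner_scaleC_left:
  fixes x y :: "'h::complex_hilbert"
  shows "cinner (c *\<^sub>C x) y = cnj c * cinner x y"
  by (metis cinner_commute cinner_scaleC_right complex_cnj_mult)

lemma cinner_zero_right [simp]:
  fixes x :: "'h::complex_hilbert"
  shows "cinner x 0 = 0"
  using cinner_add_right[of x 0 0] by simp

lemma cinner_zero_left [simp]:
  fixes x :: "'h::complex_hilbert"
  shows "cinner 0 x = 0"
  using cinner_add_left[of 0 0 x] by simp

lemma cinner_minus_right:
  fixes x y :: "'h::complex_hilbert"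
  shows "cinner x (- y) = - cinner x y"
  using cinner_add_right[of x "- y" y] by (simp add: eq_neg_iff_add_eq_0)

lemma cinner_minus_left:
  fixes x y :: "'h::complex_hilbert"
  shows "cinner (- x) y = - cinner x y"
  using cinner_add_left[of "- x" x y] by (simp add: eq_neg_iff_add_eq_0)

lemma cinner_diff_right:
  fixes x y z :: "'h::complex_hilbert"
  shows "cinner x (y - z) = cinner x y - cinner x z"
  using cinner_add_right[of x y "- z"] by (simp add: cinner_minus_right)

lemma cinner_diff_left:
  fixes x y z :: "'h::complex_hilbert"
  shows "cinner (x - y) z = cinner x z - cinner y z"
  using cinner_add_left[of x "- y" z] by (simp add: cinner_minus_left)

lemma cinner_sum_right:
  fixes x :: "'h::complex_hilbert"
  shows "cinner x (sum f A) = (\<Sum>i\<in>A. cinner x (f i))"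
  by (induction A rule: infinite_finite_induct) (simp_all add: cinner_add_right)

lemma cinner_sum_left:
  fixes y :: "'h::complex_hilbert"
  shows "cinner (sum f A) y = (\<Sum>i\<in>A. cinner (f i) y)"
  by (induction A rule: infinite_finite_induct) (simp_all add: cinner_add_left)

lemmas cinner_linear = cinner_add_left cinner_add_right cinner_scaleC_left cinner_scaleC_right
  cinner_minus_left cinner_minus_right cinner_diff_left cinner_diff_right

lemmas scaleC_simps = scaleC_add_right scaleC_add_left cvec.scale_right_diff_distrib
  cvec.scale_left_diff_distrib

section \<open>Norm, Cauchy-Schwarz inequality and continuity\<close>

lemma cinner_self: "cinner x x = complex_of_real ((norm (x::'h::complex_hilbert))\<^sup>2)"
proof (rule complex_eqI)
  show "Re (cinner x x) = Re (complex_of_real ((norm x)\<^sup>2))"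
    by (simp add: inner_eq_Re_cinner[symmetric] power2_norm_eq_inner)
  have "Im (cinner x x) = - Im (cinner x x)"
    by (subst cinner_commute) simp
  then show "Im (cinner x x) = Im (complex_of_real ((norm x)\<^sup>2))" by simp
qed

lemma norm_sq_cinner: "(norm (x::'h::complex_hilbert))\<^sup>2 = Re (cinner x x)"
  by (simp add: cinner_self)

lemma norm_scaleC: "norm (c *\<^sub>C (x::'h::complex_hilbert)) = cmod c * norm x"
proof -
  have c: "cnj c * c = complex_of_real ((cmod c)\<^sup>2)"
    using complex_norm_square[of c] by (simp add: mult.commute)
  have "cinner (c *\<^sub>C x) (c *\<^sub>C x) = (cnj c * c) * cinner x x"
    by (simp add: cinner_linear)
  also have "\<dots> = complex_of_real ((cmod c * norm x)\<^sup>2)"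
    by (simp only: c cinner_self power_mult_distrib of_real_mult)
  finally have "(norm (c *\<^sub>C x))\<^sup>2 = (cmod c * norm x)\<^sup>2"
    by (simp only: norm_sq_cinner Re_complex_of_real)
  then show ?thesis by (rule power2_eq_imp_eq) auto
qed

lemma cmod_cinner_le: "cmod (cinner x y) \<le> norm x * norm (y::'h::complex_hilbert)"
proof (cases "cinner x y = 0")
  case False
  let ?c = "cinner x y"
  \<comment> \<open>A phase that turns \<open>cinner x y\<close> into its modulus, so that the real
    Cauchy-Schwarz inequality applies.\<close>
  define u where "u = cnj ?c / cmod ?c"
  have "cmod u = 1" using False by (simp add: u_def norm_divide)
  have "cinner x (u *\<^sub>C y) = u * ?c" by (simp add: cinner_linear)
  also have "\<dots> = complex_of_real (cmod ?c)"
    using False complex_norm_square[of ?c]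
    by (simp add: u_def divide_eq_eq power2_eq_square mult.commute)
  finally have "cmod ?c = inner x (u *\<^sub>C y)" by (simp add: inner_eq_Re_cinner)
  also have "\<dots> \<le> norm x * norm (u *\<^sub>C y)" by (rule norm_cauchy_schwarz)
  finally show ?thesis by (simp add: norm_scaleC \<open>cmod u = 1\<close>)
qed simp

lemma scaleR_prod_scaleC:
  "r *\<^sub>R (p :: 'h::complex_hilbert \<times> 'k::complex_hilbert) = complex_of_real r *\<^sub>C p"
  by (simp add: scaleC_prod_def prod_eq_iff scaleR_scaleC)

lemma bounded_bilinear_scaleC:
  "bounded_bilinear (scaleC :: complex \<Rightarrow> 'h::complex_hilbert \<Rightarrow> 'h)"
  by (rule bounded_bilinear.intro)
     (auto simp: scaleC_simps scaleR_scaleC scaleC_scaleC norm_scaleC scaleR_conv_of_real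
       mult.commute intro!: exI[of _ 1])

lemma bounded_bilinear_cinner:
  "bounded_bilinear (cinner :: 'h::complex_hilbert \<Rightarrow> 'h \<Rightarrow> complex)"
  by (rule bounded_bilinear.intro)
     (auto simp: cinner_linear scaleR_scaleC scaleR_conv_of_real cmod_cinner_le intro!: exI[of _ 1])

lemmas tendsto_cinner [tendsto_intros] = bounded_bilinear.tendsto[OF bounded_bilinear_cinner]
lemmas continuous_on_scaleC [continuous_intros] =
  bounded_bilinear.continuous_on[OF bounded_bilinear_scaleC]
lemmas continuous_on_cinner [continuous_intros] =
  bounded_bilinear.continuous_on[OF bounded_bilinear_cinner]

lemma scaleC_Pair [simp]: "c *\<^sub>C (x, y) = (c *\<^sub>C x, c *\<^sub>C y)"
  by (simp add: scaleC_prod_def)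

lemma fst_scaleC [simp]: "fst (c *\<^sub>C p) = c *\<^sub>C fst p"
  and snd_scaleC [simp]: "snd (c *\<^sub>C p) = c *\<^sub>C snd p"
  by (simp_all add: scaleC_prod_def)

section \<open>Complex-linear subspaces, their closures, and total sets\<close>

lemma csubspace_prod_imp_subspace:
  "cvec.subspace (S :: ('h::complex_hilbert \<times> 'k::complex_hilbert) set) \<Longrightarrow> subspace S"
  by (auto simp: cvec.subspace_def subspace_def scaleR_prod_scaleC)

text \<open>Continuity of scaling is a hypothesis because the lemma serves Hilbert spaces and also
  pairs and nested pairs, which carry no \<open>complex_hilbert\<close> structure here.\<close>

lemma closure_csubspace_aux:
  fixes S :: "'v::{complex_vector,real_normed_vector} set"
  assumes "cvec.subspace S" and "\<And>c. continuous_on UNIV (\<lambda>x::'v. c *\<^sub>C x)"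
  shows "cvec.subspace (closure S)"
proof (rule cvec.subspaceI)
  show "0 \<in> closure S"
    using assms closure_subset[of S] by (auto simp: cvec.subspace_def)
  fix x y assume "x \<in> closure S" "y \<in> closure S"
  then obtain a b where "\<forall>n. a n \<in> S" "a \<longlonglongrightarrow> x" "\<forall>n. b n \<in> S" "b \<longlonglongrightarrow> y"
    by (auto simp: closure_sequential)
  then show "x + y \<in> closure S"
    using assms unfolding closure_sequential
    by (intro exI[of _ "\<lambda>n. a n + b n"]) (auto intro!: tendsto_add cvec.subspace_add)
next
  fix c x assume x: "x \<in> closure S"
  have "(\<lambda>x. c *\<^sub>C x) ` closure S \<subseteq> closure S"
    by (rule image_closure_subset)
       (use assms closure_subset[of S] in \<open>auto simp: cvec.subspace_def intro: continuous_on_subset\<close>)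
  then show "c *\<^sub>C x \<in> closure S" using x by auto
qed

lemma closure_csubspace:
  "cvec.subspace (S :: 'h::complex_hilbert set) \<Longrightarrow> cvec.subspace (closure S)"
  by (rule closure_csubspace_aux) (auto intro!: continuous_intros)

lemma closure_csubspace_prod:
  "cvec.subspace (S :: ('h::complex_hilbert \<times> 'k::complex_hilbert) set) \<Longrightarrow>
    cvec.subspace (closure S)"
  by (rule closure_csubspace_aux)
     (auto simp: scaleC_prod_def intro!: continuous_intros)

lemma total_induct:
  fixes X :: "'h::complex_hilbert set"
  assumes "closure (cvec.span X) = UNIV" "cvec.subspace {x. P x}" "closed {x. P x}"
    and "\<And>x. x \<in> X \<Longrightarrow> P x"
  shows "P x"
proof -
  have "cvec.span X \<subseteq> {x. P x}" using assms(2,4) by (intro cvec.span_minimal) auto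
  then have "closure (cvec.span X) \<subseteq> {x. P x}" using assms(3) by (rule closure_minimal)
  then show ?thesis using assms(1) by auto
qed

lemma total_orthogonal_0:
  fixes X :: "'h::complex_hilbert set"
  assumes "closure (cvec.span X) = UNIV" and "\<And>u. u \<in> X \<Longrightarrow> cinner u x = 0"
  shows "x = 0"
proof -
  have "cinner y x = 0" for y
  proof (rule total_induct[OF assms(1), where P = "\<lambda>y. cinner y x = 0"])
    show "cvec.subspace {y. cinner y x = 0}"
      by (auto simp: cvec.subspace_def cinner_linear)
    show "closed {y. cinner y x = 0}"
      by (intro closed_Collect_eq continuous_intros)
  qed (use assms in auto)
  from this[of x] show ?thesis by (simp add: cinner_self)
qed

lemma total_orthogonal_eq:
  fixes X :: "'h::complex_hilbert set"
  assumes "closure (cvec.span X) = UNIV" and "\<And>u. u \<in> X \<Longrightarrow> cinner u x = cinner u y"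
  shows "x = y"
  using total_orthogonal_0[OF assms(1), of "x - y"] assms(2) by (simp add: cinner_linear)

lemma cinner_eqI: "(\<And>u. cinner u x = cinner u y) \<Longrightarrow> x = (y::'h::complex_hilbert)"
  by (metis cinner_diff_right cinner_self diff_self eq_iff_diff_eq_0 norm_eq_zero of_real_eq_0_iff
      power_eq_0_iff)

section \<open>Linear maps and bounded operators\<close>

lemma clinear_add: "clinear f \<Longrightarrow> f (x + y) = f x + f y"
  and clinear_scaleC: "clinear f \<Longrightarrow> f (c *\<^sub>C x) = c *\<^sub>C f x"
  by (auto simp: clinear_def)

lemma clinear_0: "clinear f \<Longrightarrow> f 0 = 0"
  using clinear_add[of f 0 0] by simp

lemma clinear_minus: "clinear f \<Longrightarrow> f (- x) = - f x"
  using clinear_scaleC[of f "-1" x] by simp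

lemma clinear_diff: "clinear f \<Longrightarrow> f (x - y) = f x - f y"
  using clinear_add[of f x "- y"] by (simp add: clinear_minus)

lemma clinear_sum: "clinear f \<Longrightarrow> f (sum g A) = (\<Sum>i\<in>A. f (g i))"
  by (induction A rule: infinite_finite_induct) (simp_all add: clinear_0 clinear_add)

lemma bounded_op_clinear: "bounded_op S \<Longrightarrow> clinear S"
  by (simp add: bounded_op_def)

lemmas bounded_op_add = clinear_add[OF bounded_op_clinear]
  and bounded_op_scaleC = clinear_scaleC[OF bounded_op_clinear]
  and bounded_op_0 = clinear_0[OF bounded_op_clinear]
  and bounded_op_minus = clinear_minus[OF bounded_op_clinear]
  and bounded_op_diff = clinear_diff[OF bounded_op_clinear]
  and bounded_op_sum = clinear_sum[OF bounded_op_clinear]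

lemma bounded_op_continuous:
  "bounded_op S \<Longrightarrow> continuous_on A f \<Longrightarrow> continuous_on A (\<lambda>x. S (f x))"
  by (auto simp: bounded_op_def intro: bounded_linear.continuous_on)

lemma bounded_opI:
  assumes "clinear S" and "\<And>x. norm (S x) \<le> c * norm x"
  shows "bounded_op S"
  unfolding bounded_op_def
  by (intro conjI assms(1) bounded_linear_intro[of S c])
     (use assms in \<open>auto simp: clinear_def scaleR_scaleC mult.commute\<close>)

lemma bounded_op_bound:
  assumes "bounded_op S"
  obtains c where "c > 0" "\<And>x. norm (S x) \<le> c * norm x"
  using assms bounded_linear.pos_bounded[of S] by (auto simp: bounded_op_def mult.commute)

lemma bounded_op_id: "bounded_op id"
  by (rule bounded_opI[of _ 1]) (auto simp: clinear_def)

lemma bounded_op_comp: "bounded_op S \<Longrightarrow> bounded_op T \<Longrightarrow> bounded_op (S \<circ> T)"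
  by (auto simp: bounded_op_def clinear_def o_def intro: bounded_linear_compose)

lemma bounded_op_plus: "bounded_op S \<Longrightarrow> bounded_op T \<Longrightarrow> bounded_op (\<lambda>x. S x + T x)"
  by (auto simp: bounded_op_def clinear_def scaleC_simps intro: bounded_linear_add)

lemma bounded_op_scale: "bounded_op S \<Longrightarrow> bounded_op (\<lambda>x. c *\<^sub>C S x)"
  unfolding bounded_op_def clinear_def
  by (auto simp: scaleC_simps scaleC_scaleC mult.commute
      intro: bounded_bilinear.bounded_linear_right[OF bounded_bilinear_scaleC]
        bounded_linear_compose)

lemma bounded_op_zero: "bounded_op (\<lambda>x. 0)"
  by (rule bounded_opI[of _ 0]) (auto simp: clinear_def)

lemma total_op_eq:
  assumes X: "closure (cvec.span X) = UNIV" and ST: "bounded_op S" "bounded_op T"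
    and eq: "\<And>x. x \<in> X \<Longrightarrow> S x = T x"
  shows "S = T"
proof
  fix x show "S x = T x"
  proof (rule total_induct[OF X, where P = "\<lambda>x. S x = T x"])
    show "cvec.subspace {x. S x = T x}"
      using ST by (auto simp: cvec.subspace_def bounded_op_0 bounded_op_add bounded_op_scaleC)
    show "closed {x. S x = T x}"
      by (intro closed_Collect_eq continuous_intros ST[THEN bounded_op_continuous])
  qed (rule eq)
qed

lemma total_is_adjoint:
  assumes X: "closure (cvec.span X) = UNIV" and ST: "bounded_op S" "bounded_op T"
    and eq: "\<And>x y. x \<in> X \<Longrightarrow> y \<in> X \<Longrightarrow> cinner (S x) y = cinner x (T y)"
  shows "is_adjoint S T"
  unfolding is_adjoint_def
proof safe
  fix x y show "cinner (S x) y = cinner x (T y)"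
  proof (rule total_induct[OF X, where P = "\<lambda>y. cinner (S x) y = cinner x (T y)"])
    show "cvec.subspace {y. cinner (S x) y = cinner x (T y)}"
      using ST by (auto simp: cvec.subspace_def bounded_op_0 bounded_op_add bounded_op_scaleC
          cinner_linear)
    show "closed {y. cinner (S x) y = cinner x (T y)}"
      by (intro closed_Collect_eq continuous_intros ST[THEN bounded_op_continuous])
  next
    fix y assume y: "y \<in> X"
    show "cinner (S x) y = cinner x (T y)"
    proof (rule total_induct[OF X, where P = "\<lambda>x. cinner (S x) y = cinner x (T y)"])
      show "cvec.subspace {x. cinner (S x) y = cinner x (T y)}"
        using ST by (auto simp: cvec.subspace_def bounded_op_0 bounded_op_add bounded_op_scaleC
            cinner_linear)
      show "closed {x. cinner (S x) y = cinner x (T y)}"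
        by (intro closed_Collect_eq continuous_intros ST[THEN bounded_op_continuous])
    qed (use eq y in auto)
  qed
qed

text \<open>A bound from below lifts Cauchy sequences from the image to \<open>G\<close>. A closed
  image that contains a dense subspace is everything: the extension of bounded maps and the
  surjectivity of \<open>R + c\<close> rest on this, and the comparison of domains uses it in the
  same way.\<close>

lemma closed_image_subspace:
  fixes G :: "'a::{real_normed_vector, complete_space} set" and f :: "'a \<Rightarrow> 'b::real_normed_vector"
  assumes "closed G" "subspace G" "bounded_linear f" "e > 0"
    and "\<And>p. p \<in> G \<Longrightarrow> e * norm p \<le> norm (f p)"
  shows "closed (f ` G)"
  using complete_isometric_image[OF assms(4,2,3)] assms(1,5) complete_imp_closed
  by (auto simp: complete_eq_closed)

text \<open>The estimate survives on the closure of the graph, so the projection of that closure to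
  the first coordinate is bounded below. Its image is closed and contains the dense domain.\<close>

lemma bounded_extension:
  fixes G :: "('h::complex_hilbert \<times> 'k::complex_hilbert) set"
  assumes sub: "cvec.subspace G" and le: "\<And>x y. (x, y) \<in> G \<Longrightarrow> norm y \<le> c * norm x"
    and dense: "closure (Domain G) = UNIV"
  obtains F where "bounded_op F" "\<And>x y. (x, y) \<in> G \<Longrightarrow> F x = y"
proof -
  \<comment> \<open>\<open>c\<close> may be negative, whereas \<open>1 + d\<close> has to be
    positive below.\<close>
  define d where "d = max c 0"
  have le': "norm y \<le> d * norm x" if "(x, y) \<in> closure G" for x y
  proof -
    have "G \<subseteq> {p. norm (snd p) \<le> d * norm (fst p)}"
    proof
      fix p assume "p \<in> G"
      then have "norm (snd p) \<le> c * norm (fst p)" using le[of "fst p" "snd p"] by simp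
      also have "\<dots> \<le> d * norm (fst p)" by (intro mult_right_mono) (auto simp: d_def)
      finally show "p \<in> {p. norm (snd p) \<le> d * norm (fst p)}" by simp
    qed
    moreover have "closed {p :: 'h \<times> 'k. norm (snd p) \<le> d * norm (fst p)}"
      by (intro closed_Collect_le continuous_intros)
    ultimately have "closure G \<subseteq> {p. norm (snd p) \<le> d * norm (fst p)}"
      by (rule closure_minimal)
    then show ?thesis using that by auto
  qed
  have sub': "cvec.subspace (closure G)" by (rule closure_csubspace_prod[OF sub])
  have "closed (fst ` closure G)"
  proof (rule closed_image_subspace[where e = "1 / (1 + d)"])
    show "bounded_linear (fst :: 'h \<times> 'k \<Rightarrow> 'h)" by (rule bounded_linear_fst)
    show "1 / (1 + d) > 0" by (simp add: d_def)
    fix p assume "p \<in> closure G"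
    then have "norm p \<le> norm (fst p) + d * norm (fst p)"
      using norm_Pair_le[of "fst p" "snd p"] le'[of "fst p" "snd p"] by simp
    then show "1 / (1 + d) * norm p \<le> norm (fst p)"
      by (simp add: field_simps d_def)
  qed (use csubspace_prod_imp_subspace[OF sub'] in auto)
  moreover have "Domain G \<subseteq> fst ` closure G"
    using closure_subset[of G] by (force simp: Domain_fst)
  ultimately have "closure (Domain G) \<subseteq> fst ` closure G" by (metis closure_minimal)
  then have "\<forall>x. \<exists>y. (x, y) \<in> closure G" using dense by force
  then obtain F where F: "\<And>x. (x, F x) \<in> closure G" by metis
  have un: "y = F x" if "(x, y) \<in> closure G" for x y
    using cvec.subspace_diff[OF sub' that F[of x]] le'[of 0 "y - F x"] by simp
  have "clinear F" unfolding clinear_def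
    using cvec.subspace_add[OF sub' F F] cvec.subspace_scale[OF sub' F] by (auto intro!: un[symmetric])
  then have "bounded_op F" by (rule bounded_opI) (rule le'[OF F])
  then show thesis using that un closure_subset[of G] by blast
qed

section \<open>Orthonormal sets and bases\<close>

definition orthonormal :: "'h::complex_hilbert set \<Rightarrow> bool" where
  "orthonormal B \<longleftrightarrow> (\<forall>e\<in>B. \<forall>f\<in>B. cinner e f = (if e = f then 1 else 0))"

lemma orthonormal_basis_orthonormal: "orthonormal_basis B \<Longrightarrow> orthonormal B"
  by (simp add: orthonormal_basis_def orthonormal_def)

lemma orthonormal_basis_total: "orthonormal_basis B \<Longrightarrow> closure (cvec.span B) = UNIV"
  by (simp add: orthonormal_basis_def)

lemma orthonormal_subset: "orthonormal B \<Longrightarrow> F \<subseteq> B \<Longrightarrow> orthonormal F"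
  unfolding orthonormal_def by (meson subsetD)

lemma orthonormal_cinner_sum:
  assumes "orthonormal F" "finite F" "b \<in> F"
  shows "cinner b (\<Sum>e\<in>F. c e *\<^sub>C e) = c b"
proof -
  have "cinner b (\<Sum>e\<in>F. c e *\<^sub>C e) = (\<Sum>e\<in>F. c e * cinner b e)"
    by (simp add: cinner_sum_right cinner_linear)
  also have "\<dots> = (\<Sum>e\<in>F. if b = e then c e else 0)"
    using assms by (intro sum.cong) (auto simp: orthonormal_def)
  finally show ?thesis using assms by simp
qed

text \<open>Completing the square in the coefficients. Pythagoras is the case \<open>x = 0\<close>,
  Bessel's inequality the case \<open>c b = cinner b x\<close>, and the last sum shows that the
  Fourier coefficients give the best approximation.\<close>

lemma orthonormal_norm_diff_sum:
  assumes "orthonormal F" "finite F"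
  shows "(norm (x - (\<Sum>b\<in>F. c b *\<^sub>C b)))\<^sup>2 =
    (norm x)\<^sup>2 - (\<Sum>b\<in>F. (cmod (cinner b x))\<^sup>2) + (\<Sum>b\<in>F. (cmod (cinner b x - c b))\<^sup>2)"
proof -
  define s where "s = (\<Sum>b\<in>F. c b *\<^sub>C b)"
  have bs: "cinner b s = c b" if "b \<in> F" for b
    unfolding s_def by (rule orthonormal_cinner_sum[OF assms that])
  have sz: "cinner s z = (\<Sum>b\<in>F. cnj (c b) * cinner b z)" for z
    by (simp add: s_def cinner_sum_left cinner_linear)
  have ss: "cinner s s = (\<Sum>b\<in>F. cnj (c b) * c b)"
    by (simp add: sz bs)
  have xs: "cinner x s = (\<Sum>b\<in>F. c b * cnj (cinner b x))"
    by (subst cinner_commute) (simp add: sz)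
  have q: "(cmod (a - d))\<^sup>2 = (cmod a)\<^sup>2 - Re (cnj d * a) - Re (d * cnj a) + Re (cnj d * d)" for a d
    by (simp add: cmod_power2) (simp add: power2_eq_square algebra_simps)
  have "(norm (x - s))\<^sup>2 = (norm x)\<^sup>2 - Re (cinner s x) - Re (cinner x s) + Re (cinner s s)"
    by (simp add: norm_sq_cinner cinner_linear)
  also have "\<dots> = (norm x)\<^sup>2 + (\<Sum>b\<in>F. - Re (cnj (c b) * cinner b x) - Re (c b * cnj (cinner b x))
      + Re (cnj (c b) * c b))"
    by (simp add: sz[of x] xs ss sum.distrib sum_subtractf sum_negf
        sum_distrib_left[symmetric])
  also have "\<dots> = (norm x)\<^sup>2 + (\<Sum>b\<in>F. (cmod (cinner b x - c b))\<^sup>2 - (cmod (cinner b x))\<^sup>2)"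
    by (rule arg_cong[where f = "\<lambda>t. (norm x)\<^sup>2 + t"], rule sum.cong) (auto simp: q)
  finally show ?thesis by (simp add: s_def sum_subtractf)
qed

lemma orthonormal_norm_sum:
  assumes "orthonormal F" "finite F"
  shows "(norm (\<Sum>b\<in>F. c b *\<^sub>C b))\<^sup>2 = (\<Sum>b\<in>F. (cmod (c b))\<^sup>2)"
  using orthonormal_norm_diff_sum[OF assms, of 0 c] by simp

lemma bessel_inequality:
  assumes "orthonormal F" "finite F"
  shows "(\<Sum>b\<in>F. (cmod (cinner b x))\<^sup>2) \<le> (norm x)\<^sup>2"
  using orthonormal_norm_diff_sum[OF assms, of x "\<lambda>b. cinner b x"]
    zero_le_power2[of "norm (x - (\<Sum>b\<in>F. cinner b x *\<^sub>C b))"] by simp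

lemma has_sum_orthonormal_basis:
  assumes B: "orthonormal_basis B"
  shows "((\<lambda>b. cinner b x *\<^sub>C b) has_sum x) B"
  unfolding has_sum_def
proof (rule tendstoI)
  fix e :: real assume e: "e > 0"
  obtain u where u: "u \<in> cvec.span B" "dist u x < e"
    using orthonormal_basis_total[OF B] e closure_approachable[of x "cvec.span B"] by auto
  then obtain F c where F: "finite F" "F \<subseteq> B" "u = (\<Sum>b\<in>F. c b *\<^sub>C b)"
    by (auto simp: cvec.span_explicit)
  show "\<forall>\<^sub>F G in finite_subsets_at_top B. dist (\<Sum>b\<in>G. cinner b x *\<^sub>C b) x < e"
    unfolding eventually_finite_subsets_at_top
  proof (intro exI[of _ F] conjI allI impI F)
    fix G assume G: "finite G \<and> F \<subseteq> G \<and> G \<subseteq> B"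
    \<comment> \<open>The coefficients of \<open>u\<close> padded by 0: the Fourier sum over the
      larger \<open>G\<close> is at least as close to \<open>x\<close> as any combination from
      \<open>G\<close>, hence as \<open>u\<close>.\<close>
    define d where "d b = (if b \<in> F then c b else 0)" for b
    have "u = (\<Sum>b\<in>G. d b *\<^sub>C b)"
      unfolding F(3) using G by (intro sum.mono_neutral_cong_left) (auto simp: d_def)
    moreover have on: "orthonormal G"
      using orthonormal_subset[OF orthonormal_basis_orthonormal[OF B]] G by blast
    ultimately have "(norm (x - (\<Sum>b\<in>G. cinner b x *\<^sub>C b)))\<^sup>2 \<le> (norm (x - u))\<^sup>2"
      using orthonormal_norm_diff_sum[OF on, of x "\<lambda>b. cinner b x"]
        orthonormal_norm_diff_sum[OF on, of x d] G sum_nonneg[of G "\<lambda>b. (cmod (cinner b x - d b))\<^sup>2"]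
      by auto
    then have "norm (x - (\<Sum>b\<in>G. cinner b x *\<^sub>C b)) \<le> norm (x - u)"
      by (rule power2_le_imp_le) simp
    then show "dist (\<Sum>b\<in>G. cinner b x *\<^sub>C b) x < e"
      using u by (simp add: dist_norm norm_minus_commute)
  qed
qed

lemma parseval:
  assumes "orthonormal_basis B"
  shows "((\<lambda>b. cnj (cinner b x) * cinner b y) has_sum cinner x y) B"
proof -
  have "((\<lambda>b. cinner x (cinner b y *\<^sub>C b)) has_sum cinner x y) B"
    by (intro has_sum_bounded_linear[OF _ has_sum_orthonormal_basis[OF assms]]
        bounded_bilinear.bounded_linear_right[OF bounded_bilinear_cinner])
  also have "(\<lambda>b. cinner x (cinner b y *\<^sub>C b)) = (\<lambda>b. cnj (cinner b x) * cinner b y)"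
    using cinner_commute[of x] by (auto simp: cinner_linear mult.commute fun_eq_iff)
  finally show ?thesis .
qed

lemma parseval_norm:
  assumes "orthonormal_basis B"
  shows "((\<lambda>b. (cmod (cinner b x))\<^sup>2) has_sum (norm x)\<^sup>2) B"
proof -
  have "((\<lambda>b. Re (cnj (cinner b x) * cinner b x)) has_sum Re (cinner x x)) B"
    by (intro has_sum_bounded_linear[OF _ parseval[OF assms]] bounded_linear_Re)
  also have "(\<lambda>b. Re (cnj (cinner b x) * cinner b x)) = (\<lambda>b. (cmod (cinner b x))\<^sup>2)"
    by (simp add: cmod_power2) (simp add: power2_eq_square)
  finally show ?thesis by (simp add: norm_sq_cinner)
qed

lemma orthonormal_basis_eqI:
  assumes "orthonormal_basis B" "\<And>b. b \<in> B \<Longrightarrow> cinner b x = cinner b y"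
  shows "x = y"
  using total_orthogonal_eq[OF orthonormal_basis_total] assms by blast

text \<open>The squared distance of two nested partial sums is a difference of partial sums of a
  summable series, so the net of partial sums is Cauchy. Pairing its limit with \<open>b\<close>
  recovers \<open>c b\<close>.\<close>

lemma riesz_fischer:
  fixes B :: "'h::complex_hilbert set"
  assumes B: "orthonormal B" and c: "(\<lambda>b. (cmod (c b))\<^sup>2) summable_on B"
  obtains y where "\<And>b. b \<in> B \<Longrightarrow> cinner b y = c b"
proof -
  let ?s = "\<lambda>G. \<Sum>b\<in>G. c b *\<^sub>C b" and ?n = "\<lambda>G. \<Sum>b\<in>G. (cmod (c b))\<^sup>2"
  define S where "S = infsum (\<lambda>b. (cmod (c b))\<^sup>2) B"
  have hs: "(?n \<longlongrightarrow> S) (finite_subsets_at_top B)"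
    using c by (simp add: S_def has_sum_def[symmetric] has_sum_infsum)
  have near: "\<exists>F. finite F \<and> F \<subseteq> B \<and> (\<forall>G. finite G \<and> F \<subseteq> G \<and> G \<subseteq> B \<longrightarrow> dist (?s G) (?s F) < e)"
    if e: "e > 0" for e :: real
  proof -
    have "\<forall>\<^sub>F G in finite_subsets_at_top B. dist (?n G) S < e\<^sup>2"
      using e by (intro tendstoD[OF hs]) auto
    then obtain F where F: "finite F" "F \<subseteq> B" "dist (?n F) S < e\<^sup>2"
      by (auto simp: eventually_finite_subsets_at_top)
    have "dist (?s G) (?s F) < e" if G: "finite G" "F \<subseteq> G" "G \<subseteq> B" for G
    proof -
      have "(norm (?s G - ?s F))\<^sup>2 = (norm (?s (G - F)))\<^sup>2"
        using G F by (simp add: sum_diff)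
      also have "\<dots> = ?n (G - F)"
        using G B by (intro orthonormal_norm_sum) (auto intro: orthonormal_subset)
      also have "\<dots> = ?n G - ?n F" using G F by (simp add: sum_diff)
      also have "\<dots> \<le> S - ?n F"
        using finite_sum_le_infsum[OF c G(1,3)] by (simp add: S_def)
      also have "\<dots> < e\<^sup>2" using F(3) by (simp add: dist_real_def)
      finally show ?thesis using e by (simp add: dist_norm power2_less_imp_less)
    qed
    then show ?thesis using F by blast
  qed
  have "cauchy_filter (filtermap ?s (finite_subsets_at_top B))"
    unfolding cauchy_filter_metric_filtermap
  proof (intro allI impI)
    fix e :: real assume "e > 0"
    then obtain F where F: "finite F" "F \<subseteq> B"
      "\<And>G. finite G \<and> F \<subseteq> G \<and> G \<subseteq> B \<Longrightarrow> dist (?s G) (?s F) < e / 2"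
      using near[of "e / 2"] by auto
    define P where "P G \<longleftrightarrow> finite G \<and> F \<subseteq> G \<and> G \<subseteq> B" for G
    have "eventually P (finite_subsets_at_top B)"
      unfolding eventually_finite_subsets_at_top P_def using F by auto
    moreover have "dist (?s G) (?s G') < e" if "P G" "P G'" for G G'
      using that F(3) dist_triangle_half_l[of "?s G" "?s F" e "?s G'"] by (auto simp: P_def)
    ultimately show "\<exists>P. eventually P (finite_subsets_at_top B) \<and>
        (\<forall>x y. P x \<and> P y \<longrightarrow> dist (?s x) (?s y) < e)" by blast
  qed
  moreover have "complete (UNIV :: 'h set)"
    by (meson Cauchy_convergent UNIV_I complete_def convergent_def)
  ultimately obtain y where y: "(?s \<longlongrightarrow> y) (finite_subsets_at_top B)"
    using complete_uniform[where S = UNIV] by (force simp add: filterlim_def)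
  have "cinner b y = c b" if b: "b \<in> B" for b
  proof -
    have "((\<lambda>G. cinner b (?s G)) \<longlongrightarrow> cinner b y) (finite_subsets_at_top B)"
      by (intro tendsto_intros y)
    moreover have "\<forall>\<^sub>F G in finite_subsets_at_top B. cinner b (?s G) = c b"
      unfolding eventually_finite_subsets_at_top
    proof (intro exI[of _ "{b}"] conjI allI impI)
      fix G assume "finite G \<and> {b} \<subseteq> G \<and> G \<subseteq> B"
      then show "cinner b (?s G) = c b"
        using orthonormal_cinner_sum[OF orthonormal_subset[OF B]] by auto
    qed (use b in auto)
    ultimately have "((\<lambda>G. c b) \<longlongrightarrow> cinner b y) (finite_subsets_at_top B)"
      using tendsto_cong by force
    then show ?thesis by (simp add: tendsto_const_iff)
  qed
  then show thesis using that by blast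
qed

section \<open>Diagonal operators\<close>

text \<open>The choice is determined as soon as \<open>B\<close> is an orthonormal basis and
  \<open>g\<close> is bounded on \<open>B\<close>: existence is the Riesz-Fischer theorem,
  uniqueness is totality of \<open>B\<close>.\<close>

definition diag_op :: "'h::complex_hilbert set \<Rightarrow> ('h \<Rightarrow> real) \<Rightarrow> 'h \<Rightarrow> 'h" where
  "diag_op B g x = (SOME y. \<forall>b\<in>B. cinner b y = complex_of_real (g b) * cinner b x)"

lemma cinner_diag_op:
  assumes B: "orthonormal_basis B" and g: "\<And>b. b \<in> B \<Longrightarrow> \<bar>g b\<bar> \<le> M" and b: "b \<in> B"
  shows "cinner b (diag_op B g x) = complex_of_real (g b) * cinner b x"
proof -
  have "(\<lambda>b. M\<^sup>2 * (cmod (cinner b x))\<^sup>2) summable_on B"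
    using parseval_norm[OF B, of x] by (intro summable_on_cmult_right) (rule has_sum_imp_summable)
  then have "(\<lambda>b. (cmod (complex_of_real (g b) * cinner b x))\<^sup>2) summable_on B"
  proof (rule summable_on_comparison_test)
    fix b assume "b \<in> B"
    then have "\<bar>g b\<bar> * \<bar>g b\<bar> \<le> M * M" using g by (intro mult_mono) force+
    then show "(cmod (complex_of_real (g b) * cinner b x))\<^sup>2 \<le> M\<^sup>2 * (cmod (cinner b x))\<^sup>2"
      by (simp add: norm_mult power_mult_distrib power2_eq_square[of M] power2_eq_square[of "g b"] mult_right_mono)
  qed simp
  then obtain y where "\<And>b. b \<in> B \<Longrightarrow> cinner b y = complex_of_real (g b) * cinner b x"
    by (rule riesz_fischer[OF orthonormal_basis_orthonormal[OF B]]) blast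
  then have "\<exists>y. \<forall>b\<in>B. cinner b y = complex_of_real (g b) * cinner b x" by blast
  then show ?thesis unfolding diag_op_def using someI_ex[of "\<lambda>y. \<forall>b\<in>B. cinner b y = complex_of_real (g b) * cinner b x"] b
    by blast
qed

lemma norm_diag_op_le:
  assumes B: "orthonormal_basis B" and g: "\<And>b. b \<in> B \<Longrightarrow> \<bar>g b\<bar> \<le> M" and M: "0 \<le> M"
  shows "norm (diag_op B g x) \<le> M * norm x"
proof (rule power2_le_imp_le)
  have "(norm (diag_op B g x))\<^sup>2 \<le> M\<^sup>2 * (norm x)\<^sup>2"
  proof (rule has_sum_mono[OF parseval_norm[OF B] has_sum_cmult_right[OF parseval_norm[OF B]]])
    fix b assume b: "b \<in> B"
    then have "\<bar>g b\<bar> * \<bar>g b\<bar> \<le> M * M" using g by (intro mult_mono) force+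
    then show "(cmod (cinner b (diag_op B g x)))\<^sup>2 \<le> M\<^sup>2 * (cmod (cinner b x))\<^sup>2"
      by (simp add: cinner_diag_op[OF B g b] norm_mult power_mult_distrib power2_eq_square[of M]
          power2_eq_square[of "g b"] mult_right_mono)
  qed
  then show "(norm (diag_op B g x))\<^sup>2 \<le> (M * norm x)\<^sup>2"
    by (simp add: power_mult_distrib)
qed (use M in simp)

lemma bounded_op_diag_op:
  assumes B: "orthonormal_basis B" and g: "\<And>b. b \<in> B \<Longrightarrow> \<bar>g b\<bar> \<le> M"
  shows "bounded_op (diag_op B g)"
proof (rule bounded_opI)
  note d = cinner_diag_op[OF B g]
  show "clinear (diag_op B g)"
    unfolding clinear_def
    by (intro conjI allI orthonormal_basis_eqI[OF B]) (simp_all add: d cinner_linear algebra_simps)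
  show "norm (diag_op B g x) \<le> max M 0 * norm x" for x
    by (rule norm_diag_op_le[OF B]) (use g in \<open>force simp: le_max_iff_disj\<close>)+
qed

lemma is_adjoint_diag_op:
  assumes B: "orthonormal_basis B" and g: "\<And>b. b \<in> B \<Longrightarrow> \<bar>g b\<bar> \<le> M"
  shows "is_adjoint (diag_op B g) (diag_op B g)"
  unfolding is_adjoint_def
proof (intro allI)
  note d = cinner_diag_op[OF B g]
  fix x y
  have "cnj (cinner b (diag_op B g x)) * cinner b y = cnj (cinner b x) * cinner b (diag_op B g y)"
    if "b \<in> B" for b using that by (simp add: d)
  then show "cinner (diag_op B g x) y = cinner x (diag_op B g y)"
    using parseval[OF B, of "diag_op B g x" y] parseval[OF B, of x "diag_op B g y"]
    by (metis (no_types, lifting) has_sum_cong has_sum_unique)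
qed

lemma diag_op_nonneg_positive:
  assumes B: "orthonormal_basis B" and g: "\<And>b. b \<in> B \<Longrightarrow> \<bar>g b\<bar> \<le> M"
    and g0: "\<And>b. b \<in> B \<Longrightarrow> 0 \<le> g b"
  shows "positive_op (diag_op B g)"
  unfolding positive_op_def
proof (intro conjI allI bounded_op_diag_op[OF B g])
  note d = cinner_diag_op[OF B g]
  fix x
  have h: "((\<lambda>b. cnj (cinner b x) * cinner b (diag_op B g x)) has_sum cinner x (diag_op B g x)) B"
    by (rule parseval[OF B])
  have e: "cnj (cinner b x) * cinner b (diag_op B g x) = complex_of_real (g b * (cmod (cinner b x))\<^sup>2)"
    if "b \<in> B" for b using that complex_norm_square[of "cinner b x"] by (simp add: d mult.commute)
  have "cinner (diag_op B g x) x = cinner x (diag_op B g x)"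
    using is_adjoint_diag_op[OF B g] by (simp add: is_adjoint_def)
  then show "cinner x (diag_op B g x) \<in> \<real>"
    using cinner_commute[of x "diag_op B g x"] by (metis Reals_cnj_iff)
  have "((\<lambda>b. Re (cnj (cinner b x) * cinner b (diag_op B g x))) has_sum Re (cinner x (diag_op B g x))) B"
    by (intro has_sum_bounded_linear[OF _ h] bounded_linear_Re)
  then show "0 \<le> Re (cinner x (diag_op B g x))"
    by (rule has_sum_nonneg) (simp add: e g0)
qed

section \<open>Spectral measures of diagonal operators\<close>

text \<open>Series over \<open>B\<close> are read as integrals over counting measure, because the
  scalar spectral measures of diagonal operators are images of weighted counting measures.\<close>

lemma integrable_count_space_iff:
  fixes f :: "'a \<Rightarrow> real"
  shows "integrable (count_space B) f \<longleftrightarrow> f summable_on B"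
  by (metis abs_summable_equivalent abs_summable_on_def summable_on_iff_abs_summable_on_real)

lemma integral_count_space_has_sum:
  fixes f :: "'a \<Rightarrow> real"
  assumes "(f has_sum s) B"
  shows "(\<integral>b. f b \<partial>count_space B) = s"
proof -
  have "integrable (count_space B) f"
    using assms by (simp add: integrable_count_space_iff has_sum_imp_summable)
  then show ?thesis
    using assms infsetsum_infsum[of f B] by (simp add: infsumI infsetsum_def abs_summable_on_def)
qed

lemma nn_integral_count_space_has_sum:
  fixes f :: "'a \<Rightarrow> real"
  assumes "\<And>b. b \<in> B \<Longrightarrow> 0 \<le> f b" and "(f has_sum s) B"
  shows "(\<integral>\<^sup>+b. ennreal (f b) \<partial>count_space B) = ennreal s"
  using assms integral_count_space_has_sum[OF assms(2)]
  by (subst nn_integral_eq_integral)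
     (auto simp: integrable_count_space_iff AE_count_space has_sum_imp_summable)

definition diag_pvm :: "'h::complex_hilbert set \<Rightarrow> ('h \<Rightarrow> real) \<Rightarrow> real set \<Rightarrow> 'h \<Rightarrow> 'h" where
  "diag_pvm B l A = diag_op B (\<lambda>b. indicator A (l b))"

text \<open>For an orthonormal basis \<open>B\<close> this carries the maximal domain: a partner
  \<open>y\<close> exists exactly when the numbers \<open>l b * cinner b x\<close> are square
  summable over \<open>B\<close>.\<close>

definition diag_operator :: "'h::complex_hilbert set \<Rightarrow> ('h \<Rightarrow> real) \<Rightarrow> 'h operator" where
  "diag_operator B l = {(x, y). \<forall>b\<in>B. cinner b y = complex_of_real (l b) * cinner b x}"

context
  fixes B :: "'h::complex_hilbert set" and l :: "'h \<Rightarrow> real"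
  assumes B: "orthonormal_basis B"
begin

lemma cinner_diag_pvm:
  "b \<in> B \<Longrightarrow> cinner b (diag_pvm B l A x) = complex_of_real (indicator A (l b)) * cinner b x"
  unfolding diag_pvm_def by (rule cinner_diag_op[OF B, of _ 1]) (auto simp: indicator_def)

lemma bounded_op_diag_pvm: "bounded_op (diag_pvm B l A)"
  unfolding diag_pvm_def by (rule bounded_op_diag_op[OF B, of _ 1]) (auto simp: indicator_def)

lemma norm_diag_pvm_le: "norm (diag_pvm B l A x) \<le> norm x"
  using norm_diag_op_le[OF B, of "\<lambda>b. indicator A (l b)" 1 x]
  by (auto simp: indicator_def diag_pvm_def)

lemma is_adjoint_diag_pvm: "is_adjoint (diag_pvm B l A) (diag_pvm B l A)"
  unfolding diag_pvm_def by (rule is_adjoint_diag_op[OF B, of _ 1]) (auto simp: indicator_def)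

lemma diag_pvm_idem: "diag_pvm B l A \<circ> diag_pvm B l A = diag_pvm B l A"
proof
  fix x show "(diag_pvm B l A \<circ> diag_pvm B l A) x = diag_pvm B l A x"
    by (rule orthonormal_basis_eqI[OF B]) (simp add: cinner_diag_pvm indicator_def)
qed

lemma diag_pvm_basis:
  assumes "b \<in> B" shows "diag_pvm B l A b = complex_of_real (indicator A (l b)) *\<^sub>C b"
proof (rule orthonormal_basis_eqI[OF B])
  fix c assume "c \<in> B"
  then show "cinner c (diag_pvm B l A b) = cinner c (complex_of_real (indicator A (l b)) *\<^sub>C b)"
    using assms B by (auto simp: cinner_diag_pvm cinner_linear orthonormal_basis_def)
qed

text \<open>The remainders \<open>R N\<close> act as contractions, and each basis vector is
  annihilated by all late ones. Approximating \<open>x\<close> by a finite Fourier sum then gives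
  strong convergence to 0.\<close>

lemma diag_pvm_sums:
  assumes A: "disjoint_family A"
  shows "(\<lambda>n. diag_pvm B l (A n) x) sums diag_pvm B l (\<Union>n. A n) x"
proof -
  define R where "R N = (\<Union>n. A n) - (\<Union>n<N. A n)" for N
  have ind: "indicator (\<Union>n. A n) t - (\<Sum>n<N. indicator (A n) t) = (indicator (R N) t :: real)"
    for t and N :: nat
  proof -
    have "(\<Sum>n<N. indicator (A n) t) = (indicator (\<Union>n<N. A n) t :: real)"
      by (rule indicator_UN_disjoint[symmetric])
         (use A in \<open>auto intro: disjoint_family_on_mono\<close>)
    then show ?thesis by (auto simp: R_def indicator_def)
  qed
  have eq: "diag_pvm B l (\<Union>n. A n) x - (\<Sum>n<N. diag_pvm B l (A n) x) = diag_pvm B l (R N) x" for N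
  proof (rule orthonormal_basis_eqI[OF B])
    fix b assume b: "b \<in> B"
    show "cinner b (diag_pvm B l (\<Union>n. A n) x - (\<Sum>n<N. diag_pvm B l (A n) x)) =
        cinner b (diag_pvm B l (R N) x)"
      using b by (simp add: cinner_linear cinner_sum_right cinner_diag_pvm ind[of "l b" N, symmetric]
          sum_distrib_right left_diff_distrib)
  qed
  have "(\<lambda>N. diag_pvm B l (R N) x) \<longlonglongrightarrow> 0"
  proof (rule LIMSEQ_I)
    fix e :: real assume e: "e > 0"
    have "((\<lambda>F. \<Sum>b\<in>F. cinner b x *\<^sub>C b) \<longlongrightarrow> x) (finite_subsets_at_top B)"
      using has_sum_orthonormal_basis[OF B] by (simp add: has_sum_def)
    then have "\<forall>\<^sub>F F in finite_subsets_at_top B. dist (\<Sum>b\<in>F. cinner b x *\<^sub>C b) x < e"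
      using e by (rule tendstoD)
    then obtain F where F: "finite F" "F \<subseteq> B" "dist (\<Sum>b\<in>F. cinner b x *\<^sub>C b) x < e"
      by (auto simp: eventually_finite_subsets_at_top)
    define u where "u = (\<Sum>b\<in>F. cinner b x *\<^sub>C b)"
    have "\<forall>b. \<exists>N. \<forall>n\<ge>N. l b \<notin> R n"
    proof
      fix b show "\<exists>N. \<forall>n\<ge>N. l b \<notin> R n"
      proof (cases "l b \<in> (\<Union>n. A n)")
        case True
        then obtain k where "l b \<in> A k" by auto
        then show ?thesis by (intro exI[of _ "Suc k"]) (auto simp: R_def)
      qed (auto simp: R_def)
    qed
    then obtain K where K: "\<And>b n. n \<ge> K b \<Longrightarrow> l b \<notin> R n" by metis
    \<comment> \<open>\<open>insert 0\<close> keeps the maximum meaningful when \<open>F\<close> is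
      empty.\<close>
    define N where "N = Max (insert 0 (K ` F))"
    have "norm (diag_pvm B l (R n) x) < e" if n: "n \<ge> N" for n
    proof -
      have "K b \<le> n" if "b \<in> F" for b
        using n F(1) that Max_ge[of "insert 0 (K ` F)" "K b"] by (auto simp: N_def)
      then have "l b \<notin> R n" if "b \<in> F" for b using that K by blast
      then have "diag_pvm B l (R n) u = 0"
        unfolding u_def bounded_op_sum[OF bounded_op_diag_pvm] using F
        by (intro sum.neutral ballI)
           (simp add: bounded_op_scaleC[OF bounded_op_diag_pvm] diag_pvm_basis subset_iff)
      then have "diag_pvm B l (R n) x = diag_pvm B l (R n) (x - u)"
        by (simp add: bounded_op_diff[OF bounded_op_diag_pvm])
      also have "norm \<dots> \<le> norm (x - u)" by (rule norm_diag_pvm_le)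
      finally show ?thesis using F(3) by (simp add: u_def dist_norm norm_minus_commute)
    qed
    then show "\<exists>N. \<forall>n\<ge>N. norm (diag_pvm B l (R n) x - 0) < e" by auto
  qed
  then have "(\<lambda>N. diag_pvm B l (\<Union>n. A n) x - diag_pvm B l (R N) x) \<longlonglongrightarrow> diag_pvm B l (\<Union>n. A n) x"
    using tendsto_diff[OF tendsto_const] by fastforce
  then show ?thesis by (simp add: sums_def eq[symmetric])
qed

lemma projection_valued_measure_diag_pvm: "projection_valued_measure (diag_pvm B l)"
proof -
  have "diag_pvm B l UNIV = id"
  proof
    fix x show "diag_pvm B l UNIV x = id x"
      by (rule orthonormal_basis_eqI[OF B]) (simp add: cinner_diag_pvm)
  qed
  then show ?thesis
    unfolding projection_valued_measure_def
    using bounded_op_diag_pvm is_adjoint_diag_pvm diag_pvm_idem diag_pvm_sums by blast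
qed

lemma scalar_measure_diag_pvm:
  "scalar_measure (diag_pvm B l) x =
    distr (density (count_space B) (\<lambda>b. ennreal ((cmod (cinner b x))\<^sup>2))) borel l"
    (is "_ = ?M")
proof -
  have em: "emeasure ?M A = ennreal (Re (cinner x (diag_pvm B l A x)))" if A: "A \<in> sets borel" for A
  proof -
    have "emeasure ?M A = (\<integral>\<^sup>+b. ennreal ((cmod (cinner b x))\<^sup>2) * indicator (l -` A \<inter> B) b \<partial>count_space B)"
      using A by (subst emeasure_distr) (auto simp: emeasure_density)
    also have "\<dots> = (\<integral>\<^sup>+b. ennreal ((cmod (cinner b (diag_pvm B l A x)))\<^sup>2) \<partial>count_space B)"
      by (rule nn_integral_cong) (auto simp: cinner_diag_pvm indicator_def)
    also have "\<dots> = ennreal ((norm (diag_pvm B l A x))\<^sup>2)"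
      by (rule nn_integral_count_space_has_sum[OF _ parseval_norm[OF B]]) simp
    also have "(norm (diag_pvm B l A x))\<^sup>2 = Re (cinner x (diag_pvm B l A x))"
      using is_adjoint_diag_pvm[of A] fun_cong[OF diag_pvm_idem[of A], of x]
      by (simp add: norm_sq_cinner is_adjoint_def)
    finally show ?thesis .
  qed
  have "?M = measure_of (space ?M) (sets ?M) (emeasure ?M)" by (rule measure_of_of_measure[symmetric])
  also have "\<dots> = measure_of UNIV (sets borel) (emeasure ?M)" by simp
  also have "\<dots> = scalar_measure (diag_pvm B l) x"
    unfolding scalar_measure_def
    by (rule measure_of_eq) (auto simp: em sets.sigma_sets_eq[of borel, simplified])
  finally show ?thesis by simp
qed

lemma linear_operator_diag_operator: "linear_operator (diag_operator B g)"
  unfolding linear_operator_def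
proof
  show "cvec.subspace (diag_operator B g)"
    by (auto simp: cvec.subspace_def diag_operator_def cinner_linear algebra_simps zero_prod_def)
  show "single_valued (diag_operator B g)"
    by (auto simp: single_valued_def diag_operator_def intro!: orthonormal_basis_eqI[OF B])
qed

lemma is_spectral_integral_diag:
  assumes f [measurable]: "f \<in> borel_measurable borel"
  shows "is_spectral_integral (diag_pvm B l) f (diag_operator B (\<lambda>b. f (l b)))"
proof -
  let ?w = "\<lambda>x b. (cmod (cinner b x))\<^sup>2"
  have int: "integrable (scalar_measure (diag_pvm B l) x) h \<longleftrightarrow> (\<lambda>b. ?w x b * h (l b)) summable_on B"
    if [measurable]: "h \<in> borel_measurable borel" for x and h :: "real \<Rightarrow> real"
    unfolding scalar_measure_diag_pvm
    by (subst integrable_distr_eq) (auto simp: integrable_density integrable_count_space_iff)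
  have sq: "?w y b = ?w x b * (f (l b))\<^sup>2" if "(x, y) \<in> diag_operator B (\<lambda>b. f (l b))" "b \<in> B" for x y b
    using that by (simp add: diag_operator_def norm_mult power_mult_distrib)
  have dom: "x \<in> Domain (diag_operator B (\<lambda>b. f (l b))) \<longleftrightarrow>
      (\<lambda>b. ?w x b * (f (l b))\<^sup>2) summable_on B" for x
  proof
    assume "x \<in> Domain (diag_operator B (\<lambda>b. f (l b)))"
    then obtain y where y: "(x, y) \<in> diag_operator B (\<lambda>b. f (l b))" by auto
    have "?w y summable_on B" using parseval_norm[OF B] by (rule has_sum_imp_summable)
    then show "(\<lambda>b. ?w x b * (f (l b))\<^sup>2) summable_on B"
      by (rule summable_on_cong[THEN iffD1, rotated]) (rule sq[OF y])
  next
    assume "(\<lambda>b. ?w x b * (f (l b))\<^sup>2) summable_on B"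
    also have "(\<lambda>b. ?w x b * (f (l b))\<^sup>2) = (\<lambda>b. (cmod (complex_of_real (f (l b)) * cinner b x))\<^sup>2)"
      by (simp add: norm_mult power_mult_distrib mult.commute)
    finally obtain y where "\<And>b. b \<in> B \<Longrightarrow> cinner b y = complex_of_real (f (l b)) * cinner b x"
      by (rule riesz_fischer[OF orthonormal_basis_orthonormal[OF B]]) blast
    then show "x \<in> Domain (diag_operator B (\<lambda>b. f (l b)))" by (auto simp: diag_operator_def)
  qed
  have form: "cinner x y = complex_of_real (\<integral>t. f t \<partial>scalar_measure (diag_pvm B l) x)"
    if xy: "(x, y) \<in> diag_operator B (\<lambda>b. f (l b))" for x y
  proof -
    have e: "cnj (cinner b x) * cinner b y = complex_of_real (?w x b * f (l b))" if "b \<in> B" for b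
      using that xy complex_norm_square[of "cinner b x"] by (simp add: diag_operator_def mult.commute)
    have hs: "((\<lambda>b. complex_of_real (?w x b * f (l b))) has_sum cinner x y) B"
      using parseval[OF B, of x y] by (rule has_sum_cong[THEN iffD1, rotated]) (rule e)
    \<comment> \<open>The form has to equal a real integral inside the complex numbers, so the
      vanishing of its imaginary part is checked apart from the value of its real part.\<close>
    then have "((\<lambda>b. Im (complex_of_real (?w x b * f (l b)))) has_sum Im (cinner x y)) B"
      by (intro has_sum_bounded_linear[OF bounded_linear_Im])
    then have "((\<lambda>b. 0) has_sum Im (cinner x y)) B" by simp
    then have im: "Im (cinner x y) = 0" using has_sum_0_simp by (rule has_sum_unique)
    have "((\<lambda>b. Re (complex_of_real (?w x b * f (l b)))) has_sum Re (cinner x y)) B"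
      using hs by (intro has_sum_bounded_linear[OF bounded_linear_Re])
    then have "((\<lambda>b. ?w x b * f (l b)) has_sum Re (cinner x y)) B" by simp
    then have "(\<integral>b. ?w x b * f (l b) \<partial>count_space B) = Re (cinner x y)"
      by (rule integral_count_space_has_sum)
    then have "(\<integral>t. f t \<partial>scalar_measure (diag_pvm B l) x) = Re (cinner x y)"
      unfolding scalar_measure_diag_pvm
      by (subst integral_distr) (auto simp: integral_density)
    then show ?thesis using im by (simp add: complex_eq_iff)
  qed
  show ?thesis
    unfolding is_spectral_integral_def
    using linear_operator_diag_operator dom int[of "\<lambda>t. (f t)\<^sup>2"] form by auto
qed

lemma graph_diag_op:
  assumes "\<And>b. b \<in> B \<Longrightarrow> \<bar>g b\<bar> \<le> M"
  shows "graph (diag_op B g) = diag_operator B g"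
  using cinner_diag_op[OF B assms] orthonormal_basis_eqI[OF B]
  unfolding graph_def diag_operator_def by force

text \<open>A nonnegative diagonal operator is its own absolute value, and its diagonal matrix
  elements along \<open>B\<close> are the values of \<open>g\<close>.\<close>

lemma trace_class_diag_op:
  assumes g: "\<And>b. b \<in> B \<Longrightarrow> \<bar>g b\<bar> \<le> M" and g0: "\<And>b. b \<in> B \<Longrightarrow> 0 \<le> g b" and sum: "g summable_on B"
  shows "trace_class (diag_op B g)"
proof -
  have "Re (cinner b (diag_op B g b)) = g b" if "b \<in> B" for b
    using cinner_diag_op[OF B g that, where x = b] that B by (simp add: orthonormal_basis_def)
  then have "(\<lambda>b. Re (cinner b (diag_op B g b))) summable_on B"
    using sum by (metis (no_types, lifting) summable_on_cong)
  moreover have "is_abs_op (diag_op B g) (diag_op B g)"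
    unfolding is_abs_op_def
    by (intro conjI exI[of _ "diag_op B g"] diag_op_nonneg_positive[OF B] is_adjoint_diag_op[OF B])
       (fact g g0 refl)+
  moreover have "bounded_op (diag_op B g)" by (rule bounded_op_diag_op[OF B]) (fact g)
  ultimately show ?thesis
    unfolding trace_class_def using B by blast
qed

lemma heat_trace_class_diag_operator:
  assumes l0: "\<And>b. b \<in> B \<Longrightarrow> 0 \<le> l b" and sum: "(\<lambda>b. exp (- \<epsilon> * l b)) summable_on B" and e: "\<epsilon> > 0"
  shows "\<exists>E. is_function_of (diag_operator B l) (\<lambda>t. exp (- \<epsilon> * t)) (graph E) \<and> trace_class E"
proof (intro exI conjI)
  let ?g = "\<lambda>b. exp (- \<epsilon> * l b)"
  have g: "\<bar>?g b\<bar> \<le> 1" if "b \<in> B" for b using l0[OF that] e by simp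
  have gr: "graph (diag_op B ?g) = diag_operator B ?g" by (rule graph_diag_op) (rule g)
  show "trace_class (diag_op B ?g)" by (rule trace_class_diag_op[OF g _ sum]) auto
  show "is_function_of (diag_operator B l) (\<lambda>t. exp (- \<epsilon> * t)) (graph (diag_op B ?g))"
    unfolding is_function_of_def gr
    by (intro exI[of _ "diag_pvm B l"] conjI projection_valued_measure_diag_pvm
        is_spectral_integral_diag) measurable
qed

end

section \<open>Self-adjoint operators with a total set of eigenvectors\<close>

text \<open>Imposed on arbitrary relations, so that it passes to spans and closures before
  single-valuedness is known; density of the domain yields the latter afterwards.\<close>

definition symmetric_op :: "'h::complex_hilbert operator \<Rightarrow> bool" where
  "symmetric_op T \<longleftrightarrow> (\<forall>x w u v. (x, w) \<in> T \<longrightarrow> (u, v) \<in> T \<longrightarrow> cinner w u = cinner x v)"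

lemma symmetric_opD: "symmetric_op T \<Longrightarrow> (x, w) \<in> T \<Longrightarrow> (u, v) \<in> T \<Longrightarrow> cinner w u = cinner x v"
  by (auto simp: symmetric_op_def)

lemma op_adjoint_iff:
  "(y, z) \<in> op_adjoint T \<longleftrightarrow> (\<forall>x w. (x, w) \<in> T \<longrightarrow> cinner w y = cinner x z)"
  by (simp only: op_adjoint_def mem_Collect_eq case_prod_conv Ball_def split_paired_All)

lemma symmetric_op_closure:
  assumes "symmetric_op T" shows "symmetric_op (closure T)"
proof -
  \<comment> \<open>The identity is a closed condition in each argument separately, so the closure
    is taken in one argument and then in the other.\<close>
  have 1: "closure T \<subseteq> {q. cinner (snd p) (fst q) = cinner (fst p) (snd q)}" if "p \<in> T" for p
    using assms that by (intro closure_minimal closed_Collect_eq continuous_intros)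
      (cases p, auto dest: symmetric_opD)
  have "closure T \<subseteq> {p. cinner (snd p) (fst q) = cinner (fst p) (snd q)}" if "q \<in> closure T" for q
    using 1 that by (intro closure_minimal closed_Collect_eq continuous_intros) auto
  then show ?thesis unfolding symmetric_op_def by (smt (verit) fst_conv mem_Collect_eq snd_conv subsetD)
qed

lemma symmetric_op_span:
  assumes "symmetric_op T" shows "symmetric_op (cvec.span T)"
proof -
  have 1: "cvec.span T \<subseteq> {q. cinner (snd p) (fst q) = cinner (fst p) (snd q)}" if "p \<in> T" for p
    using assms that by (intro cvec.span_minimal)
      (cases p, auto simp: cvec.subspace_def cinner_linear dest: symmetric_opD)
  have "cvec.span T \<subseteq> {p. cinner (snd p) (fst q) = cinner (fst p) (snd q)}" if "q \<in> cvec.span T" for q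
    using 1 that by (intro cvec.span_minimal) (auto simp: cvec.subspace_def cinner_linear)
  then show ?thesis unfolding symmetric_op_def by (smt (verit) fst_conv mem_Collect_eq snd_conv subsetD)
qed

text \<open>If \<open>(0, z)\<close> lies in a symmetric relation, then \<open>z\<close> is
  orthogonal to the whole domain, hence zero when the domain is dense.\<close>

lemma symmetric_op_single_valued:
  assumes "symmetric_op T" "cvec.subspace T" "closure (Domain T) = UNIV"
  shows "single_valued T"
proof (rule single_valuedI)
  fix x y z assume "(x, y) \<in> T" "(x, z) \<in> T"
  then have "(0, y - z) \<in> T" using cvec.subspace_diff[OF assms(2)] by force
  then have "cinner u (y - z) = 0" if "u \<in> Domain T" for u
    using that symmetric_opD[OF assms(1)] by force
  moreover have "closure (cvec.span (Domain T)) = UNIV"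
    using assms(3) closure_mono[OF cvec.span_superset[of "Domain T"]] by auto
  ultimately have "y - z = 0" by (rule total_orthogonal_0[rotated])
  then show "y = z" by simp
qed

lemma op_adjoint_eq_imp_symmetric: "op_adjoint T = T \<Longrightarrow> symmetric_op T"
  using op_adjoint_iff[of _ _ T] unfolding symmetric_op_def by metis

lemma closure_image_fst: "fst ` closure (T :: ('a::topological_space \<times> 'b::topological_space) set) \<subseteq> closure (fst ` T)"
  by (intro image_closure_subset) (auto intro: continuous_intros intro!: closure_subset[THEN subsetD] simp: image_iff)

lemma essentially_self_adjoint_closure:
  assumes "essentially_self_adjoint T"
  shows "cvec.subspace (closure T)" "symmetric_op (closure T)" "symmetric_op T"
    "closure (Domain (closure T)) = UNIV" "single_valued (closure T)"
proof -
  show 1: "cvec.subspace (closure T)"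
    using assms by (auto simp: essentially_self_adjoint_def linear_operator_def intro: closure_csubspace_prod)
  show 2: "symmetric_op (closure T)"
    using assms by (intro op_adjoint_eq_imp_symmetric) (simp add: essentially_self_adjoint_def)
  then show "symmetric_op T"
    using closure_subset[of T] unfolding symmetric_op_def by blast
  show 3: "closure (Domain (closure T)) = UNIV"
    using assms closure_mono[OF Domain_mono[OF closure_subset[of T]]]
    by (auto simp: essentially_self_adjoint_def)
  show "single_valued (closure T)" by (rule symmetric_op_single_valued[OF 2 1 3])
qed

lemma csubspace_rel:
  fixes T :: "('a::complex_vector \<times> 'b::complex_vector) set"
  shows "cvec.subspace T \<longleftrightarrow> (0, 0) \<in> T \<and>
    (\<forall>x w y z. (x, w) \<in> T \<longrightarrow> (y, z) \<in> T \<longrightarrow> (x + y, w + z) \<in> T) \<and>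
    (\<forall>c x w. (x, w) \<in> T \<longrightarrow> (c *\<^sub>C x, c *\<^sub>C w) \<in> T)"
  unfolding cvec.subspace_def zero_prod_def by (simp add: Ball_def split_paired_All)

lemma csubspace_Domain:
  assumes "cvec.subspace T" shows "cvec.subspace (Domain T)"
proof (rule cvec.subspaceI)
  show "0 \<in> Domain T" using assms by (auto simp: csubspace_rel)
  show "x + y \<in> Domain T" if "x \<in> Domain T" "y \<in> Domain T" for x y
    using that assms by (meson DomainE DomainI csubspace_rel)
  show "c *\<^sub>C x \<in> Domain T" if "x \<in> Domain T" for x c
    using that assms by (meson DomainE DomainI csubspace_rel)
qed

lemma csubspace_op_prod:
  assumes "cvec.subspace S" "cvec.subspace T" shows "cvec.subspace (S \<cdot> T)"
  unfolding op_prod_def csubspace_rel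
proof (intro conjI allI impI)
  show "(0, 0) \<in> T O S" using assms by (auto simp: csubspace_rel)
  show "(x + y, w + z) \<in> T O S" if xw: "(x, w) \<in> T O S" "(y, z) \<in> T O S" for x y w z
    using xw assms by (meson relcompE relcompEpair relcompI csubspace_rel)
  show "(c *\<^sub>C x, c *\<^sub>C w) \<in> T O S" if "(x, w) \<in> T O S" for x w c
    using that assms by (meson relcompEpair relcompI csubspace_rel)
qed

text \<open>The vectors of \<open>X\<close> are eigenvectors of the square only: \<open>v\<close> is
  the image of \<open>u\<close> under \<open>R\<close> and need not be a multiple of
  \<open>u\<close>.\<close>

locale total_eigen =
  fixes R :: "'h::complex_hilbert operator" and X :: "'h set" and l :: "'h \<Rightarrow> real"
  assumes subspace: "cvec.subspace R"
    and closed: "closed R"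
    and symmetric: "symmetric_op R"
    and total: "closure (cvec.span X) = UNIV"
    and nonneg: "\<And>u. u \<in> X \<Longrightarrow> 0 \<le> l u"
    and eigen: "\<And>u. u \<in> X \<Longrightarrow> \<exists>v. (u, v) \<in> R \<and> (v, complex_of_real (l u) *\<^sub>C u) \<in> R"
begin

text \<open>For \<open>(x, w)\<close> in \<open>R\<close> the number \<open>cinner w x\<close> is
  real, so the cross terms in the squared norm of \<open>w + c *\<^sub>C x\<close> cancel. Hence
  \<open>f\<close> is isometric on the graph and has closed image, and this image contains the total
  set \<open>X\<close>.\<close>

lemma surj_add_scaleC:
  assumes c: "c = \<i> \<or> c = - \<i>"
  shows "\<exists>x w. (x, w) \<in> R \<and> w + c *\<^sub>C x = q"
proof -
  define f where "f p = snd p + c *\<^sub>C fst p" for p :: "'h \<times> 'h"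
  have bl: "bounded_linear f" unfolding f_def
    by (intro bounded_linear_add bounded_linear_snd bounded_linear_compose[OF _ bounded_linear_fst]
        bounded_bilinear.bounded_linear_right[OF bounded_bilinear_scaleC])
  have "norm p = norm (f p)" if "p \<in> R" for p
  proof -
    obtain x w where p: "p = (x, w)" by force
    have "cinner w x = cinner x w" using symmetric_opD[OF symmetric, of x w x w] that p by simp
    then have "Im (cinner x w) = 0" using cinner_commute[of w x] by (metis cnj.simps(2) equal_neg_zero)
    then have "(norm (w + c *\<^sub>C x))\<^sup>2 = (norm w)\<^sup>2 + (norm x)\<^sup>2"
      using c \<open>cinner w x = cinner x w\<close> by (auto simp: norm_sq_cinner cinner_linear)
    then have "sqrt ((norm w)\<^sup>2 + (norm x)\<^sup>2) = norm (w + c *\<^sub>C x)"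
      by (metis norm_ge_zero real_sqrt_abs abs_of_nonneg)
    then show ?thesis by (simp add: p f_def norm_prod_def add.commute)
  qed
  then have "closed (f ` R)"
    by (intro closed_image_subspace[OF closed csubspace_prod_imp_subspace[OF subspace] bl, of 1]) auto
  moreover have sub: "cvec.subspace (f ` R)"
  proof (rule cvec.subspaceI)
    show "0 \<in> f ` R" using cvec.subspace_0[OF subspace] by (force simp: f_def)
    show "x + y \<in> f ` R" if "x \<in> f ` R" "y \<in> f ` R" for x y
    proof -
      from that obtain p p' where "p \<in> R" "p' \<in> R" "x = f p" "y = f p'" by auto
      then show ?thesis using cvec.subspace_add[OF subspace, of p p']
        by (intro image_eqI[of _ _ "p + p'"]) (auto simp: f_def scaleC_simps)
    qed
    show "d *\<^sub>C x \<in> f ` R" if "x \<in> f ` R" for x d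
    proof -
      from that obtain p where "p \<in> R" "x = f p" by auto
      then show ?thesis using cvec.subspace_scale[OF subspace, of p d]
        by (intro image_eqI[of _ _ "d *\<^sub>C p"]) (auto simp: f_def scaleC_simps scaleC_scaleC mult.commute)
    qed
  qed
  moreover have "X \<subseteq> f ` R"
  proof
    fix u assume u: "u \<in> X"
    then obtain v where v: "(u, v) \<in> R" "(v, complex_of_real (l u) *\<^sub>C u) \<in> R" using eigen by blast
    let ?k = "complex_of_real (l u)"
    have k: "1 + ?k \<noteq> 0" using nonneg[OF u]
      by (metis add_nonneg_eq_0_iff of_real_1 of_real_add of_real_eq_0_iff zero_le_one zero_neq_one)
    \<comment> \<open>The graph point over \<open>R u - c u\<close>; because
      \<open>c * c = -1\<close>, its image under \<open>f\<close> is a multiple of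
      \<open>u\<close>.\<close>
    have "(v, ?k *\<^sub>C u) - c *\<^sub>C (u, v) \<in> R"
      using v by (intro cvec.subspace_diff[OF subspace] cvec.subspace_scale[OF subspace])
    moreover have "f ((v, ?k *\<^sub>C u) - c *\<^sub>C (u, v)) = (1 + ?k) *\<^sub>C u"
      using c by (auto simp: f_def scaleC_simps scaleC_scaleC scaleC_one)
    ultimately have "(1 + ?k) *\<^sub>C u \<in> f ` R" by (metis imageI)
    then have "(1 / (1 + ?k)) *\<^sub>C (1 + ?k) *\<^sub>C u \<in> f ` R" by (rule cvec.subspace_scale[OF sub])
    then show "u \<in> f ` R" using k by (simp add: scaleC_scaleC scaleC_one)
  qed
  ultimately have "closure (cvec.span X) \<subseteq> f ` R"
    by (intro closure_minimal cvec.span_minimal)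
  then have "q \<in> f ` R" using total by auto
  then obtain x w where "(x, w) \<in> R" "q = f (x, w)" by auto
  then show ?thesis by (auto simp: f_def)
qed

lemma dense_domain: "closure (Domain R) = UNIV"
proof -
  have "cvec.subspace (Domain R)"
    by (rule csubspace_Domain[OF subspace])
  moreover have "X \<subseteq> Domain R" using eigen by blast
  ultimately have "cvec.span X \<subseteq> Domain R" by (intro cvec.span_minimal)
  then show ?thesis using closure_mono total by blast
qed

lemma single_valued: "single_valued R"
  by (rule symmetric_op_single_valued[OF symmetric subspace dense_domain])

lemma op_adjoint_eq: "op_adjoint R = R"
proof
  show "R \<subseteq> op_adjoint R"
    using symmetric by (auto simp: op_adjoint_iff intro: symmetric_opD)
  show "op_adjoint R \<subseteq> R"
  proof
    fix p assume "p \<in> op_adjoint R"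
    then obtain y z where p: "p = (y, z)"
      and adj: "\<And>x w. (x, w) \<in> R \<Longrightarrow> cinner w y = cinner x z"
      by (cases p) (metis op_adjoint_iff)
    \<comment> \<open>Solves \<open>(R + i) x = z + i y\<close> inside \<open>R\<close>; the aim is
      \<open>x = y\<close>.\<close>
    obtain x w where xw: "(x, w) \<in> R" "w + \<i> *\<^sub>C x = z + \<i> *\<^sub>C y"
      using surj_add_scaleC by blast
    then have zw: "z - w = - (\<i> *\<^sub>C (y - x))"
      by (simp add: scaleC_simps algebra_simps)
    \<comment> \<open>The difference \<open>y - x\<close> is orthogonal to the range of
      \<open>R - i\<close>. Writing it as an element of that range makes it orthogonal to
      itself.\<close>
    obtain u v where uv: "(u, v) \<in> R" "v + (- \<i>) *\<^sub>C u = y - x"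
      using surj_add_scaleC by blast
    have "cinner v (y - x) = cinner u (z - w)"
      using adj[OF uv(1)] symmetric_opD[OF symmetric uv(1) xw(1)] by (simp add: cinner_linear)
    then have "cinner (v + (- \<i>) *\<^sub>C u) (y - x) = 0"
      by (simp add: zw cinner_linear algebra_simps)
    then have "y = x" unfolding uv(2) by (simp add: cinner_self)
    then show "p \<in> R" using xw p by simp
  qed
qed

text \<open>Factor \<open>R^2 + 1 = (R + i) (R - i)\<close> and solve the two equations in
  turn.\<close>

lemma surj_add_square: "\<exists>x w y. (x, w) \<in> R \<and> (w, y) \<in> R \<and> x + y = q"
proof -
  obtain p r where pr: "(p, r) \<in> R" "r + \<i> *\<^sub>C p = q" using surj_add_scaleC by blast
  obtain x w where xw: "(x, w) \<in> R" "w + (- \<i>) *\<^sub>C x = p" using surj_add_scaleC by blast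
  have w: "w = p + \<i> *\<^sub>C x" using xw(2) by auto
  have "(p, r) + \<i> *\<^sub>C (x, w) \<in> R"
    using pr xw by (intro cvec.subspace_add[OF subspace] cvec.subspace_scale[OF subspace])
  then have "(w, r + \<i> *\<^sub>C w) \<in> R" by (simp add: w)
  moreover have "x + (r + \<i> *\<^sub>C w) = q"
    using pr(2) by (simp add: w scaleC_simps scaleC_scaleC scaleC_one)
  ultimately show ?thesis using xw(1) by blast
qed

lemma square_eigen:
  assumes "(x, w) \<in> R" "(w, y) \<in> R" "u \<in> X"
  shows "cinner u y = complex_of_real (l u) * cinner u x"
proof -
  obtain v where v: "(u, v) \<in> R" "(v, complex_of_real (l u) *\<^sub>C u) \<in> R" using eigen assms by blast
  have "cinner u y = cinner v w" using symmetric_opD[OF symmetric v(1) assms(2)] by simp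
  also have "\<dots> = cinner (complex_of_real (l u) *\<^sub>C u) x"
    using symmetric_opD[OF symmetric v(2) assms(1)] by simp
  finally show ?thesis by (simp add: cinner_linear)
qed

text \<open>One inclusion is symmetry. For the other, \<open>R^2 + 1\<close> is surjective, while
  its diagonal extension is injective because \<open>1 + l u\<close> never vanishes; an extension of
  this kind cannot be proper.\<close>

lemma square_eq_diag_operator: "R \<cdot> R = diag_operator X l"
proof
  show "R \<cdot> R \<subseteq> diag_operator X l"
    by (auto simp: op_prod_def diag_operator_def square_eigen)
  show "diag_operator X l \<subseteq> R \<cdot> R"
  proof
    fix p assume "p \<in> diag_operator X l"
    then obtain x y where p: "p = (x, y)"
      and d: "\<And>u. u \<in> X \<Longrightarrow> cinner u y = complex_of_real (l u) * cinner u x"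
      by (auto simp: diag_operator_def)
    obtain x' w y' where xy: "(x', w) \<in> R" "(w, y') \<in> R" "x' + y' = x + y"
      using surj_add_square by blast
    have "x' = x"
    proof (rule total_orthogonal_eq[OF total])
      fix u assume u: "u \<in> X"
      have "(1 + complex_of_real (l u)) * cinner u x' = cinner u (x' + y')"
        using square_eigen[OF xy(1,2) u] by (simp add: cinner_linear algebra_simps)
      also have "\<dots> = (1 + complex_of_real (l u)) * cinner u x"
        using d[OF u] by (simp add: xy cinner_linear algebra_simps)
      finally show "cinner u x' = cinner u x"
        using nonneg[OF u]
        by (metis add_nonneg_eq_0_iff mult_cancel_left of_real_1 of_real_add of_real_eq_0_iff
            zero_le_one zero_neq_one)
    qed
    then show "p \<in> R \<cdot> R" using xy p by (auto simp: op_prod_def)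
  qed
qed

text \<open>A symmetric extension of \<open>R\<close> lies in the adjoint of \<open>R\<close>, which
  is \<open>R\<close>.\<close>

lemma maximal:
  assumes "R \<subseteq> S" "symmetric_op S" shows "S = R"
proof -
  have "S \<subseteq> op_adjoint R"
    using assms(1) by (auto simp: op_adjoint_iff intro!: symmetric_opD[OF assms(2)])
  then show ?thesis using assms op_adjoint_eq by auto
qed

text \<open>The restriction of \<open>R\<close> to the domain of its square still contains the pairs
  over \<open>u\<close> and over \<open>R u\<close>, because \<open>R u\<close> is itself in that
  domain. So the closure of the restriction meets the conditions of the locale and has no proper
  symmetric extension.\<close>

lemma core_square: "closure {(x, w). (x, w) \<in> R \<and> x \<in> Domain (R \<cdot> R)} = R"
proof -
  let ?C = "{(x, w). (x, w) \<in> R \<and> x \<in> Domain (R \<cdot> R)}"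
  have dom: "cvec.subspace (Domain (R \<cdot> R))"
    by (intro csubspace_Domain csubspace_op_prod subspace)
  then have "cvec.subspace ?C"
    using subspace unfolding csubspace_rel by (auto simp: cvec.subspace_def)
  moreover have le: "closure ?C \<subseteq> R" by (intro closure_minimal closed) auto
  moreover have "\<exists>v. (u, v) \<in> closure ?C \<and> (v, complex_of_real (l u) *\<^sub>C u) \<in> closure ?C"
    if u: "u \<in> X" for u
  proof -
    obtain v where v: "(u, v) \<in> R" "(v, complex_of_real (l u) *\<^sub>C u) \<in> R" using eigen u by blast
    moreover have "(complex_of_real (l u) *\<^sub>C u, complex_of_real (l u) *\<^sub>C v) \<in> R"
      using cvec.subspace_scale[OF subspace v(1)] by force
    ultimately have "(u, v) \<in> ?C \<and> (v, complex_of_real (l u) *\<^sub>C u) \<in> ?C"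
      by (auto simp: op_prod_def)
    then show ?thesis by (meson closure_subset subsetD)
  qed
  moreover have "symmetric_op (closure ?C)"
    using symmetric le unfolding symmetric_op_def by blast
  ultimately interpret C: total_eigen "closure ?C" X l
    using total nonneg by unfold_locales (auto intro: closure_csubspace_prod)
  show ?thesis using C.maximal[OF le symmetric] by simp
qed

lemma essentially_self_adjointI:
  assumes "closure S = R" "cvec.subspace S"
  shows "essentially_self_adjoint S"
proof -
  have "S \<subseteq> R" using assms closure_subset by blast
  then have "single_valued S" using single_valued by (rule single_valued_subset)
  moreover have "Domain R \<subseteq> closure (Domain S)"
    using closure_image_fst[of S] assms by (simp add: Domain_fst)
  then have "closure (Domain S) = UNIV"
    using dense_domain closure_minimal[OF _ closed_closure, of "Domain R" "Domain S"] by blast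
  ultimately show ?thesis
    using assms op_adjoint_eq by (simp add: essentially_self_adjoint_def linear_operator_def)
qed

end

section \<open>Two operators with the same diagonal square\<close>

locale total_eigen_pair = R: total_eigen R X l + R': total_eigen R' X l
  for R R' :: "'h::complex_hilbert operator" and X l
begin

lemma square_eq: "R \<cdot> R = R' \<cdot> R'"
  by (simp add: R.square_eq_diag_operator R'.square_eq_diag_operator)

text \<open>Both squared norms equal \<open>cinner x y\<close>, where \<open>y\<close> is the common
  value of the two squares at \<open>x\<close>.\<close>

lemma norm_eq_on_core:
  assumes "(x, w) \<in> R" "x \<in> Domain (R \<cdot> R)" "(x, w') \<in> R'"
  shows "norm w = norm w'"
proof -
  obtain y where y: "(x, y) \<in> R \<cdot> R" "(x, y) \<in> R' \<cdot> R'" using assms(2) square_eq by auto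
  have "(w, y) \<in> R"
    using y(1) assms(1) R.single_valued by (auto simp: op_prod_def dest: single_valuedD)
  moreover have "(w', y) \<in> R'"
    using y(2) assms(3) R'.single_valued by (auto simp: op_prod_def dest: single_valuedD)
  ultimately have "cinner w w = cinner w' w'"
    using symmetric_opD[OF R.symmetric assms(1)] symmetric_opD[OF R'.symmetric assms(3)] by metis
  then show ?thesis by (simp add: norm_eq_sqrt_inner inner_eq_Re_cinner)
qed

text \<open>Along a sequence in the core that converges in the graph norm of \<open>R\<close>, the
  images under \<open>R'\<close> are Cauchy too, since both operators give differences the same
  norm. In terms of graphs: \<open>G\<close> collects the triples of \<open>x\<close>,
  \<open>R x\<close> and \<open>R' x\<close>, and forgetting \<open>R' x\<close> is bounded below on
  its closure.\<close>

lemma Domain_subset: "Domain R \<subseteq> Domain R'"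
proof -
  define C where "C = {(x, w). (x, w) \<in> R \<and> x \<in> Domain (R \<cdot> R)}"
  define G where "G = {(p, w'). p \<in> C \<and> (fst p, w') \<in> R'}"
  have G: "closure G \<subseteq> {q. norm (snd (fst q)) = norm (snd q)}"
    by (intro closure_minimal closed_Collect_eq continuous_intros)
       (auto simp: G_def C_def dest: norm_eq_on_core[OF _ DomainI])
  have "closed ((\<lambda>q. (fst (fst q), snd q)) -` R')"
    by (intro closed_vimage R'.closed continuous_intros)
  then have G': "closure G \<subseteq> (\<lambda>q. (fst (fst q), snd q)) -` R'"
    by (intro closure_minimal) (auto simp: G_def)
  have C: "cvec.subspace C"
    using R.subspace csubspace_Domain[OF csubspace_op_prod[OF R.subspace R.subspace]]
    unfolding C_def csubspace_rel by (auto simp: cvec.subspace_def)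
  have "cvec.subspace G"
    using R'.subspace C[unfolded cvec.subspace_def] unfolding csubspace_rel[of G] csubspace_rel[of R']
    by (auto simp: G_def zero_prod_def)
  then have "cvec.subspace (closure G)"
    by (rule closure_csubspace_aux) (auto simp: scaleC_prod_def intro!: continuous_intros)
  then have "subspace (closure G)"
    by (auto simp: cvec.subspace_def subspace_def scaleR_scaleC scaleR_prod_scaleC scaleR_prod_def scaleC_prod_def)
  then have "closed (fst ` closure G)"
  proof (rule closed_image_subspace[OF closed_closure, where e = "1 / 2"])
    show "bounded_linear (fst :: ('h \<times> 'h) \<times> 'h \<Rightarrow> 'h \<times> 'h)" by (rule bounded_linear_fst)
    \<comment> \<open>The last component has norm at most that of the first two together, so the
      norm of the triple at most doubles; this is the origin of \<open>1 / 2\<close>.\<close>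
    fix q assume "q \<in> closure G"
    then have "norm (snd q) = norm (snd (fst q))" using G by auto
    also have "\<dots> \<le> norm (fst q)" by (metis norm_snd_le prod.collapse)
    finally show "1 / 2 * norm q \<le> norm (fst q)"
      using norm_Pair_le[of "fst q" "snd q"] by simp
  qed simp
  moreover have "C \<subseteq> fst ` closure G"
  proof
    fix p assume p: "p \<in> C"
    then have "fst p \<in> Domain (R' \<cdot> R')" using square_eq by (auto simp: C_def)
    then obtain w' where "(fst p, w') \<in> R'" by (auto simp: op_prod_def)
    then have "(p, w') \<in> G" using p by (simp add: G_def)
    then have "(p, w') \<in> closure G" by (rule closure_subset[THEN subsetD])
    then show "p \<in> fst ` closure G" by force
  qed
  ultimately have "closure C \<subseteq> fst ` closure G" by (intro closure_minimal)
  then have "R \<subseteq> fst ` closure G" unfolding C_def R.core_square .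
  then show ?thesis using G' by fastforce
qed

text \<open>If \<open>R R' x\<close> is defined, then \<open>R' x\<close> lies in the common domain,
  so \<open>x\<close> is in the domain of the common square; hence \<open>R x\<close> lies in the
  common domain and \<open>R' R x\<close> is defined. Its value is found by moving all operators
  onto the total set \<open>X\<close>, where anticommutation is assumed.\<close>

lemma anticommute_subset:
  assumes anti: "\<And>u. u \<in> X \<Longrightarrow> \<exists>v v' y. (u, v) \<in> R \<and> (v, - y) \<in> R' \<and> (u, v') \<in> R' \<and> (v', y) \<in> R"
    and Dom: "Domain R = Domain R'"
  shows "R \<cdot> R' \<subseteq> op_neg (R' \<cdot> R)"
proof
  fix p assume "p \<in> R \<cdot> R'"
  then obtain x w' y where p: "p = (x, y)" and xw: "(x, w') \<in> R'" "(w', y) \<in> R"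
    by (auto simp: op_prod_def)
  obtain t where "(w', t) \<in> R'" using xw(2) Dom by blast
  then have "(x, t) \<in> R' \<cdot> R'" using xw(1) by (auto simp: op_prod_def)
  then have "(x, t) \<in> R \<cdot> R" by (simp add: square_eq)
  then obtain w where w: "(x, w) \<in> R" "(w, t) \<in> R" by (auto simp: op_prod_def)
  obtain z where z: "(w, z) \<in> R'" using w(2) Dom by blast
  have "z = - y"
  proof (rule total_orthogonal_eq[OF R.total])
    fix u assume "u \<in> X"
    then obtain v v' y' where u: "(u, v) \<in> R" "(v, - y') \<in> R'" "(u, v') \<in> R'" "(v', y') \<in> R"
      using anti by blast
    have "cinner u z = cinner v' w" using symmetric_opD[OF R'.symmetric u(3) z] by simp
    also have "\<dots> = cinner y' x" using symmetric_opD[OF R.symmetric u(4) w(1)] by simp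
    also have "\<dots> = - cinner (- y') x" by (simp add: cinner_linear)
    also have "\<dots> = - cinner v w'" using symmetric_opD[OF R'.symmetric u(2) xw(1)] by simp
    also have "\<dots> = - cinner u y" using symmetric_opD[OF R.symmetric u(1) xw(2)] by simp
    finally show "cinner u z = cinner u (- y)" by (simp add: cinner_linear)
  qed
  then have "(x, - y) \<in> R' \<cdot> R" using w(1) z by (auto simp: op_prod_def)
  then show "p \<in> op_neg (R' \<cdot> R)" using p by (force simp: op_neg_def)
qed

end

lemma total_eigen_pair_anticommute:
  assumes "total_eigen_pair R R' X l"
    and anti: "\<And>u. u \<in> X \<Longrightarrow> \<exists>v v' y. (u, v) \<in> R \<and> (v, - y) \<in> R' \<and> (u, v') \<in> R' \<and> (v', y) \<in> R"
  shows "anticommute R R'"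
proof -
  interpret P: total_eigen_pair R R' X l by fact
  interpret Q: total_eigen_pair R' R X l
    by (intro total_eigen_pair.intro P.R.total_eigen_axioms P.R'.total_eigen_axioms)
  have Dom: "Domain R = Domain R'" using P.Domain_subset Q.Domain_subset by auto
  have 1: "R \<cdot> R' \<subseteq> op_neg (R' \<cdot> R)" by (rule P.anticommute_subset[OF anti Dom])
  have "R' \<cdot> R \<subseteq> op_neg (R \<cdot> R')"
  proof (rule Q.anticommute_subset)
    \<comment> \<open>Exchanging the two operators exchanges \<open>v\<close> and \<open>v'\<close>
      and changes the sign of \<open>y\<close>.\<close>
    fix u assume "u \<in> X"
    then show "\<exists>v v' y. (u, v) \<in> R' \<and> (v, - y) \<in> R \<and> (u, v') \<in> R \<and> (v', y) \<in> R'"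
      using anti by (metis add.inverse_inverse)
  qed (simp add: Dom)
  then have "op_neg (R' \<cdot> R) \<subseteq> R \<cdot> R'" by (fastforce simp: op_neg_def)
  then show ?thesis using 1 by (auto simp: anticommute_def)
qed

section \<open>Projection-valued measures and eigenvectors\<close>

locale pvm =
  fixes P :: "real set \<Rightarrow> 'h::complex_hilbert \<Rightarrow> 'h"
  assumes P: "projection_valued_measure P"
begin

lemma bounded: "A \<in> sets borel \<Longrightarrow> bounded_op (P A)"
  and adjoint: "A \<in> sets borel \<Longrightarrow> cinner (P A x) y = cinner x (P A y)"
  and idem: "A \<in> sets borel \<Longrightarrow> P A (P A x) = P A x"
  and univ: "P UNIV x = x"
  and sums: "range B \<subseteq> sets borel \<Longrightarrow> disjoint_family B \<Longrightarrow> (\<lambda>n. P (B n) x) sums P (\<Union>n. B n) x"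
  using P unfolding projection_valued_measure_def is_adjoint_def
  by (auto simp: fun_eq_iff)

lemmas add = bounded_op_add[OF bounded] and scaleC = bounded_op_scaleC[OF bounded]
  and zero = bounded_op_0[OF bounded]

lemma empty: "P {} x = 0"
proof -
  have "(\<lambda>n. P {} x) sums P (\<Union>n::nat. {}) x"
    by (rule sums) (auto simp: disjoint_family_on_def)
  then have "(\<lambda>n::nat. P {} x) \<longlonglongrightarrow> 0" by (intro summable_LIMSEQ_zero) (rule sums_summable)
  then show ?thesis by (simp add: LIMSEQ_const_iff)
qed

lemma Un:
  assumes "A \<in> sets borel" "B \<in> sets borel" "A \<inter> B = {}"
  shows "P (A \<union> B) x = P A x + P B x"
proof -
  have "(\<lambda>n. P (binaryset A B n) x) sums P (\<Union>n. binaryset A B n) x"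
    using assms by (intro sums) (auto simp: range_binaryset_eq disjoint_family_on_def binaryset_def)
  moreover have "(\<lambda>n. P (binaryset A B n) x) sums (P A x + P B x)"
    by (rule binaryset_sums) (rule empty)
  ultimately show ?thesis by (simp add: UN_binaryset_eq sums_unique2)
qed

text \<open>Idempotence of \<open>P (A \<union> B)\<close> only says that \<open>P A\<close> and
  \<open>P B\<close> anticommute. Multiplying this relation by \<open>P A\<close> from either side
  shows that they also commute, so the product vanishes.\<close>

lemma disjoint_zero:
  assumes A: "A \<in> sets borel" and B: "B \<in> sets borel" and AB: "A \<inter> B = {}"
  shows "P A (P B x) = 0"
proof -
  have U: "A \<union> B \<in> sets borel" using A B by auto
  have 1: "P A (P B y) + P B (P A y) = 0" for y
  proof -
    have "P (A \<union> B) (P (A \<union> B) y) = P (A \<union> B) y" by (rule idem[OF U])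
    then show ?thesis
      by (simp add: Un[OF A B AB] add[OF A] add[OF B] idem[OF A] idem[OF B])
  qed
  have "P A (P A (P B x) + P B (P A x)) = 0" by (simp add: 1 zero[OF A])
  then have 2: "P A (P B x) + P A (P B (P A x)) = 0" by (simp add: add[OF A] idem[OF A])
  have 3: "P A (P B (P A x)) + P B (P A x) = 0" using 1[of "P A x"] by (simp add: idem[OF A])
  from 2 3 have "P A (P B x) = P B (P A x)" by (metis add.commute add_left_cancel)
  with 1[of x] have "2 *\<^sub>R P A (P B x) = 0" by (simp add: scaleR_2)
  then show ?thesis by simp
qed

lemma Int:
  assumes A: "A \<in> sets borel" and B: "B \<in> sets borel"
  shows "P A (P B x) = P (A \<inter> B) x"
proof -
  have AB: "A \<inter> B \<in> sets borel" "A - B \<in> sets borel" "B - A \<in> sets borel" using A B by auto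
  have eqs: "A \<inter> B \<union> (B - A) = B" "A \<inter> B \<union> (A - B) = A" by auto
  have 1: "P B x = P (A \<inter> B) x + P (B - A) x"
    using Un[of "A \<inter> B" "B - A" x] AB unfolding eqs by blast
  have "P A (P (A \<inter> B) x) = P (A \<inter> B) (P (A \<inter> B) x) + P (A - B) (P (A \<inter> B) x)"
    using Un[of "A \<inter> B" "A - B" "P (A \<inter> B) x"] AB unfolding eqs by blast
  also have "P (A - B) (P (A \<inter> B) x) = 0" using AB by (intro disjoint_zero) auto
  also have "P (A \<inter> B) (P (A \<inter> B) x) = P (A \<inter> B) x" using AB(1) by (rule idem)
  finally have 2: "P A (P (A \<inter> B) x) = P (A \<inter> B) x" by simp
  have "P A (P (B - A) x) = 0" using A AB by (intro disjoint_zero) auto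
  then show ?thesis using 2 by (simp add: 1 add[OF A])
qed

lemma norm_sq: "A \<in> sets borel \<Longrightarrow> (norm (P A x))\<^sup>2 = Re (cinner x (P A x))"
  by (simp add: norm_sq_cinner adjoint idem)

lemma space_scalar_measure [simp]: "space (scalar_measure P x) = UNIV"
  by (simp add: scalar_measure_def)

lemma sets_scalar_measure [simp, measurable_cong]: "sets (scalar_measure P x) = sets borel"
  by (simp add: scalar_measure_def) (metis sets.sigma_sets_eq space_borel)

text \<open>\<open>measure_of\<close> has the intended values only once countable additivity is
  known; it comes from the strong convergence of sums of projections.\<close>

lemma emeasure_scalar_measure:
  assumes A: "A \<in> sets borel"
  shows "emeasure (scalar_measure P x) A = ennreal ((norm (P A x))\<^sup>2)"
proof -
  have "emeasure (scalar_measure P x) A = ennreal (Re (cinner x (P A x)))"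
  proof (rule emeasure_measure_of[OF scalar_measure_def])
    show "positive (sets (scalar_measure P x)) (\<lambda>A. ennreal (Re (cinner x (P A x))))"
      by (simp add: positive_def empty)
    show "countably_additive (sets (scalar_measure P x)) (\<lambda>A. ennreal (Re (cinner x (P A x))))"
    proof (rule countably_additiveI)
      fix B :: "nat \<Rightarrow> real set" assume B: "range B \<subseteq> sets (scalar_measure P x)" "disjoint_family B"
      have "(\<lambda>n. cinner x (P (B n) x)) sums cinner x (P (\<Union>n. B n) x)"
        using B by (intro bounded_linear.sums[OF bounded_bilinear.bounded_linear_right[OF
            bounded_bilinear_cinner]] sums) auto
      then have "(\<lambda>n. Re (cinner x (P (B n) x))) sums Re (cinner x (P (\<Union>n. B n) x))"
        by (rule bounded_linear.sums[OF bounded_linear_Re])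
      moreover have "0 \<le> Re (cinner x (P (B n) x))" for n
        using B(1) norm_sq[of "B n" x, symmetric] by auto
      ultimately show "(\<Sum>i. ennreal (Re (cinner x (P (B i) x)))) = ennreal (Re (cinner x (P (\<Union> (range B)) x)))"
        by (intro suminf_ennreal_eq)
    qed
  qed (use A in auto)
  then show ?thesis by (simp add: norm_sq[OF A])
qed

lemma finite_scalar_measure: "finite_measure (scalar_measure P x)"
  by (rule finite_measureI) (simp add: emeasure_scalar_measure)

lemma measure_scalar_measure: "A \<in> sets borel \<Longrightarrow> measure (scalar_measure P x) A = (norm (P A x))\<^sup>2"
  by (simp add: measure_def emeasure_scalar_measure)

lemma measurable_scalar_measure: "f \<in> borel_measurable borel \<Longrightarrow> f \<in> borel_measurable (scalar_measure P x)"
  using measurable_cong_sets[OF sets_scalar_measure refl] by blast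

text \<open>Multiplicativity of \<open>P\<close> in terms of measures. It turns integrals for
  \<open>P B x\<close> into integrals for \<open>x\<close> with a factor
  \<open>indicator B\<close>.\<close>

lemma scalar_measure_P:
  assumes B: "B \<in> sets borel"
  shows "scalar_measure P (P B x) = density (scalar_measure P x) (\<lambda>t. ennreal (indicator B t))"
proof (rule measure_eqI)
  fix A assume "A \<in> sets (scalar_measure P (P B x))"
  then have A: "A \<in> sets borel" by simp
  have eq: "(\<lambda>t. ennreal (indicator B t) * indicator A t) = (indicator (A \<inter> B) :: real \<Rightarrow> ennreal)"
    by (auto split: split_indicator simp: fun_eq_iff)
  have "emeasure (density (scalar_measure P x) (\<lambda>t. ennreal (indicator B t))) A =
      emeasure (scalar_measure P x) (A \<inter> B)"
    using A B by (subst emeasure_density) (auto simp only: eq sets_scalar_measure intro!: nn_integral_indicator measurable_scalar_measure, auto)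
  then show "emeasure (scalar_measure P (P B x)) A =
      emeasure (density (scalar_measure P x) (\<lambda>t. ennreal (indicator B t))) A"
    using A B by (simp add: emeasure_scalar_measure Int)
qed simp

lemma integrable_P:
  fixes f :: "real \<Rightarrow> real"
  assumes "B \<in> sets borel" "f \<in> borel_measurable borel"
  shows "integrable (scalar_measure P (P B x)) f \<longleftrightarrow>
    integrable (scalar_measure P x) (\<lambda>t. indicator B t * f t)"
  unfolding scalar_measure_P[OF assms(1)] using assms
  by (subst integrable_density) (auto intro!: measurable_scalar_measure)

lemma integral_P:
  fixes f :: "real \<Rightarrow> real"
  assumes "B \<in> sets borel" "f \<in> borel_measurable borel"
  shows "(\<integral>t. f t \<partial>scalar_measure P (P B x)) = (\<integral>t. indicator B t * f t \<partial>scalar_measure P x)"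
  unfolding scalar_measure_P[OF assms(1)] using assms
  by (subst integral_density) (auto intro!: measurable_scalar_measure)

lemma null_subset:
  assumes "\<And>x. P B x = 0" "A \<subseteq> B" "A \<in> sets borel" "B \<in> sets borel"
  shows "P A x = 0"
  using Int[OF assms(3,4), of x] assms by (simp add: Int_absorb2 zero)

lemma null_UN_finite:
  assumes "finite I" "\<And>i. i \<in> I \<Longrightarrow> N i \<in> sets borel" "\<And>i x. i \<in> I \<Longrightarrow> P (N i) x = 0"
  shows "P (\<Union>i\<in>I. N i) x = 0"
  using assms
proof (induction I arbitrary: x rule: finite_induct)
  case empty then show ?case by (simp add: pvm.empty pvm_axioms)
next
  case (insert i I)
  let ?U = "\<Union>i\<in>I. N i"
  have U: "?U \<in> sets borel" "N i \<in> sets borel" using insert by auto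
  have "P (?U - N i) x = 0"
    by (rule null_subset[of ?U]) (use insert U in auto)
  moreover have "P (N i \<union> (?U - N i)) x = P (N i) x + P (?U - N i) x"
    by (rule Un) (use U in auto)
  ultimately show ?case using insert.prems(2)[of i x] by simp
qed

lemma P_finite:
  assumes "finite Z" shows "P Z x = (\<Sum>t\<in>Z. P {t} x)"
  using assms
proof (induction Z rule: finite_induct)
  case (insert t Z)
  have "P ({t} \<union> Z) x = P {t} x + P Z x"
    by (rule Un) (use insert in \<open>auto intro: borel_closed finite_imp_closed\<close>)
  then show ?case using insert by simp
qed (simp add: empty)

text \<open>Every vector becomes a series of pieces of bounded spectral support, on which an
  operator resolved by \<open>P\<close> is defined. Density of its domain and totality of its
  eigenvectors are both obtained from this series.\<close>

lemma sums_annuli: "(\<lambda>n. P {t. real n \<le> \<bar>t\<bar> \<and> \<bar>t\<bar> < real n + 1} x) sums x"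
proof -
  have "(\<lambda>n. P {t. real n \<le> \<bar>t\<bar> \<and> \<bar>t\<bar> < real n + 1} x) sums
      P (\<Union>n. {t. real n \<le> \<bar>t\<bar> \<and> \<bar>t\<bar> < real n + 1}) x"
  proof (rule sums)
    show "range (\<lambda>n. {t::real. real n \<le> \<bar>t\<bar> \<and> \<bar>t\<bar> < real n + 1}) \<subseteq> sets borel"
      by auto
    show "disjoint_family (\<lambda>n. {t::real. real n \<le> \<bar>t\<bar> \<and> \<bar>t\<bar> < real n + 1})"
      by (auto simp: disjoint_family_on_def)
  qed
  also have "(\<Union>n. {t::real. real n \<le> \<bar>t\<bar> \<and> \<bar>t\<bar> < real n + 1}) = UNIV"
  proof -
    have "t \<in> (\<Union>n. {t. real n \<le> \<bar>t\<bar> \<and> \<bar>t\<bar> < real n + 1})" for t :: real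
      by (auto intro!: exI[of _ "nat \<lfloor>\<bar>t\<bar>\<rfloor>"])
    then show ?thesis by auto
  qed
  finally show ?thesis by (simp add: univ)
qed

end

section \<open>Unbounded symmetric operators with a spectral resolution\<close>

locale spectral_resolution = pvm P
  for P :: "real set \<Rightarrow> 'h::complex_hilbert \<Rightarrow> 'h" +
  fixes T :: "'h operator"
  assumes integral: "is_spectral_integral P (\<lambda>t. t) T"
    and symmetric: "symmetric_op T"
begin

lemma subspace: "cvec.subspace T"
  using integral by (simp add: is_spectral_integral_def linear_operator_def)

lemma Domain_iff: "x \<in> Domain T \<longleftrightarrow> integrable (scalar_measure P x) (\<lambda>t. t\<^sup>2)"
  using integral by (auto simp: is_spectral_integral_def)

lemma integrable_id: "x \<in> Domain T \<Longrightarrow> integrable (scalar_measure P x) (\<lambda>t. t)"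
  using finite_measure.square_integrable_imp_integrable[OF finite_scalar_measure, of "\<lambda>t. t" x]
  by (auto simp: Domain_iff intro!: measurable_scalar_measure)

lemma form: "(x, y) \<in> T \<Longrightarrow> Re (cinner x y) = (\<integral>t. t \<partial>scalar_measure P x)"
  using integral by (auto simp: is_spectral_integral_def)

lemma P_bounded_Domain:
  assumes A: "A \<in> sets borel" "A \<subseteq> {-L..L}"
  shows "P A x \<in> Domain T"
proof -
  interpret finite_measure "scalar_measure P x" by (rule finite_scalar_measure)
  have "indicator A t * t\<^sup>2 \<le> L\<^sup>2" for t :: real
    using A(2) by (auto simp: indicator_def abs_le_square_iff[symmetric] subset_iff abs_le_iff)
  then have "integrable (scalar_measure P x) (\<lambda>t. indicator A t * t\<^sup>2)"
    using A by (intro integrable_const_bound[where B = "L\<^sup>2"]) (auto intro!: measurable_scalar_measure)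
  then show ?thesis using A by (simp add: Domain_iff integrable_P)
qed

lemma P_bounded_form:
  assumes A: "A \<in> sets borel" "A \<subseteq> {-L..L}" and y: "(P A x, y) \<in> T"
  shows "Re (cinner (P A x) y) \<le> L * (norm (P A x))\<^sup>2"
proof -
  interpret finite_measure "scalar_measure P (P A x)" by (rule finite_scalar_measure)
  interpret x: finite_measure "scalar_measure P x" by (rule finite_scalar_measure)
  have 1: "integrable (scalar_measure P x) (\<lambda>t. indicator A t * t)"
    using integrable_id[OF DomainI[OF y]] A by (simp add: integrable_P)
  have 2: "integrable (scalar_measure P x) (\<lambda>t. indicator A t * L)"
    using A by (intro x.integrable_const_bound[where B = "\<bar>L\<bar>"])
      (auto intro!: measurable_scalar_measure simp: indicator_def)
  have "Re (cinner (P A x) y) = (\<integral>t. indicator A t * t \<partial>scalar_measure P x)"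
    using form[OF y] A by (simp add: integral_P)
  also have "\<dots> \<le> (\<integral>t. indicator A t * L \<partial>scalar_measure P x)"
    by (rule integral_mono[OF 1 2]) (use A in \<open>auto simp: indicator_def\<close>)
  also have "\<dots> = L * (norm (P A x))\<^sup>2"
    using A by (simp add: measure_scalar_measure)
  finally show ?thesis .
qed

lemma annulus: "{t::real. real n \<le> \<bar>t\<bar> \<and> \<bar>t\<bar> < real n + 1} \<in> sets borel"
  "{t::real. real n \<le> \<bar>t\<bar> \<and> \<bar>t\<bar> < real n + 1} \<subseteq> {-(real n + 1)..real n + 1}"
  by (measurable, auto)

lemma dense_domain: "closure (Domain T) = UNIV"
proof -
  have "x \<in> closure (Domain T)" for x
  proof -
    have "(\<lambda>N. \<Sum>n<N. P {t. real n \<le> \<bar>t\<bar> \<and> \<bar>t\<bar> < real n + 1} x) \<longlonglongrightarrow> x"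
      using sums_annuli[of x] by (simp add: sums_def)
    moreover have "(\<Sum>n<N. P {t. real n \<le> \<bar>t\<bar> \<and> \<bar>t\<bar> < real n + 1} x) \<in> Domain T" for N
      by (intro cvec.subspace_sum csubspace_Domain subspace P_bounded_Domain[OF annulus])
    ultimately show ?thesis unfolding closure_sequential
      by (intro exI[of _ "\<lambda>N. \<Sum>n<N. P {t. real n \<le> \<bar>t\<bar> \<and> \<bar>t\<bar> < real n + 1} x"]) blast
  qed
  then show ?thesis by auto
qed

text \<open>The form of \<open>T - t\<close> does not see the component \<open>P {t}\<close>: the integrand \<open>s - t\<close> vanishes there.
  Together with symmetry and density of the domain this makes \<open>P {t} x\<close> an eigenvector.\<close>

lemma P_singleton_eigen: "(P {t} x, complex_of_real t *\<^sub>C P {t} x) \<in> T"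
proof -
  let ?c = "complex_of_real t"
  have bt: "{t} \<in> sets borel" "- {t} \<in> sets borel" by auto
  have phi: "Re (cinner y (z - ?c *\<^sub>C y)) = (\<integral>s. s - t \<partial>scalar_measure P (P (- {t}) y))"
    if yz: "(y, z) \<in> T" for y z
  proof -
    interpret finite_measure "scalar_measure P y" by (rule finite_scalar_measure)
    have "Re (cinner y (z - ?c *\<^sub>C y)) = (\<integral>s. s \<partial>scalar_measure P y) - t * (norm y)\<^sup>2"
      using form[OF yz] by (simp add: cinner_linear norm_sq_cinner)
    also have "\<dots> = (\<integral>s. s - t \<partial>scalar_measure P y)"
      using integrable_id[OF DomainI[OF yz]]
      by (simp add: measure_scalar_measure univ)
    also have "\<dots> = (\<integral>s. indicator (- {t}) s * (s - t) \<partial>scalar_measure P y)"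
      by (intro Bochner_Integration.integral_cong) (auto simp: indicator_def)
    also have "\<dots> = (\<integral>s. s - t \<partial>scalar_measure P (P (- {t}) y))"
      by (simp add: integral_P bt)
    finally show ?thesis .
  qed
  define v where "v = P {t} x"
  have "v \<in> Domain T" unfolding v_def by (rule P_bounded_Domain[of _ "\<bar>t\<bar>"]) auto
  then obtain w where w: "(v, w) \<in> T" by auto
  define k where "k = w - ?c *\<^sub>C v"
  have Qv: "P (- {t}) v = 0" unfolding v_def by (rule disjoint_zero) auto
  have "inner y k = 0" if "y \<in> Domain T" for y
  proof -
    from that obtain z where z: "(y, z) \<in> T" by auto
    define j where "j = z - ?c *\<^sub>C y"
    have "(0, 0) \<in> T" using subspace by (simp add: csubspace_rel)
    then have 0: "Re (cinner v k) = 0"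
      using phi[OF w] phi[of 0 0] by (simp add: Qv zero[OF bt(2)] k_def)
    have vy: "(v + y, w + z) \<in> T" using subspace w z by (simp add: csubspace_rel)
    \<comment> \<open>Adding \<open>v\<close> does not change the right side of \<open>phi\<close>,
      since \<open>P (- {t}) v = 0\<close>. Expanding leaves two cross terms with sum 0, and
      symmetry makes them equal.\<close>
    have "Re (cinner (v + y) (k + j)) = Re (cinner y j)"
      using phi[OF vy] phi[OF z] by (simp add: Qv add[OF bt(2)] k_def j_def scaleC_simps algebra_simps)
    then have "Re (cinner v j) + Re (cinner y k) = 0" using 0 by (simp add: cinner_linear)
    moreover have "cinner v j = cinner k y"
      using symmetric_opD[OF symmetric w z] by (simp add: k_def j_def cinner_linear)
    then have "Re (cinner v j) = Re (cinner y k)" using cinner_commute[of k y] by simp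
    ultimately show ?thesis by (simp add: inner_eq_Re_cinner)
  qed
  then have "closure (Domain T) \<subseteq> {y. inner y k = 0}"
    by (intro closure_minimal closed_Collect_eq continuous_intros) auto
  then have "k \<in> {y. inner y k = 0}" using dense_domain by blast
  then have "w = ?c *\<^sub>C v" by (simp add: k_def)
  then show ?thesis using w by (simp add: v_def)
qed

end

text \<open>A substitute for finiteness of the trace of \<open>exp (- \<epsilon> T)\<close> that
  refers to no basis and to no functional calculus. The sums are those of the Peierls inequality,
  with \<open>y v\<close> in the role of \<open>T v\<close>.\<close>

definition heat_bounded :: "real \<Rightarrow> 'h::complex_hilbert operator \<Rightarrow> bool" where
  "heat_bounded \<epsilon> T \<longleftrightarrow> (\<exists>M. \<forall>F y. finite F \<longrightarrow> orthonormal F \<longrightarrow> (\<forall>v\<in>F. (v, y v) \<in> T) \<longrightarrow>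
     (\<Sum>v\<in>F. exp (- \<epsilon> * Re (cinner v (y v)))) \<le> M)"

text \<open>Each vector of energy at most \<open>L\<close> contributes at least
  \<open>exp (- \<epsilon> * L)\<close> to a bounded sum.\<close>

lemma heat_bounded_card:
  assumes "heat_bounded \<epsilon> T" and "\<epsilon> > 0"
  obtains N :: nat where "\<And>F y. finite F \<Longrightarrow> orthonormal F \<Longrightarrow> (\<And>v. v \<in> F \<Longrightarrow> (v, y v) \<in> T) \<Longrightarrow>
    (\<And>v. v \<in> F \<Longrightarrow> Re (cinner v (y v)) \<le> L) \<Longrightarrow> card F < N"
proof -
  obtain M where M: "\<And>F y. finite F \<Longrightarrow> orthonormal F \<Longrightarrow> (\<forall>v\<in>F. (v, y v) \<in> T) \<Longrightarrow>
     (\<Sum>v\<in>F. exp (- \<epsilon> * Re (cinner v (y v)))) \<le> M"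
    using assms unfolding heat_bounded_def by blast
  obtain N :: nat where N: "M / exp (- \<epsilon> * L) < real N" using reals_Archimedean2 by blast
  have "card F < N" if F: "finite F" "orthonormal F" "\<And>v. v \<in> F \<Longrightarrow> (v, y v) \<in> T"
    "\<And>v. v \<in> F \<Longrightarrow> Re (cinner v (y v)) \<le> L" for F y
  proof -
    have "real (card F) * exp (- \<epsilon> * L) \<le> (\<Sum>v\<in>F. exp (- \<epsilon> * Re (cinner v (y v))))"
      using F(4) \<open>\<epsilon> > 0\<close> by (intro sum_bounded_below) simp
    also have "\<dots> \<le> M" using M F by blast
    finally have "real (card F) \<le> M / exp (- \<epsilon> * L)" by (simp add: field_simps)
    then show ?thesis using N by linarith
  qed
  then show thesis by (rule that)
qed

lemma orthonormal_norm: "orthonormal F \<Longrightarrow> v \<in> F \<Longrightarrow> norm v = 1"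
  by (simp add: orthonormal_def norm_eq_sqrt_inner inner_eq_Re_cinner)

context spectral_resolution begin

text \<open>Unit vectors from the ranges of the nonzero \<open>P (A n)\<close> are orthonormal and
  have energy at most \<open>L\<close>, so their number is bounded.\<close>

lemma finite_nonzero_disjoint:
  assumes heat: "heat_bounded \<epsilon> T" "\<epsilon> > 0" and A: "disjoint_family A" "\<And>n. A n \<in> sets borel"
    "\<And>n. A n \<subseteq> {-L..L}"
  shows "finite {n::nat. \<exists>x. P (A n) x \<noteq> 0}" (is "finite ?N")
proof (rule ccontr)
  assume inf: "infinite ?N"
  obtain N :: nat where N: "\<And>F y. finite F \<Longrightarrow> orthonormal F \<Longrightarrow> (\<And>v. v \<in> F \<Longrightarrow> (v, y v) \<in> T) \<Longrightarrow>
    (\<And>v. v \<in> F \<Longrightarrow> Re (cinner v (y v)) \<le> L) \<Longrightarrow> card F < N"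
    using heat_bounded_card[OF heat] by blast
  obtain G where G: "finite G" "card G = N" "G \<subseteq> ?N" using infinite_arbitrarily_large[OF inf] by metis
  have "\<exists>v. P (A n) v = v \<and> norm v = 1" if n: "n \<in> ?N" for n
  proof -
    obtain x where x: "P (A n) x \<noteq> 0" using n by auto
    let ?v = "complex_of_real (1 / norm (P (A n) x)) *\<^sub>C P (A n) x"
    have "P (A n) ?v = ?v" by (simp add: scaleC A idem)
    moreover have "norm ?v = 1" using x by (simp add: norm_scaleC norm_divide)
    ultimately show ?thesis by blast
  qed
  then obtain v where v: "\<And>n. n \<in> ?N \<Longrightarrow> P (A n) (v n) = v n" "\<And>n. n \<in> ?N \<Longrightarrow> norm (v n) = 1"
    by metis
  have orth: "cinner (v n) (v m) = (if n = m then 1 else 0)" if nm: "n \<in> ?N" "m \<in> ?N" for n m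
  proof (cases "n = m")
    case False
    then have "A n \<inter> A m = {}" using A(1) by (auto simp: disjoint_family_on_def)
    then have "P (A n) (P (A m) (v m)) = 0" by (intro disjoint_zero A)
    then have "cinner (P (A n) (v n)) (v m) = 0" using v(1)[OF nm(2)] by (simp add: adjoint A)
    then show ?thesis using v(1)[OF nm(1)] False by simp
  qed (use v nm in \<open>simp add: cinner_self\<close>)
  \<comment> \<open>The bound counts vectors, while \<open>G\<close> is a set of indices.\<close>
  have inj: "inj_on v G"
  proof (rule inj_onI)
    fix n m assume nm: "n \<in> G" "m \<in> G" "v n = v m"
    then have N: "n \<in> ?N" "m \<in> ?N" using G(3) by auto
    have "cinner (v n) (v m) = 1" using orth[OF N(1,1)] nm(3) by simp
    then show "n = m" using orth[OF N] by (metis zero_neq_one)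
  qed
  have on: "orthonormal (v ` G)"
    unfolding orthonormal_def using G(3) inj by (auto simp: orth subset_iff inj_on_eq_iff)
  have dom: "v n \<in> Domain T" if "n \<in> ?N" for n
    using P_bounded_Domain[OF A(2,3), of n "v n"] v(1)[OF that] by simp
  then have "v ` G \<subseteq> Domain T" using G(3) by blast
  then have "\<forall>u\<in>v ` G. \<exists>y. (u, y) \<in> T" by blast
  then obtain y where y: "\<And>u. u \<in> v ` G \<Longrightarrow> (u, y u) \<in> T" by metis
  have "Re (cinner u (y u)) \<le> L" if u: "u \<in> v ` G" for u
  proof -
    obtain n where n: "n \<in> G" "u = v n" using u by auto
    then have n': "n \<in> ?N" using G(3) by auto
    show ?thesis
      using P_bounded_form[OF A(2,3), of n "v n" "y u"] v(1,2)[OF n'] y[OF u] n by simp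
  qed
  then have "card (v ` G) < N" using y on G(1) by (intro N[of _ y]) auto
  then show False using inj G by (simp add: card_image)
qed

text \<open>Cut a punctured ball into the countably many shells \<open>A n\<close>. Only finitely
  many of them carry spectral measure, and those beyond the last one fill a smaller punctured ball,
  which carries none.\<close>

lemma punctured_null:
  assumes heat: "heat_bounded \<epsilon> T" "\<epsilon> > 0"
  shows "\<exists>d>0. \<forall>x. P (ball t d - {t}) x = 0"
proof -
  define U where "U n = ball t (1 / (real n + 1)) - {t}" for n
  define A where "A n = U n - U (Suc n)" for n
  have U_mono: "U m \<subseteq> U n" if "n \<le> m" for n m
  proof -
    have "1 / (real m + 1) \<le> 1 / (real n + 1)" using that by (intro divide_left_mono) auto
    then show ?thesis by (auto simp: U_def)
  qed
  have U_borel: "U n \<in> sets borel" for n by (simp add: U_def)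
  have A_borel: "A n \<in> sets borel" for n using U_borel by (simp add: A_def sets.Diff)
  have dis: "disjoint_family A"
    unfolding disjoint_family_on_def
  proof (intro ballI impI)
    fix i j :: nat assume "i \<noteq> j"
    then consider "Suc i \<le> j" | "Suc j \<le> i" by linarith
    then show "A i \<inter> A j = {}"
    proof cases
      case 1 then show ?thesis using U_mono[of "Suc i" j] by (auto simp: A_def)
    next
      case 2 then show ?thesis using U_mono[of "Suc j" i] by (auto simp: A_def)
    qed
  qed
  have "U n \<subseteq> {- (\<bar>t\<bar> + 1)..\<bar>t\<bar> + 1}" for n
  proof -
    have "U n \<subseteq> U 0" by (rule U_mono) simp
    also have "\<dots> \<subseteq> {- (\<bar>t\<bar> + 1)..\<bar>t\<bar> + 1}" by (auto simp: U_def dist_real_def abs_if split: if_splits)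
    finally show ?thesis .
  qed
  then have bd: "A n \<subseteq> {- (\<bar>t\<bar> + 1)..\<bar>t\<bar> + 1}" for n by (auto simp: A_def)
  have "finite {n. \<exists>x. P (A n) x \<noteq> 0}"
    by (rule finite_nonzero_disjoint[OF heat dis A_borel bd])
  then obtain m where m: "\<And>n. (\<exists>x. P (A n) x \<noteq> 0) \<Longrightarrow> n < m"
    by (auto simp: finite_nat_set_iff_bounded)
  have cover: "(\<Union>k. A (k + m)) = U m"
  proof
    have "A (k + m) \<subseteq> U m" for k using U_mono[of m "k + m"] by (auto simp: A_def)
    then show "(\<Union>k. A (k + m)) \<subseteq> U m" by blast
    show "U m \<subseteq> (\<Union>k. A (k + m))"
    proof
      fix s assume s: "s \<in> U m"
      then have "dist t s > 0" by (simp add: U_def)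
      then obtain n where n: "1 / (real n + 1) < dist t s"
        using reals_Archimedean[of "dist t s"] by (auto simp: inverse_eq_divide add.commute)
      then have ex: "s \<notin> U n" by (simp add: U_def)
      \<comment> \<open>The index of the first punctured ball that misses \<open>s\<close>. It
        exceeds \<open>m\<close>, and since the \<open>U n\<close> decrease, \<open>s\<close> lies
        in the shell just before it.\<close>
      define j where "j = (LEAST n. s \<notin> U n)"
      have j: "s \<notin> U j" unfolding j_def using ex by (rule LeastI)
      then have "m < j" using U_mono[of j m] s by (meson not_le subsetD)
      then obtain i where i: "j = Suc i" "m \<le> i" by (cases j) auto
      have "s \<in> U i" using not_less_Least[of i "\<lambda>n. s \<notin> U n"] i j_def by auto
      then have "s \<in> A ((i - m) + m)" using i j by (simp add: A_def)
      then show "s \<in> (\<Union>k. A (k + m))" by blast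
    qed
  qed
  have "P (U m) x = 0" for x
  proof -
    have "(\<lambda>k. P (A (k + m)) x) sums P (\<Union>k. A (k + m)) x"
      using A_borel dis by (intro sums) (auto simp: disjoint_family_on_def)
    moreover have "P (A (k + m)) x = 0" for k using m[of "k + m"] by auto
    ultimately have "(\<lambda>k::nat. 0) sums P (U m) x" by (simp add: cover)
    then show ?thesis using sums_zero sums_unique2 by blast
  qed
  then show ?thesis unfolding U_def by (intro exI[of _ "1 / (real m + 1)"]) auto
qed

text \<open>Cover \<open>K\<close> by balls whose punctured versions are null: finitely many
  suffice, and only their centres remain.\<close>

lemma compact_finite_support:
  assumes heat: "heat_bounded \<epsilon> T" "\<epsilon> > 0" and K: "compact K"
  obtains Z where "finite Z" "Z \<subseteq> K" "\<And>x. P (K - Z) x = 0"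
proof -
  obtain d where d: "\<And>t. d t > 0" "\<And>t x. P (ball t (d t) - {t}) x = 0"
    using punctured_null[OF heat] by metis
  have "K \<subseteq> (\<Union>t\<in>K. ball t (d t))" using d(1) by force
  then obtain Z where Z: "Z \<subseteq> K" "finite Z" "K \<subseteq> (\<Union>t\<in>Z. ball t (d t))"
    using compactE_image[OF K, of K "\<lambda>t. ball t (d t)"] by (metis open_ball)
  have bor: "K \<in> sets borel" "Z \<in> sets borel"
    using K Z(2) by (auto intro: borel_closed compact_imp_closed finite_imp_closed)
  have "P (K - Z) x = 0" for x
  proof (rule null_subset)
    show "P (\<Union>t\<in>Z. ball t (d t) - {t}) x = 0" for x
      using d(2) Z(2) by (intro null_UN_finite) auto
    show "K - Z \<subseteq> (\<Union>t\<in>Z. ball t (d t) - {t})" using Z(3) by auto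
    show "K - Z \<in> sets borel" using bor by auto
    show "(\<Union>t\<in>Z. ball t (d t) - {t}) \<in> sets borel" using Z(2) by (intro sets.finite_UN) auto
  qed
  then show thesis using Z that by blast
qed

text \<open>On a bounded Borel set the projection is a finite sum of projections
  \<open>P {t}\<close>, whose values are eigenvectors; the annuli then approximate every
  vector.\<close>

lemma total_eigenvectors:
  assumes heat: "heat_bounded \<epsilon> T" "\<epsilon> > 0"
  shows "closure (cvec.span {v. \<exists>t. (v, complex_of_real t *\<^sub>C v) \<in> T}) = UNIV"
proof -
  let ?S = "cvec.span {v. \<exists>t. (v, complex_of_real t *\<^sub>C v) \<in> T}"
  have "P A x \<in> ?S" if A: "A \<in> sets borel" "A \<subseteq> {-L..L}" for A L x
  proof -
    obtain Z where Z: "finite Z" "Z \<subseteq> {-L..L}" "\<And>x. P ({-L..L} - Z) x = 0"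
      using compact_finite_support[OF heat compact_Icc] by blast
    have Zb: "Z \<in> sets borel" "A \<inter> Z \<in> sets borel"
      using Z(1) by (auto intro: borel_closed finite_imp_closed)
    have "P (A - Z) x = 0"
      by (rule null_subset[OF Z(3)]) (use A Zb in auto)
    moreover have "A \<inter> Z \<union> (A - Z) = A" by auto
    then have "P A x = P (A \<inter> Z) x + P (A - Z) x"
      using Un[of "A \<inter> Z" "A - Z" x] A Zb by (metis Int_Diff_disjoint sets.Diff)
    ultimately have "P A x = (\<Sum>t\<in>A \<inter> Z. P {t} x)" using P_finite[of "A \<inter> Z" x] Z(1) by auto
    moreover have "P {t} x \<in> ?S" for t
      using P_singleton_eigen by (intro cvec.span_base) auto
    ultimately show ?thesis by (simp add: cvec.span_sum)
  qed
  note PS = this[OF annulus]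
  have "x \<in> closure ?S" for x
  proof -
    have "(\<lambda>N. \<Sum>n<N. P {t. real n \<le> \<bar>t\<bar> \<and> \<bar>t\<bar> < real n + 1} x) \<longlonglongrightarrow> x"
      using sums_annuli[of x] by (simp add: sums_def)
    moreover have "(\<Sum>n<N. P {t. real n \<le> \<bar>t\<bar> \<and> \<bar>t\<bar> < real n + 1} x) \<in> ?S" for N
      by (intro cvec.span_sum PS)
    ultimately show ?thesis unfolding closure_sequential
      by (intro exI[of _ "\<lambda>N. \<Sum>n<N. P {t. real n \<le> \<bar>t\<bar> \<and> \<bar>t\<bar> < real n + 1} x"]) blast
  qed
  then show ?thesis by auto
qed

end

section \<open>Orthonormal eigenbases\<close>

lemma real_form_symmetric:
  assumes S: "clinear S" and real: "\<And>x. cinner x (S x) \<in> \<real>"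
  shows "cinner (S x) y = cinner x (S y)"
proof -
  have im: "Im (cinner x (S x)) = 0" for x using real[of x] by (simp add: complex_is_Real_iff)
  \<comment> \<open>Polarization: \<open>x + y\<close> controls the imaginary parts, and
    \<open>\<i> *\<^sub>C x\<close> in place of \<open>x\<close> controls the real parts.\<close>
  have 1: "Im (cinner x (S y)) + Im (cinner y (S x)) = 0" for x y
    using im[of "x + y"] im[of x] im[of y] by (simp add: clinear_add[OF S] cinner_linear)
  have "Im (cinner (\<i> *\<^sub>C x) (S y)) + Im (cinner y (S (\<i> *\<^sub>C x))) = 0" by (rule 1)
  then have "- Re (cinner x (S y)) + Re (cinner y (S x)) = 0"
    by (simp add: clinear_scaleC[OF S] cinner_linear)
  then have "cinner x (S y) = cnj (cinner y (S x))" using 1[of x y] by (simp add: complex_eq_iff)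
  then show ?thesis using cinner_commute by metis
qed

text \<open>Positivity is tested at \<open>x - R x / K\<close>, and the cubic term is absorbed by
  the norm bound. The outcome, \<open>R^2 \<le> K R\<close>, converts summability of the form of an
  absolute value into summability of squared norms.\<close>

lemma positive_op_norm_sq_le:
  assumes R: "positive_op R" and K: "\<And>x. norm (R x) \<le> K * norm x" and "K > 0"
  shows "(norm (R x))\<^sup>2 \<le> K * Re (cinner x (R x))"
proof -
  have lin: "clinear R" using R by (simp add: positive_op_def bounded_op_def)
  have sym: "cinner (R a) b = cinner a (R b)" for a b
    using R by (intro real_form_symmetric[OF lin]) (simp add: positive_op_def)
  define t where "t = complex_of_real (1 / K)"
  let ?z = "x - t *\<^sub>C R x"
  have "Re (cinner (R x) (R (R x))) \<le> cmod (cinner (R x) (R (R x)))" by (rule complex_Re_le_cmod)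
  also have "\<dots> \<le> norm (R x) * norm (R (R x))" by (rule cmod_cinner_le)
  also have "\<dots> \<le> norm (R x) * (K * norm (R x))" by (intro mult_left_mono K) simp
  finally have rr: "Re (cinner (R x) (R (R x))) \<le> K * (norm (R x))\<^sup>2"
    by (simp add: power2_eq_square mult_ac)
  have "cinner ?z (R ?z) = cinner x (R x) - 2 * t * cinner (R x) (R x) + t\<^sup>2 * cinner (R x) (R (R x))"
    by (simp add: clinear_diff[OF lin] clinear_scaleC[OF lin] cinner_linear sym[symmetric] t_def
        algebra_simps power2_eq_square)
  then have "Re (cinner ?z (R ?z)) = Re (cinner x (R x)) - 2 / K * (norm (R x))\<^sup>2
      + (1 / K)\<^sup>2 * Re (cinner (R x) (R (R x)))"
    by (simp add: t_def cinner_self power_divide flip: of_real_power)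
  then have "0 \<le> Re (cinner x (R x)) - 2 / K * (norm (R x))\<^sup>2 + (1 / K)\<^sup>2 * Re (cinner (R x) (R (R x)))"
    using R unfolding positive_op_def by metis
  also have "\<dots> \<le> Re (cinner x (R x)) - 2 / K * (norm (R x))\<^sup>2 + (1 / K)\<^sup>2 * (K * (norm (R x))\<^sup>2)"
    using rr by (intro add_left_mono mult_left_mono) auto
  also have "\<dots> = Re (cinner x (R x)) - (norm (R x))\<^sup>2 / K"
    using \<open>K > 0\<close> by (simp add: field_simps power2_eq_square)
  finally show ?thesis using \<open>K > 0\<close> by (simp add: field_simps)
qed

lemma has_sum_finite_sum:
  assumes "finite F" "\<And>v. v \<in> F \<Longrightarrow> (f v has_sum s v) B"
  shows "((\<lambda>e. \<Sum>v\<in>F. f v e) has_sum (\<Sum>v\<in>F. s v :: real)) B"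
  using assms by (induction F rule: finite_induct) (auto intro: has_sum_add)

text \<open>Trace class is witnessed by a single basis \<open>B\<close>. The squared norms of
  \<open>E e\<close> over \<open>B\<close> are summable by the previous estimate; expanding
  \<open>E v\<close> along \<open>B\<close> and applying Bessel's inequality to each
  \<open>E e\<close> carries the bound over to every finite orthonormal \<open>F\<close>.\<close>

lemma trace_class_hilbert_schmidt:
  assumes E: "trace_class E" and sym: "\<And>x y. cinner (E x) y = cinner x (E y)"
  obtains M where "\<And>F. finite F \<Longrightarrow> orthonormal F \<Longrightarrow> (\<Sum>v\<in>F. (norm (E v))\<^sup>2) \<le> M"
proof -
  obtain R S' B where RB: "positive_op R" "is_adjoint E S'" "R \<circ> R = S' \<circ> E" "orthonormal_basis B"
    "(\<lambda>e. Re (cinner e (R e))) summable_on B"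
    using E by (auto simp: trace_class_def is_abs_op_def)
  have "bounded_op R" using RB(1) by (simp add: positive_op_def)
  then obtain K where K: "K > 0" "\<And>x. norm (R x) \<le> K * norm x" by (rule bounded_op_bound) blast
  have Rsym: "cinner (R a) b = cinner a (R b)" for a b
    using RB(1) by (intro real_form_symmetric) (auto simp: positive_op_def bounded_op_def)
  have ER: "(norm (E x))\<^sup>2 = (norm (R x))\<^sup>2" for x
  proof -
    have "cinner (E x) (E x) = cinner x ((S' \<circ> E) x)" using RB(2) by (simp add: is_adjoint_def)
    also have "\<dots> = cinner (R x) (R x)" unfolding RB(3)[symmetric] by (simp add: Rsym)
    finally show ?thesis by (simp add: norm_sq_cinner)
  qed
  have sumE: "(\<lambda>e. (norm (E e))\<^sup>2) summable_on B"
  proof (rule summable_on_comparison_test[OF summable_on_cmult_right[OF RB(5), of K]])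
    show "(norm (E e))\<^sup>2 \<le> K * Re (cinner e (R e))" for e
      unfolding ER by (rule positive_op_norm_sq_le[OF RB(1) K(2,1)])
  qed simp
  show thesis
  proof (rule that)
    fix F :: "'a set" assume F: "finite F" "orthonormal F"
    have "((\<lambda>e. \<Sum>v\<in>F. (cmod (cinner e (E v)))\<^sup>2) has_sum (\<Sum>v\<in>F. (norm (E v))\<^sup>2)) B"
      using parseval_norm[OF RB(4)] F(1) by (intro has_sum_finite_sum)
    moreover have "((\<lambda>e. (norm (E e))\<^sup>2) has_sum infsum (\<lambda>e. (norm (E e))\<^sup>2) B) B"
      using sumE by (rule has_sum_infsum)
    moreover have "(\<Sum>v\<in>F. (cmod (cinner e (E v)))\<^sup>2) \<le> (norm (E e))\<^sup>2" for e
    proof -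
      have "cmod (cinner e (E v)) = cmod (cinner v (E e))" for v
        using sym cinner_commute by (metis complex_mod_cnj)
      then show ?thesis using bessel_inequality[OF F(2,1), of "E e"] by simp
    qed
    ultimately show "(\<Sum>v\<in>F. (norm (E v))\<^sup>2) \<le> infsum (\<lambda>e. (norm (E e))\<^sup>2) B"
      by (rule has_sum_mono)
  qed
qed

text \<open>Jensen's inequality, in the form of the tangent line of \<open>exp\<close>, bounds the Hilbert-Schmidt norm
  of \<open>exp (-\<epsilon> T)\<close> from below.\<close>

lemma heat_boundedI:
  assumes fn: "is_function_of T (\<lambda>t. exp (- \<epsilon> * t)) (graph E)" and E: "trace_class E"
  shows "heat_bounded (2 * \<epsilon>) T"
proof -
  obtain P where res: "projection_valued_measure P" "is_spectral_integral P (\<lambda>t. t) T"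
    "is_spectral_integral P (\<lambda>t. exp (- \<epsilon> * t)) (graph E)"
    using fn by (auto simp: is_function_of_def)
  interpret pvm P by unfold_locales (rule res(1))
  have DE: "Domain (graph E) = UNIV" by (auto simp: graph_def)
  have "x \<in> Domain (graph E)" for x by (simp add: DE)
  then have sqE: "integrable (scalar_measure P x) (\<lambda>t. (exp (- \<epsilon> * t))\<^sup>2)" for x
    using res(3) unfolding is_spectral_integral_def by blast
  have intE: "integrable (scalar_measure P x) (\<lambda>t. exp (- \<epsilon> * t))" for x
    by (rule finite_measure.square_integrable_imp_integrable[OF finite_scalar_measure _ sqE])
       (rule measurable_scalar_measure, measurable)
  have formE: "cinner x (E x) = complex_of_real (\<integral>t. exp (- \<epsilon> * t) \<partial>scalar_measure P x)" for x
    using res(3) by (auto simp: is_spectral_integral_def graph_def)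
  have sym: "cinner (E x) y = cinner x (E y)" for x y
    using E by (intro real_form_symmetric) (auto simp: formE trace_class_def bounded_op_def)
  obtain M where M: "\<And>F. finite F \<Longrightarrow> orthonormal F \<Longrightarrow> (\<Sum>v\<in>F. (norm (E v))\<^sup>2) \<le> M"
    using trace_class_hilbert_schmidt[OF E sym] by blast
  have jensen: "exp (- \<epsilon> * Re (cinner v y)) \<le> norm (E v)" if v: "norm v = 1" "(v, y) \<in> T" for v y
  proof -
    interpret finite_measure "scalar_measure P v" by (rule finite_scalar_measure)
    define m where "m = Re (cinner v y)"
    have m: "m = (\<integral>t. t \<partial>scalar_measure P v)"
      using res(2) v(2) by (auto simp: m_def is_spectral_integral_def)
    have "v \<in> Domain T" using v(2) by auto
    then have sq: "integrable (scalar_measure P v) (\<lambda>t. t\<^sup>2)"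
      using res(2) unfolding is_spectral_integral_def by blast
    have int: "integrable (scalar_measure P v) (\<lambda>t. t)"
      by (rule square_integrable_imp_integrable[OF _ sq]) (rule measurable_scalar_measure, simp)
    have one: "measure (scalar_measure P v) UNIV = 1"
      by (simp add: measure_scalar_measure univ v)
    \<comment> \<open>\<open>m\<close> is the mean of a probability measure, so the tangent line of
      \<open>exp (- \<epsilon> * t)\<close> at \<open>m\<close> integrates to its value at
      \<open>m\<close>.\<close>
    have "exp (- \<epsilon> * m) = (\<integral>t. exp (- \<epsilon> * m) * (1 - \<epsilon> * (t - m)) \<partial>scalar_measure P v)"
      using int by (simp add: one m[symmetric] algebra_simps)
    also have "\<dots> \<le> (\<integral>t. exp (- \<epsilon> * t) \<partial>scalar_measure P v)"
    proof (rule integral_mono[OF _ intE])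
      show "integrable (scalar_measure P v) (\<lambda>t. exp (- \<epsilon> * m) * (1 - \<epsilon> * (t - m)))"
        using int by (auto simp: algebra_simps)
      fix t :: real
      have "1 - \<epsilon> * (t - m) \<le> exp (- \<epsilon> * (t - m))" using exp_ge_add_one_self[of "- \<epsilon> * (t - m)"] by simp
      then have "exp (- \<epsilon> * m) * (1 - \<epsilon> * (t - m)) \<le> exp (- \<epsilon> * m) * exp (- \<epsilon> * (t - m))"
        by (intro mult_left_mono) auto
      then show "exp (- \<epsilon> * m) * (1 - \<epsilon> * (t - m)) \<le> exp (- \<epsilon> * t)"
        by (simp add: exp_add[symmetric] algebra_simps)
    qed
    also have "\<dots> = Re (cinner v (E v))" by (simp add: formE)
    also have "\<dots> \<le> norm v * norm (E v)"
      using complex_Re_le_cmod cmod_cinner_le order_trans by blast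
    finally show ?thesis using v by (simp add: m_def)
  qed
  have "(\<Sum>v\<in>F. exp (- (2 * \<epsilon>) * Re (cinner v (y v)))) \<le> M"
    if F: "finite F" "orthonormal F" "\<forall>v\<in>F. (v, y v) \<in> T" for F y
  proof -
    have "(\<Sum>v\<in>F. exp (- (2 * \<epsilon>) * Re (cinner v (y v)))) \<le> (\<Sum>v\<in>F. (norm (E v))\<^sup>2)"
    proof (rule sum_mono)
      fix v assume v: "v \<in> F"
      \<comment> \<open>Squaring, required by the Hilbert-Schmidt bound, is what doubles the
        parameter.\<close>
      have "(exp (- \<epsilon> * Re (cinner v (y v))))\<^sup>2 \<le> (norm (E v))\<^sup>2"
        using jensen[of v "y v"] F v by (intro power_mono) (auto simp: orthonormal_norm)
      then show "exp (- (2 * \<epsilon>) * Re (cinner v (y v))) \<le> (norm (E v))\<^sup>2"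
        by (simp add: power2_eq_square exp_add[symmetric] mult.assoc)
    qed
    then show ?thesis using M F by force
  qed
  then show ?thesis unfolding heat_bounded_def by blast
qed

text \<open>The heat bound limits the size of orthonormal systems inside one eigenspace, so one of
  maximal size exists, and it spans the eigenspace. The union over all eigenvalues is orthonormal by
  symmetry, and the heat bound on its finite subsets gives summability.\<close>

lemma orthonormal_eigenbasis:
  fixes T :: "'h::complex_hilbert operator"
  assumes sub: "cvec.subspace T" and sym: "symmetric_op T"
    and heat: "\<And>\<epsilon>. \<epsilon> > 0 \<Longrightarrow> heat_bounded \<epsilon> T"
    and total: "closure (cvec.span {v. \<exists>t. (v, complex_of_real t *\<^sub>C v) \<in> T}) = UNIV"
  obtains B l where "orthonormal_basis B" "\<And>b. b \<in> B \<Longrightarrow> (b, complex_of_real (l b) *\<^sub>C b) \<in> T"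
    "\<And>\<epsilon>. \<epsilon> > 0 \<Longrightarrow> (\<lambda>b. exp (- \<epsilon> * l b)) summable_on B"
proof -
  define Eig where "Eig t = {v. (v, complex_of_real t *\<^sub>C v) \<in> T}" for t
  have Eig_sub: "cvec.subspace (Eig t)" for t
    using sub by (auto simp: Eig_def csubspace_rel cvec.subspace_def scaleC_simps scaleC_scaleC)
       (metis mult.commute scaleC_scaleC)
  have orth: "cinner u v = 0" if "u \<in> Eig s" "v \<in> Eig t" "s \<noteq> t" for u v s t
  proof -
    have "cinner (complex_of_real s *\<^sub>C u) v = cinner u (complex_of_real t *\<^sub>C v)"
      using that by (intro symmetric_opD[OF sym]) (auto simp: Eig_def)
    then show ?thesis using that(3) by (simp add: cinner_linear)
  qed
  have "\<exists>F. F \<subseteq> Eig t \<and> finite F \<and> orthonormal F \<and>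
      (\<forall>G. G \<subseteq> Eig t \<longrightarrow> finite G \<longrightarrow> orthonormal G \<longrightarrow> card G \<le> card F)" for t
  proof -
    obtain N :: nat where N: "\<And>F y. finite F \<Longrightarrow> orthonormal F \<Longrightarrow> (\<And>v. v \<in> F \<Longrightarrow> (v, y v) \<in> T) \<Longrightarrow>
        (\<And>v. v \<in> F \<Longrightarrow> Re (cinner v (y v)) \<le> t) \<Longrightarrow> card F < N"
      using heat_bounded_card[OF heat[OF zero_less_one] zero_less_one] by blast
    have "card F < N" if "F \<subseteq> Eig t" "finite F" "orthonormal F" for F
      using that by (intro N[of F "\<lambda>v. complex_of_real t *\<^sub>C v"])
        (auto simp: Eig_def cinner_linear orthonormal_def)
    then have "\<forall>F. F \<subseteq> Eig t \<and> finite F \<and> orthonormal F \<longrightarrow> card F < N" by blast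
    moreover have "orthonormal {}" by (simp add: orthonormal_def)
    ultimately have "\<exists>F. (F \<subseteq> Eig t \<and> finite F \<and> orthonormal F) \<and>
        (\<forall>G. G \<subseteq> Eig t \<and> finite G \<and> orthonormal G \<longrightarrow> card G \<le> card F)"
      by (intro ex_has_greatest_nat[of _ "{}"]) auto
    then show ?thesis by blast
  qed
  then obtain C where C: "\<And>t. C t \<subseteq> Eig t" "\<And>t. finite (C t)" "\<And>t. orthonormal (C t)"
    "\<And>t G. G \<subseteq> Eig t \<Longrightarrow> finite G \<Longrightarrow> orthonormal G \<Longrightarrow> card G \<le> card (C t)" by metis
  define B where "B = (\<Union>t. C t)"
  have on: "orthonormal B"
    unfolding orthonormal_def
  proof (intro ballI)
    fix e f assume "e \<in> B" "f \<in> B"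
    then obtain s t where st: "e \<in> C s" "f \<in> C t" by (auto simp: B_def)
    show "cinner e f = (if e = f then 1 else 0)"
    proof (cases "s = t")
      case True then show ?thesis using C(3) st by (auto simp: orthonormal_def)
    next
      case False
      then have "cinner e f = 0" using orth C(1) st by blast
      moreover have "e \<noteq> f"
      proof
        assume "e = f"
        then have "cinner e f = 1" using C(3) st by (auto simp: orthonormal_def)
        then show False using \<open>cinner e f = 0\<close> by simp
      qed
      ultimately show ?thesis by simp
    qed
  qed
  have span: "v \<in> cvec.span B" if v: "v \<in> Eig t" for v t
  proof -
    define p where "p = (\<Sum>e\<in>C t. cinner e v *\<^sub>C e)"
    define r where "r = v - p"
    have "p \<in> Eig t"
      unfolding p_def using C(1)[of t]
      by (intro cvec.subspace_sum cvec.subspace_scale Eig_sub) auto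
    moreover have "p \<in> cvec.span B"
      unfolding p_def by (intro cvec.span_sum cvec.span_scale cvec.span_base) (auto simp: B_def)
    ultimately have p: "p \<in> Eig t" "p \<in> cvec.span B" by auto
    have "r = 0"
    proof (rule ccontr)
      assume "r \<noteq> 0"
      \<comment> \<open>The normalized part of \<open>v\<close> orthogonal to \<open>C t\<close>;
        adjoining it to \<open>C t\<close> would contradict maximality.\<close>
      define r' where "r' = complex_of_real (1 / norm r) *\<^sub>C r"
      have "r \<in> Eig t" unfolding r_def using v p Eig_sub by (intro cvec.subspace_diff)
      then have r'E: "r' \<in> Eig t" unfolding r'_def using Eig_sub by (intro cvec.subspace_scale)
      have "cinner e r = 0" if "e \<in> C t" for e
        using orthonormal_cinner_sum[OF C(3,2) that] by (simp add: r_def p_def cinner_linear)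
      then have er: "cinner e r' = 0" "cinner r' e = 0" if "e \<in> C t" for e
        using that cinner_commute[of r' e] by (simp_all add: r'_def cinner_linear)
      have "norm r' = 1" using \<open>r \<noteq> 0\<close> by (simp add: r'_def norm_scaleC norm_divide)
      then have rr: "cinner r' r' = 1" by (simp add: cinner_self)
      then have nin: "r' \<notin> C t" using er by force
      have "orthonormal (insert r' (C t))"
        using C(3)[of t] er rr nin unfolding orthonormal_def by auto
      then have "card (insert r' (C t)) \<le> card (C t)"
        using C r'E by (intro C(4)) auto
      then show False using nin C(2) by simp
    qed
    then show ?thesis using p by (simp add: r_def)
  qed
  have "{v. \<exists>t. (v, complex_of_real t *\<^sub>C v) \<in> T} \<subseteq> cvec.span B"
    using span by (auto simp: Eig_def)
  then have "cvec.span {v. \<exists>t. (v, complex_of_real t *\<^sub>C v) \<in> T} \<subseteq> cvec.span B"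
    by (intro cvec.span_minimal cvec.subspace_span)
  then have "closure (cvec.span B) = UNIV" using total closure_mono by blast
  then have onb: "orthonormal_basis B" using on by (simp add: orthonormal_basis_def orthonormal_def)
  have "\<forall>b\<in>B. \<exists>t. b \<in> Eig t" using C(1) by (auto simp: B_def)
  then obtain l where l: "\<And>b. b \<in> B \<Longrightarrow> b \<in> Eig (l b)" by metis
  have lT: "(b, complex_of_real (l b) *\<^sub>C b) \<in> T" if "b \<in> B" for b using l[OF that] by (simp add: Eig_def)
  have "(\<lambda>b. exp (- \<epsilon> * l b)) summable_on B" if e: "\<epsilon> > 0" for \<epsilon>
  proof (rule nonneg_bdd_above_summable_on)
    obtain M where M: "\<And>F y. finite F \<Longrightarrow> orthonormal F \<Longrightarrow> (\<forall>v\<in>F. (v, y v) \<in> T) \<Longrightarrow>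
       (\<Sum>v\<in>F. exp (- \<epsilon> * Re (cinner v (y v)))) \<le> M"
      using heat[OF e] unfolding heat_bounded_def by blast
    have "(\<Sum>b\<in>F. exp (- \<epsilon> * l b)) \<le> M" if F: "F \<subseteq> B" "finite F" for F
    proof -
      have F': "orthonormal F" using orthonormal_subset[OF on F(1)] .
      have "(\<Sum>b\<in>F. exp (- \<epsilon> * l b)) =
          (\<Sum>b\<in>F. exp (- \<epsilon> * Re (cinner b (complex_of_real (l b) *\<^sub>C b))))"
        using F' by (intro sum.cong) (auto simp: cinner_linear orthonormal_def)
      also have "\<dots> \<le> M"
        using F F' lT by (intro M) auto
      finally show ?thesis .
    qed
    then show "bdd_above (sum (\<lambda>b. exp (- \<epsilon> * l b)) ` {F. F \<subseteq> B \<and> finite F})"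
      by (intro bdd_aboveI2[where M = M]) auto
  qed simp
  then show thesis using that onb lT by blast
qed

lemma (in N11_spectral_data) eigenbasis:
  obtains B l where "orthonormal_basis B"
    "\<And>b. b \<in> B \<Longrightarrow> (b, complex_of_real (l b) *\<^sub>C b) \<in> closure D \<cdot> closure D"
    "\<And>b. b \<in> B \<Longrightarrow> 0 \<le> l b"
    "\<And>\<epsilon>. \<epsilon> > 0 \<Longrightarrow> (\<lambda>b. exp (- \<epsilon> * l b)) summable_on B"
proof -
  note D = essentially_self_adjoint_closure[OF self_adjoint(1)]
  let ?T = "closure D \<cdot> closure D"
  have sub: "cvec.subspace ?T" by (intro csubspace_op_prod D)
  have sym: "symmetric_op ?T"
    unfolding symmetric_op_def op_prod_def
  proof (intro allI impI)
    fix x w u v assume "(x, w) \<in> closure D O closure D" "(u, v) \<in> closure D O closure D"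
    then obtain a b where "(x, a) \<in> closure D" "(a, w) \<in> closure D" "(u, b) \<in> closure D" "(b, v) \<in> closure D"
      by auto
    then show "cinner w u = cinner x v" using symmetric_opD[OF D(2)] by metis
  qed
  have heat: "heat_bounded \<epsilon> ?T" if "\<epsilon> > 0" for \<epsilon>
  proof -
    \<comment> \<open>Halved in advance, because \<open>heat_boundedI\<close> doubles the
      parameter.\<close>
    have "\<epsilon> / 2 > 0" using that by simp
    then obtain E where "is_function_of ?T (\<lambda>t. exp (- (\<epsilon> / 2) * t)) (graph E)" "trace_class E"
      using heat_trace_class by blast
    then have "heat_bounded (2 * (\<epsilon> / 2)) ?T" by (rule heat_boundedI)
    then show ?thesis by simp
  qed
  \<comment> \<open>Any positive parameter would do: only the resolution \<open>P\<close> is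
    kept.\<close>
  obtain E P where "projection_valued_measure P" "is_spectral_integral P (\<lambda>t. t) ?T"
    using heat_trace_class[of 1] by (auto simp: is_function_of_def)
  then interpret spectral_resolution P ?T by unfold_locales (use sym in auto)
  obtain B l where B: "orthonormal_basis B" "\<And>b. b \<in> B \<Longrightarrow> (b, complex_of_real (l b) *\<^sub>C b) \<in> ?T"
    "\<And>\<epsilon>. \<epsilon> > 0 \<Longrightarrow> (\<lambda>b. exp (- \<epsilon> * l b)) summable_on B"
    using orthonormal_eigenbasis[OF sub sym heat total_eigenvectors[OF heat zero_less_one]] by auto
  have "0 \<le> l b" if b: "b \<in> B" for b
  proof -
    obtain a where a: "(b, a) \<in> closure D" "(a, complex_of_real (l b) *\<^sub>C b) \<in> closure D"
      using B(2)[OF b] by (auto simp: op_prod_def)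
    \<comment> \<open>The eigenvalue is the squared norm of the image \<open>a\<close> of
      \<open>b\<close> under \<open>closure D\<close>.\<close>
    have "cinner a a = cinner b (complex_of_real (l b) *\<^sub>C b)" using symmetric_opD[OF D(2) a] .
    also have "\<dots> = complex_of_real (l b)"
      using B(1) b by (simp add: cinner_linear orthonormal_basis_def)
    finally have "l b = (norm a)\<^sup>2" unfolding cinner_self by (metis of_real_eq_iff)
    then show ?thesis by simp
  qed
  then show thesis using that B by blast
qed

section \<open>Tensor products of Hilbert spaces and bounded operators\<close>

text \<open>This normal form has one summand per index; when two sums are added, summands with equal
  index merge by linearity. It serves expansions along a basis of the second factor in the Hilbert
  space and in the algebraic tensor product.\<close>

lemma csubspace_finite_sums:
  fixes \<phi> :: "'b \<Rightarrow> 'a::complex_vector \<Rightarrow> 'v::complex_vector"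
  assumes lin: "\<And>b. clinear (\<phi> b)"
  shows "cvec.subspace {\<Sum>b\<in>F. \<phi> b (x b) | F x. finite F \<and> F \<subseteq> C}" (is "cvec.subspace ?V")
proof (rule cvec.subspaceI)
  show "0 \<in> ?V" by (rule CollectI, intro exI[of _ "{}"]) auto
next
  fix u v assume "u \<in> ?V" "v \<in> ?V"
  then obtain F x G y where F: "finite F" "F \<subseteq> C" "u = (\<Sum>b\<in>F. \<phi> b (x b))"
    and G: "finite G" "G \<subseteq> C" "v = (\<Sum>b\<in>G. \<phi> b (y b))" by auto
  define z where "z b = (if b \<in> F then x b else 0) + (if b \<in> G then y b else 0)" for b
  have "u = (\<Sum>b\<in>F \<union> G. \<phi> b (if b \<in> F then x b else 0))"
    unfolding F(3) using F G by (intro sum.mono_neutral_cong_left) (auto simp: clinear_0[OF lin])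
  moreover have "v = (\<Sum>b\<in>F \<union> G. \<phi> b (if b \<in> G then y b else 0))"
    unfolding G(3) using F G by (intro sum.mono_neutral_cong_left) (auto simp: clinear_0[OF lin])
  ultimately have "u + v = (\<Sum>b\<in>F \<union> G. \<phi> b (z b))"
    by (simp add: z_def clinear_add[OF lin] sum.distrib)
  then show "u + v \<in> ?V" using F G by blast
next
  fix c u assume "u \<in> ?V"
  then obtain F x where F: "finite F" "F \<subseteq> C" "u = (\<Sum>b\<in>F. \<phi> b (x b))" by auto
  then have "c *\<^sub>C u = (\<Sum>b\<in>F. \<phi> b (c *\<^sub>C x b))"
    by (simp add: cvec.scale_sum_right clinear_scaleC[OF lin])
  then show "c *\<^sub>C u \<in> ?V" using F by (intro CollectI exI[of _ F] exI[of _ "\<lambda>b. c *\<^sub>C x b"]) simp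
qed

lemma countable_dense_of_total:
  fixes X :: "'h::complex_hilbert set"
  assumes "countable X" and total: "closure (cvec.span X) = UNIV"
  shows "\<exists>Y :: 'h set. countable Y \<and> closure Y = UNIV"
proof -
  obtain Q :: "complex set" where Q: "countable Q" and dense: "\<And>U. open U \<Longrightarrow> U \<noteq> {} \<Longrightarrow> \<exists>q\<in>Q. q \<in> U"
    using countable_dense_setE by metis
  have "x \<in> closure Q" for x
  proof -
    have "\<exists>q\<in>Q. dist q x < e" if "e > 0" for e
      using dense[of "ball x e"] that by (auto simp: dist_commute)
    then show ?thesis by (simp add: closure_approachable)
  qed
  then have clQ: "closure Q = UNIV" by auto
  \<comment> \<open>Lists of summands rather than finite sets, so that addition becomes
    concatenation.\<close>
  define s where "s xs = (\<Sum>(q, b)\<leftarrow>xs. q *\<^sub>C b)" for xs :: "(complex \<times> 'h) list"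
  define L where "L = s ` lists (Q \<times> X)"
  have L: "countable L" unfolding L_def using Q assms(1) by (intro countable_image countable_lists) auto
  have add: "u + v \<in> closure L" if uv: "u \<in> closure L" "v \<in> closure L" for u v
  proof -
    have LL: "a + b \<in> L" if "a \<in> L" "b \<in> L" for a b
    proof -
      from that obtain xs ys where xs: "xs \<in> lists (Q \<times> X)" "ys \<in> lists (Q \<times> X)" "a = s xs" "b = s ys"
        by (auto simp: L_def)
      then have "a + b = s (xs @ ys)" "xs @ ys \<in> lists (Q \<times> X)" by (auto simp: s_def)
      then show ?thesis by (auto simp: L_def)
    qed
    from uv obtain a b where "\<forall>n. a n \<in> L" "a \<longlonglongrightarrow> u" "\<forall>n. b n \<in> L" "b \<longlonglongrightarrow> v"
      by (auto simp: closure_sequential)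
    then show ?thesis
      unfolding closure_sequential by (intro exI[of _ "\<lambda>n. a n + b n"]) (auto intro: tendsto_add LL)
  qed
  have zero: "0 \<in> closure L"
    by (rule closure_subset[THEN subsetD]) (auto simp: L_def s_def intro!: image_eqI[of _ _ "[]"])
  have scale: "c *\<^sub>C b \<in> closure L" if b: "b \<in> X" for c b
  proof -
    have "(\<lambda>c. c *\<^sub>C b) ` closure Q \<subseteq> closure L"
    proof (rule image_closure_subset)
      show "continuous_on (closure Q) (\<lambda>c. c *\<^sub>C b)" by (intro continuous_intros)
      show "(\<lambda>c. c *\<^sub>C b) ` Q \<subseteq> closure L"
      proof safe
        fix q assume "q \<in> Q"
        then have "s [(q, b)] \<in> L" using b unfolding L_def by (intro imageI) auto
        then show "q *\<^sub>C b \<in> closure L" by (auto simp: s_def intro: closure_subset[THEN subsetD])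
      qed
    qed simp
    then show ?thesis using clQ by auto
  qed
  have sum: "(\<Sum>a\<in>t. r a *\<^sub>C a) \<in> closure L" if "finite t" "t \<subseteq> X" for t r
    using that by (induction t rule: finite_induct) (auto intro: zero add scale)
  have "cvec.span X \<subseteq> closure L"
    unfolding cvec.span_explicit by (auto intro: sum)
  then have "closure (cvec.span X) \<subseteq> closure L" by (intro closure_minimal) auto
  then show ?thesis using total L by auto
qed

locale hilbert_tensor_product =
  fixes tp :: "'h1::complex_hilbert \<Rightarrow> 'h2::complex_hilbert \<Rightarrow> 'k::complex_hilbert"
  assumes hilbert_tensor: "hilbert_tensor tp"
begin

lemma add_left: "tp (x + x') y = tp x y + tp x' y"
  and add_right: "tp x (y + y') = tp x y + tp x y'"
  and scaleC_left: "tp (c *\<^sub>C x) y = c *\<^sub>C tp x y"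
  and scaleC_right: "tp x (c *\<^sub>C y) = c *\<^sub>C tp x y"
  and cinner_tp: "cinner (tp x y) (tp x' y') = cinner x x' * cinner y y'"
  and total: "closure (cvec.span {tp x y | x y. True}) = UNIV"
  using hilbert_tensor by (auto simp: hilbert_tensor_def cbilinear_def clinear_def)

lemma clinear_left: "clinear (\<lambda>x. tp x y)" and clinear_right: "clinear (tp x)"
  by (auto simp: clinear_def add_left add_right scaleC_left scaleC_right)

lemmas zero_left = clinear_0[OF clinear_left] and zero_right = clinear_0[OF clinear_right]
  and minus_left = clinear_minus[OF clinear_left] and minus_right = clinear_minus[OF clinear_right]

lemmas linear_simps = add_left add_right scaleC_left scaleC_right zero_left zero_right
  minus_left minus_right

lemma norm_tp: "norm (tp x y) = norm x * norm y"
proof -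
  have "cinner (tp x y) (tp x y) = complex_of_real ((norm x * norm y)\<^sup>2)"
    unfolding cinner_tp by (simp only: cinner_self of_real_mult power_mult_distrib)
  then have "(norm (tp x y))\<^sup>2 = (norm x * norm y)\<^sup>2"
    by (simp only: norm_sq_cinner Re_complex_of_real)
  then show ?thesis by (rule power2_eq_imp_eq) auto
qed

lemma bounded_bilinear_tp: "bounded_bilinear tp"
  by (rule bounded_bilinear.intro)
     (auto simp: linear_simps scaleR_scaleC norm_tp intro!: exI[of _ 1])

lemmas continuous_on_tp = bounded_bilinear.continuous_on[OF bounded_bilinear_tp]

lemma total_product:
  fixes X :: "'h1 set" and Y :: "'h2 set"
  assumes X: "closure (cvec.span X) = UNIV" and Y: "closure (cvec.span Y) = UNIV"
  shows "closure (cvec.span {tp x y | x y. x \<in> X \<and> y \<in> Y}) = UNIV" (is "?V = UNIV")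
proof -
  have sub: "cvec.subspace ?V" by (intro closure_csubspace cvec.subspace_span)
  have 1: "tp x y \<in> ?V" if y: "y \<in> Y" for x y
  proof (rule total_induct[OF X, where P = "\<lambda>x. tp x y \<in> ?V"])
    show "cvec.subspace {x. tp x y \<in> ?V}"
      using sub by (auto simp: cvec.subspace_def linear_simps)
    have "closed ((\<lambda>x. tp x y) -` ?V)"
      by (intro closed_vimage closed_closure continuous_on_tp continuous_intros)
    then show "closed {x. tp x y \<in> ?V}" by (simp add: vimage_def)
    show "tp x y \<in> ?V" if "x \<in> X" for x
      using that y by (intro closure_subset[THEN subsetD] cvec.span_base) auto
  qed
  have "tp x y \<in> ?V" for x y
  proof (rule total_induct[OF Y, where P = "\<lambda>y. tp x y \<in> ?V"])
    show "cvec.subspace {y. tp x y \<in> ?V}"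
      using sub by (auto simp: cvec.subspace_def linear_simps)
    have "closed ((\<lambda>y. tp x y) -` ?V)"
      by (intro closed_vimage closed_closure continuous_on_tp continuous_intros)
    then show "closed {y. tp x y \<in> ?V}" by (simp add: vimage_def)
  qed (rule 1)
  then have "cvec.span {tp x y | x y. True} \<subseteq> ?V" using sub by (intro cvec.span_minimal) auto
  then have "closure (cvec.span {tp x y | x y. True}) \<subseteq> ?V" by (intro closure_minimal) auto
  then show ?thesis using total by auto
qed

lemma orthonormal_basis_product:
  assumes "orthonormal_basis B" "orthonormal_basis C"
  shows "orthonormal_basis {tp b c | b c. b \<in> B \<and> c \<in> C}" "inj_on (\<lambda>(b, c). tp b c) (B \<times> C)"
proof -
  have o: "cinner (tp b c) (tp b' c') = (if b = b' \<and> c = c' then 1 else 0)"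
    if "b \<in> B" "b' \<in> B" "c \<in> C" "c' \<in> C" for b b' c c'
    using that assms by (simp add: cinner_tp orthonormal_basis_def)
  have eq: "b = b' \<and> c = c'" if "b \<in> B" "b' \<in> B" "c \<in> C" "c' \<in> C" "tp b c = tp b' c'" for b b' c c'
    using o[of b b' c c'] o[of b b c c] that by (metis zero_neq_one)
  then show "inj_on (\<lambda>(b, c). tp b c) (B \<times> C)" by (auto simp: inj_on_def)
  show "orthonormal_basis {tp b c | b c. b \<in> B \<and> c \<in> C}"
    unfolding orthonormal_basis_def
    using total_product[OF assms[THEN orthonormal_basis_total]] by (auto simp: o)
qed

lemma separable_product:
  fixes X :: "'h1 set" and Y :: "'h2 set"
  assumes "countable X" "closure X = UNIV" "countable Y" "closure Y = UNIV"
  shows "\<exists>Z :: 'k set. countable Z \<and> closure Z = UNIV"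
proof (rule countable_dense_of_total)
  have "{tp x y | x y. x \<in> X \<and> y \<in> Y} = (\<lambda>(x, y). tp x y) ` (X \<times> Y)" by auto
  then show "countable {tp x y | x y. x \<in> X \<and> y \<in> Y}" using assms by auto
  have "closure (cvec.span X) = UNIV" "closure (cvec.span Y) = UNIV"
    using assms closure_mono[OF cvec.span_superset[of X]] closure_mono[OF cvec.span_superset[of Y]] by auto
  then show "closure (cvec.span {tp x y | x y. x \<in> X \<and> y \<in> Y}) = UNIV" by (rule total_product)
qed

lemma flip: "hilbert_tensor_product (\<lambda>y x. tp x y)"
proof
  have "{tp x y | y x. True} = {tp x y | x y. True}" by auto
  then show "hilbert_tensor (\<lambda>y x. tp x y)"
    using hilbert_tensor unfolding hilbert_tensor_def cbilinear_def by (auto simp: mult.commute)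
qed

text \<open>For sums along an orthonormal basis \<open>C\<close> of the second factor, the squared
  norm is the sum of the squared norms of the coefficients, so applying \<open>S\<close> to the
  coefficients is bounded. As \<open>G\<close> is only a relation, well-definedness follows from the
  same estimate.\<close>

lemma tensor_left_exists:
  fixes C :: "'h2 set"
  assumes S: "bounded_op S" and C: "orthonormal_basis C"
  shows "\<exists>F. bounded_op F \<and> (\<forall>x y. F (tp x y) = tp (S x) y)"
proof -
  define \<phi> where "\<phi> c x = (tp x c, tp (S x) c)" for c x
  have lin: "clinear (\<phi> c)" for c
    by (auto simp: clinear_def \<phi>_def linear_simps bounded_op_add[OF S] bounded_op_scaleC[OF S])
  define G where "G = {\<Sum>c\<in>F. \<phi> c (x c) | F x. finite F \<and> F \<subseteq> C}"
  obtain k where k: "k > 0" "\<And>x. norm (S x) \<le> k * norm x" using bounded_op_bound[OF S] by blast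
  have sub: "cvec.subspace G" unfolding G_def by (rule csubspace_finite_sums[OF lin])
  have nrm: "(norm (\<Sum>c\<in>F. tp (x c) c))\<^sup>2 = (\<Sum>c\<in>F. (norm (x c))\<^sup>2)"
    if F: "finite F" "F \<subseteq> C" for F and x :: "'h2 \<Rightarrow> 'h1"
  proof -
    have "cinner (\<Sum>c\<in>F. tp (x c) c) (\<Sum>c\<in>F. tp (x c) c) =
        (\<Sum>c\<in>F. \<Sum>d\<in>F. cinner (x c) (x d) * cinner c d)"
      by (simp add: cinner_sum_left cinner_sum_right cinner_tp) (rule sum.swap)
    also have "\<dots> = (\<Sum>c\<in>F. \<Sum>d\<in>F. if c = d then cinner (x c) (x c) else 0)"
    proof (intro sum.cong refl)
      fix c d assume "c \<in> F" "d \<in> F"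
      then have "c \<in> C" "d \<in> C" using F(2) by auto
      then have "cinner c d = (if c = d then 1 else 0)" using C by (simp add: orthonormal_basis_def)
      then show "cinner (x c) (x d) * cinner c d = (if c = d then cinner (x c) (x c) else 0)" by simp
    qed
    also have "\<dots> = (\<Sum>c\<in>F. cinner (x c) (x c))" using F by simp
    finally show ?thesis by (simp add: norm_sq_cinner)
  qed
  obtain F where F: "bounded_op F" "\<And>p q. (p, q) \<in> G \<Longrightarrow> F p = q"
  proof (rule bounded_extension[OF sub, of k])
    fix p q assume "(p, q) \<in> G"
    then obtain J x where J: "finite J" "J \<subseteq> C" "(p, q) = (\<Sum>c\<in>J. \<phi> c (x c))" by (auto simp: G_def)
    then have pq: "p = (\<Sum>c\<in>J. tp (x c) c)" "q = (\<Sum>c\<in>J. tp (S (x c)) c)"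
      by (simp_all add: prod_eq_iff fst_sum snd_sum \<phi>_def)
    have "(norm q)\<^sup>2 = (\<Sum>c\<in>J. (norm (S (x c)))\<^sup>2)" unfolding pq(2) using J by (intro nrm)
    also have "\<dots> \<le> (\<Sum>c\<in>J. (k * norm (x c))\<^sup>2)" by (intro sum_mono power_mono k) simp
    also have "\<dots> = (k * norm p)\<^sup>2"
      unfolding pq(1) power_mult_distrib nrm[OF J(1,2)] by (simp add: sum_distrib_left)
    finally show "norm q \<le> k * norm p" by (rule power2_le_imp_le) (use k(1) in simp)
  next
    have "tp x c \<in> Domain G" if "c \<in> C" for x c
    proof (rule DomainI)
      show "(tp x c, tp (S x) c) \<in> G"
        unfolding G_def using that by (intro CollectI exI[of _ "{c}"] exI[of _ "\<lambda>_. x"]) (auto simp: \<phi>_def)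
    qed
    then have "cvec.span {tp x c | x c. x \<in> UNIV \<and> c \<in> C} \<subseteq> Domain G"
      by (intro cvec.span_minimal csubspace_Domain sub) auto
    moreover have "closure (cvec.span {tp x c | x c. x \<in> UNIV \<and> c \<in> C}) = UNIV"
      by (intro total_product orthonormal_basis_total[OF C]) simp
    ultimately show "closure (Domain G) = UNIV" using closure_mono by blast
  qed blast
  have "F (tp x y) = tp (S x) y" for x y
  proof (rule total_induct[OF orthonormal_basis_total[OF C], where P = "\<lambda>y. F (tp x y) = tp (S x) y"])
    show "cvec.subspace {y. F (tp x y) = tp (S x) y}"
      by (auto simp: cvec.subspace_def linear_simps bounded_op_0[OF F(1)] bounded_op_add[OF F(1)]
          bounded_op_scaleC[OF F(1)])
    show "closed {y. F (tp x y) = tp (S x) y}"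
      by (intro closed_Collect_eq bounded_op_continuous[OF F(1)] continuous_on_tp continuous_intros)
    show "F (tp x y) = tp (S x) y" if "y \<in> C" for y
      using that by (intro F(2), unfold G_def)
        (intro CollectI exI[of _ "{y}"] exI[of _ "\<lambda>_. x"], auto simp: \<phi>_def)
  qed
  then show ?thesis using F(1) by blast
qed

end

text \<open>In the application both bases are the eigenbases of the squared operators.\<close>

locale hilbert_tensor_bases = hilbert_tensor_product tp
  for tp :: "'h1::complex_hilbert \<Rightarrow> 'h2::complex_hilbert \<Rightarrow> 'k::complex_hilbert" +
  assumes bases: "\<exists>B :: 'h1 set. orthonormal_basis B" "\<exists>C :: 'h2 set. orthonormal_basis C"
begin

abbreviation bt where "bt \<equiv> bounded_tensor tp"

lemma tensor_op_eqI:
  assumes "bounded_op F" "bounded_op G" "\<And>x y. F (tp x y) = G (tp x y)"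
  shows "F = G"
  by (rule total_op_eq[OF total]) (use assms in auto)

text \<open>Existence comes from composing \<open>S \<otimes> 1\<close> with
  \<open>1 \<otimes> T\<close>; the latter is the former with the factors exchanged.\<close>

lemma bounded_tensor_ex1:
  assumes S: "bounded_op S" and T: "bounded_op T"
  shows "\<exists>!F. bounded_op F \<and> (\<forall>x y. F (tp x y) = tp (S x) (T y))"
proof -
  obtain B :: "'h1 set" and C :: "'h2 set" where B: "orthonormal_basis B" and C: "orthonormal_basis C"
    using bases by blast
  interpret fl: hilbert_tensor_product "\<lambda>y x. tp x y" by (rule flip)
  obtain F where F: "bounded_op F" "\<And>x y. F (tp x y) = tp (S x) y"
    using tensor_left_exists[OF S C] by blast
  obtain G where G: "bounded_op G" "\<And>y x. G (tp x y) = tp x (T y)"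
    using fl.tensor_left_exists[OF T B] by blast
  have "bounded_op (F \<circ> G)" by (rule bounded_op_comp[OF F(1) G(1)])
  moreover have "(F \<circ> G) (tp x y) = tp (S x) (T y)" for x y by (simp add: F G)
  ultimately show ?thesis by (intro ex1I[of _ "F \<circ> G"]) (auto intro: tensor_op_eqI)
qed

lemma
  assumes S: "bounded_op S" and T: "bounded_op T"
  shows bounded_op_bt: "bounded_op (bt S T)" and bt_tp: "bt S T (tp x y) = tp (S x) (T y)"
  using theI'[OF bounded_tensor_ex1[OF assms]] unfolding bounded_tensor_def by auto

lemma bt_eqI:
  assumes "bounded_op S" "bounded_op T" "bounded_op F" "\<And>x y. F (tp x y) = tp (S x) (T y)"
  shows "bt S T = F"
  by (rule tensor_op_eqI) (use assms bounded_op_bt bt_tp in auto)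

lemma bt_comp:
  assumes "bounded_op S" "bounded_op T" "bounded_op S'" "bounded_op T'"
  shows "bt S T \<circ> bt S' T' = bt (S \<circ> S') (T \<circ> T')"
  by (rule bt_eqI[symmetric]) (use assms in \<open>auto intro!: bounded_op_comp bounded_op_bt simp: bt_tp\<close>)

lemma bt_id: "bt id id = id"
  by (rule bt_eqI) (auto intro: bounded_op_id)

lemma bt_is_adjoint:
  assumes "bounded_op S" "bounded_op T" "bounded_op S'" "bounded_op T'"
    and "is_adjoint S S'" "is_adjoint T T'"
  shows "is_adjoint (bt S T) (bt S' T')"
  by (rule total_is_adjoint[OF total])
     (use assms in \<open>auto intro!: bounded_op_bt simp: bt_tp cinner_tp is_adjoint_def\<close>)

lemma bt_self_adjoint_unitary:
  assumes "self_adjoint_unitary U" "self_adjoint_unitary V"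
  shows "self_adjoint_unitary (bt U V)"
  using assms bt_is_adjoint[of U V U V] bt_comp[of U V U V] bounded_op_bt[of U V]
  by (simp add: self_adjoint_unitary_def bt_id)

end

section \<open>The tensor product representation\<close>

locale tensor_representations = hilbert_tensor_bases tp
  for tp :: "'h1::complex_hilbert \<Rightarrow> 'h2::complex_hilbert \<Rightarrow> 'k::complex_hilbert" +
  fixes ta :: "'a1::complex_star_algebra \<Rightarrow> 'a2::complex_star_algebra \<Rightarrow> 't::complex_star_algebra"
    and \<pi>1 :: "'a1 \<Rightarrow> 'h1 \<Rightarrow> 'h1" and \<pi>2 :: "'a2 \<Rightarrow> 'h2 \<Rightarrow> 'h2"
  assumes algebra_tensor: "algebra_tensor ta"
    and faithful1: "faithful_representation \<pi>1" and faithful2: "faithful_representation \<pi>2"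
begin

lemma b1: "bounded_op (\<pi>1 a)" and b2: "bounded_op (\<pi>2 b)"
  using faithful1 faithful2 by (auto simp: faithful_representation_def)

lemma l1: "clinear (\<lambda>a. \<pi>1 a x)" and l2: "clinear (\<lambda>b. \<pi>2 b y)"
  using faithful1 faithful2 by (auto simp: faithful_representation_def)

lemma ta_add_left: "ta (a + a') b = ta a b + ta a' b"
  and ta_scaleC_left: "ta (c *\<^sub>C a) b = c *\<^sub>C ta a b"
  and ta_add_right: "ta a (b + b') = ta a b + ta a b'"
  and ta_scaleC_right: "ta a (c *\<^sub>C b) = c *\<^sub>C ta a b"
  and ta_mult: "ta a b * ta a' b' = ta (a * a') (b * b')"
  and ta_one: "ta 1 1 = 1"
  and ta_involution: "involution (ta a b) = ta (involution a) (involution b)"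
  and ta_span: "cvec.span {ta a b | a b. True} = UNIV"
  and ta_universal: "cbilinear f \<Longrightarrow> \<exists>g. clinear g \<and> (\<forall>a b. g (ta a b) = (f a b :: complex))"
  using algebra_tensor by (auto simp: algebra_tensor_def cbilinear_def clinear_def)

lemma ta_clinear: "clinear (\<lambda>a. ta a b)" "clinear (ta a)"
  by (auto simp: clinear_def ta_add_left ta_scaleC_left ta_add_right ta_scaleC_right)

lemma ta_induct:
  assumes "cvec.subspace {t. Q t}" "\<And>a b. Q (ta a b)"
  shows "Q t"
proof -
  have "cvec.span {ta a b | a b. True} \<subseteq> {t. Q t}" using assms by (intro cvec.span_minimal) auto
  then show ?thesis using ta_span by auto
qed

abbreviation \<rho> where "\<rho> a b \<equiv> bt (\<pi>1 a) (\<pi>2 b)"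

lemma \<rho>_add_left: "\<rho> (a + a') b x = \<rho> a b x + \<rho> a' b x"
  using bt_eqI[of "\<pi>1 (a + a')" "\<pi>2 b" "\<lambda>x. \<rho> a b x + \<rho> a' b x"]
  by (simp add: b1 b2 bounded_op_plus bounded_op_bt bt_tp clinear_add[OF l1] linear_simps)

lemma \<rho>_add_right: "\<rho> a (b + b') x = \<rho> a b x + \<rho> a b' x"
  using bt_eqI[of "\<pi>1 a" "\<pi>2 (b + b')" "\<lambda>x. \<rho> a b x + \<rho> a b' x"]
  by (simp add: b1 b2 bounded_op_plus bounded_op_bt bt_tp clinear_add[OF l2] linear_simps)

lemma \<rho>_scaleC_left: "\<rho> (c *\<^sub>C a) b x = c *\<^sub>C \<rho> a b x"
  using bt_eqI[of "\<pi>1 (c *\<^sub>C a)" "\<pi>2 b" "\<lambda>x. c *\<^sub>C \<rho> a b x"]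
  by (simp add: b1 b2 bounded_op_scale bounded_op_bt bt_tp clinear_scaleC[OF l1] linear_simps)

lemma \<rho>_scaleC_right: "\<rho> a (c *\<^sub>C b) x = c *\<^sub>C \<rho> a b x"
  using bt_eqI[of "\<pi>1 a" "\<pi>2 (c *\<^sub>C b)" "\<lambda>x. c *\<^sub>C \<rho> a b x"]
  by (simp add: b1 b2 bounded_op_scale bounded_op_bt bt_tp clinear_scaleC[OF l2] linear_simps)

text \<open>The universal property in \<open>algebra_tensor\<close> concerns scalar-valued maps, so
  it is applied to each matrix element of \<open>\<rho> a b\<close>. The \<open>t\<close> for which
  the functionals \<open>g \<xi> \<eta>\<close> are the matrix elements of one operator form a
  subspace containing all elementary tensors.\<close>

lemma tensor_representation_ex1:
  "\<exists>!\<Theta>. (\<forall>x. clinear (\<lambda>t. \<Theta> t x)) \<and> (\<forall>a b. \<Theta> (ta a b) = \<rho> a b)"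
proof -
  have "\<exists>g. clinear g \<and> (\<forall>a b. g (ta a b) = cinner \<xi> (\<rho> a b \<eta>))" for \<xi> \<eta>
    by (rule ta_universal)
       (simp add: cbilinear_def clinear_def \<rho>_add_left \<rho>_add_right \<rho>_scaleC_left \<rho>_scaleC_right
         cinner_linear scaleC_complex_def)
  then obtain g where g: "\<And>\<xi> \<eta>. clinear (g \<xi> \<eta>)" "\<And>\<xi> \<eta> a b. g \<xi> \<eta> (ta a b) = cinner \<xi> (\<rho> a b \<eta>)"
    by metis
  have "\<exists>A. \<forall>\<xi> \<eta>. cinner \<xi> (A \<eta>) = g \<xi> \<eta> t" for t
  proof (rule ta_induct[of "\<lambda>t. \<exists>A. \<forall>\<xi> \<eta>. cinner \<xi> (A \<eta>) = g \<xi> \<eta> t"])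
    show "cvec.subspace {t. \<exists>A. \<forall>\<xi> \<eta>. cinner \<xi> (A \<eta>) = g \<xi> \<eta> t}"
    proof (rule cvec.subspaceI; clarsimp)
      show "\<exists>A. \<forall>\<xi> \<eta>. cinner \<xi> (A \<eta>) = g \<xi> \<eta> 0"
        by (intro exI[of _ "\<lambda>_. 0"]) (simp add: clinear_0[OF g(1)])
      fix s t A A' assume "\<forall>\<xi> \<eta>. cinner \<xi> (A \<eta>) = g \<xi> \<eta> s" "\<forall>\<xi> \<eta>. cinner \<xi> (A' \<eta>) = g \<xi> \<eta> t"
      then show "\<exists>A. \<forall>\<xi> \<eta>. cinner \<xi> (A \<eta>) = g \<xi> \<eta> (s + t)"
        by (intro exI[of _ "\<lambda>\<eta>. A \<eta> + A' \<eta>"]) (simp add: clinear_add[OF g(1)] cinner_linear)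
    next
      fix c s A assume "\<forall>\<xi> \<eta>. cinner \<xi> (A \<eta>) = g \<xi> \<eta> s"
      then show "\<exists>A. \<forall>\<xi> \<eta>. cinner \<xi> (A \<eta>) = g \<xi> \<eta> (c *\<^sub>C s)"
        by (intro exI[of _ "\<lambda>\<eta>. c *\<^sub>C A \<eta>"])
           (simp add: clinear_scaleC[OF g(1)] cinner_linear scaleC_complex_def)
    qed
    show "\<exists>A. \<forall>\<xi> \<eta>. cinner \<xi> (A \<eta>) = g \<xi> \<eta> (ta a b)" for a b
      by (intro exI[of _ "\<rho> a b"]) (simp add: g(2))
  qed
  then obtain \<Theta> where \<Theta>: "\<And>t \<xi> \<eta>. cinner \<xi> (\<Theta> t \<eta>) = g \<xi> \<eta> t" by metis
  show ?thesis
  proof (intro ex1I[of _ \<Theta>] conjI allI)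
    show lin: "clinear (\<lambda>t. \<Theta> t x)" for x
      unfolding clinear_def
    proof (intro conjI allI cinner_eqI)
      show "cinner u (\<Theta> (s + t) x) = cinner u (\<Theta> s x + \<Theta> t x)" for u s t
        unfolding cinner_add_right \<Theta> by (rule clinear_add[OF g(1)])
      show "cinner u (\<Theta> (c *\<^sub>C t) x) = cinner u (c *\<^sub>C \<Theta> t x)" for u c t
        unfolding cinner_scaleC_right \<Theta> clinear_scaleC[OF g(1)] scaleC_complex_def ..
    qed
    show ta: "\<Theta> (ta a b) = \<rho> a b" for a b
      by (rule ext, rule cinner_eqI) (simp only: \<Theta> g(2))
    fix \<Theta>' assume "(\<forall>x. clinear (\<lambda>t. \<Theta>' t x)) \<and> (\<forall>a b. \<Theta>' (ta a b) = \<rho> a b)"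
    then have lin': "clinear (\<lambda>t. \<Theta>' t x)" and ta': "\<Theta>' (ta a b) = \<rho> a b" for x a b by auto
    have "\<Theta>' t x = \<Theta> t x" for t x
      by (rule ta_induct[of "\<lambda>t. \<Theta>' t x = \<Theta> t x"])
         (auto simp: cvec.subspace_def clinear_0[OF lin] clinear_0[OF lin'] clinear_add[OF lin]
           clinear_add[OF lin'] clinear_scaleC[OF lin] clinear_scaleC[OF lin'] ta ta')
    then show "\<Theta>' = \<Theta>" by blast
  qed
qed

abbreviation \<Theta> where "\<Theta> \<equiv> tensor_representation ta tp \<pi>1 \<pi>2"

lemma \<Theta>_clinear: "clinear (\<lambda>t. \<Theta> t x)" and \<Theta>_ta: "\<Theta> (ta a b) = \<rho> a b"
  using theI'[OF tensor_representation_ex1] unfolding tensor_representation_def by auto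

lemmas \<Theta>_add = clinear_add[OF \<Theta>_clinear] and \<Theta>_scaleC = clinear_scaleC[OF \<Theta>_clinear]
  and \<Theta>_0 = clinear_0[OF \<Theta>_clinear] and \<Theta>_diff = clinear_diff[OF \<Theta>_clinear]

lemma bounded_op_\<Theta>: "bounded_op (\<Theta> t)"
proof (rule ta_induct[of "\<lambda>t. bounded_op (\<Theta> t)"])
  have "\<Theta> 0 = (\<lambda>x. 0)" "\<And>s t. \<Theta> (s + t) = (\<lambda>x. \<Theta> s x + \<Theta> t x)" "\<And>c t. \<Theta> (c *\<^sub>C t) = (\<lambda>x. c *\<^sub>C \<Theta> t x)"
    by (auto simp: \<Theta>_0 \<Theta>_add \<Theta>_scaleC)
  then show "cvec.subspace {t. bounded_op (\<Theta> t)}"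
    by (auto simp: cvec.subspace_def bounded_op_zero bounded_op_plus bounded_op_scale)
qed (simp add: \<Theta>_ta bounded_op_bt b1 b2)

lemma \<Theta>_commute:
  assumes U: "bounded_op U" and "\<And>a b. U \<circ> \<rho> a b = \<rho> a b \<circ> U"
  shows "U \<circ> \<Theta> t = \<Theta> t \<circ> U"
proof
  fix x show "(U \<circ> \<Theta> t) x = (\<Theta> t \<circ> U) x"
    by (rule ta_induct[of "\<lambda>t. (U \<circ> \<Theta> t) x = (\<Theta> t \<circ> U) x"])
       (use assms in \<open>auto simp: cvec.subspace_def \<Theta>_0 \<Theta>_add \<Theta>_scaleC bounded_op_0 bounded_op_add
         bounded_op_scaleC \<Theta>_ta fun_eq_iff\<close>)
qed

lemma \<Theta>_mult: "\<Theta> (s * t) = \<Theta> s \<circ> \<Theta> t"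
proof
  fix x
  \<comment> \<open>The left factor is elementary at first; a second induction, over
    \<open>s\<close>, removes this.\<close>
  have 1: "\<Theta> (ta a b * t) x = \<Theta> (ta a b) (\<Theta> t x)" for a b t
  proof (rule ta_induct[of "\<lambda>t. \<Theta> (ta a b * t) x = \<Theta> (ta a b) (\<Theta> t x)"])
    show "cvec.subspace {t. \<Theta> (ta a b * t) x = \<Theta> (ta a b) (\<Theta> t x)}"
      by (auto simp: cvec.subspace_def \<Theta>_0 \<Theta>_add \<Theta>_scaleC distrib_left mult_scaleC_right
          bounded_op_0[OF bounded_op_\<Theta>] bounded_op_add[OF bounded_op_\<Theta>] bounded_op_scaleC[OF bounded_op_\<Theta>])
    fix a' b'
    have "\<rho> (a * a') (b * b') = \<rho> a b \<circ> \<rho> a' b'"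
      using faithful1 faithful2 by (simp add: bt_comp b1 b2 faithful_representation_def)
    then show "\<Theta> (ta a b * ta a' b') x = \<Theta> (ta a b) (\<Theta> (ta a' b') x)"
      by (simp add: ta_mult \<Theta>_ta)
  qed
  show "\<Theta> (s * t) x = (\<Theta> s \<circ> \<Theta> t) x"
    by (rule ta_induct[of "\<lambda>s. \<Theta> (s * t) x = (\<Theta> s \<circ> \<Theta> t) x"])
       (auto simp: cvec.subspace_def \<Theta>_0 \<Theta>_add \<Theta>_scaleC distrib_right mult_scaleC_left 1)
qed

lemma \<Theta>_adjoint: "is_adjoint (\<Theta> t) (\<Theta> (involution t))"
proof (rule ta_induct[of "\<lambda>t. is_adjoint (\<Theta> t) (\<Theta> (involution t))"])
  have inv0: "involution (0 :: 't) = 0"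
    using involution_scaleC[of 0 "0 :: 't"] by simp
  show "cvec.subspace {t. is_adjoint (\<Theta> t) (\<Theta> (involution t))}"
    by (auto simp: cvec.subspace_def is_adjoint_def \<Theta>_0 \<Theta>_add \<Theta>_scaleC inv0 involution_add
        involution_scaleC cinner_linear)
  show "is_adjoint (\<Theta> (ta a b)) (\<Theta> (involution (ta a b)))" for a b
    unfolding ta_involution \<Theta>_ta using faithful1 faithful2
    by (intro bt_is_adjoint b1 b2) (auto simp: faithful_representation_def)
qed

text \<open>Write \<open>t = \<Sum> \<alpha>(b) \<otimes> b\<close> with linearly independent \<open>b\<close>. If \<open>t\<close> acts by zero then so does
  \<open>\<Sum> \<langle>x, \<alpha>(b) x'\<rangle> b\<close> for all \<open>x\<close>, \<open>x'\<close>; faithfulness of the second factor makes the coefficients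
  vanish, and faithfulness of the first factor makes the \<open>\<alpha>(b)\<close> vanish.\<close>

lemma \<Theta>_kernel:
  assumes t: "\<And>x. \<Theta> t x = 0" shows "t = 0"
proof -
  obtain Bs :: "'a2 set" where Bs: "cvec.independent Bs" "UNIV \<subseteq> cvec.span Bs"
    using cvec.basis_exists[of UNIV] by blast
  have "\<exists>F \<alpha>. t = (\<Sum>b\<in>F. ta (\<alpha> b) b) \<and> finite F \<and> F \<subseteq> Bs"
  proof (rule ta_induct[of "\<lambda>t. \<exists>F \<alpha>. t = (\<Sum>b\<in>F. ta (\<alpha> b) b) \<and> finite F \<and> F \<subseteq> Bs"])
    show "cvec.subspace {t. \<exists>F \<alpha>. t = (\<Sum>b\<in>F. ta (\<alpha> b) b) \<and> finite F \<and> F \<subseteq> Bs}"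
      by (rule csubspace_finite_sums) (rule ta_clinear)
    fix a b
    obtain F r where F: "finite F" "F \<subseteq> Bs" "b = (\<Sum>c\<in>F. r c *\<^sub>C c)"
      using Bs(2) unfolding cvec.span_explicit by blast
    have "ta a b = (\<Sum>c\<in>F. ta (r c *\<^sub>C a) c)"
      unfolding F(3) by (simp add: clinear_sum[OF ta_clinear(2)] ta_scaleC_left ta_scaleC_right)
    then show "\<exists>F \<alpha>. ta a b = (\<Sum>b\<in>F. ta (\<alpha> b) b) \<and> finite F \<and> F \<subseteq> Bs"
      using F(1,2) by (intro exI[of _ F] exI[of _ "\<lambda>c. r c *\<^sub>C a"]) auto
  qed
  then obtain F \<alpha> where F: "finite F" "F \<subseteq> Bs" "t = (\<Sum>b\<in>F. ta (\<alpha> b) b)" by auto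
  have "\<alpha> b = 0" if b: "b \<in> F" for b
  proof -
    have "cinner x (\<pi>1 (\<alpha> b) x') = 0" for x x'
    proof -
      define r where "r c = cinner x (\<pi>1 (\<alpha> c) x')" for c
      have "cinner y (\<pi>2 (\<Sum>c\<in>F. r c *\<^sub>C c) y') = 0" for y y'
      proof -
        have "cinner y (\<pi>2 (\<Sum>c\<in>F. r c *\<^sub>C c) y') = (\<Sum>c\<in>F. r c * cinner y (\<pi>2 c y'))"
          by (simp add: clinear_sum[OF l2] clinear_scaleC[OF l2] cinner_sum_right cinner_linear)
        also have "\<dots> = cinner (tp x y) (\<Theta> t (tp x' y'))"
          by (simp add: F(3) clinear_sum[OF \<Theta>_clinear] \<Theta>_ta bt_tp b1 b2 cinner_sum_right cinner_tp r_def)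
        finally show ?thesis by (simp add: t)
      qed
      then have "\<pi>2 (\<Sum>c\<in>F. r c *\<^sub>C c) = \<pi>2 0"
        by (intro ext cinner_eqI) (simp add: clinear_0[OF l2])
      then have "(\<Sum>c\<in>F. r c *\<^sub>C c) = 0"
        using faithful2 by (auto simp: faithful_representation_def inj_eq)
      then have "r b = 0" using Bs(1) F(1,2) b unfolding cvec.dependent_explicit by blast
      then show ?thesis by (simp add: r_def)
    qed
    then have "\<pi>1 (\<alpha> b) = \<pi>1 0" by (intro ext cinner_eqI) (simp add: clinear_0[OF l1])
    then show ?thesis using faithful1 by (auto simp: faithful_representation_def inj_eq)
  qed
  then show ?thesis unfolding F(3) by (simp add: clinear_0[OF ta_clinear(1)])
qed

lemma faithful_representation_\<Theta>: "faithful_representation \<Theta>"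
proof -
  have "\<Theta> 1 = id"
    using faithful1 faithful2 by (simp add: ta_one[symmetric] \<Theta>_ta faithful_representation_def bt_id)
  moreover have "inj \<Theta>"
  proof (rule injI)
    fix s t assume "\<Theta> s = \<Theta> t"
    then have "s - t = 0" by (intro \<Theta>_kernel) (simp add: \<Theta>_diff)
    then show "s = t" by simp
  qed
  ultimately show ?thesis
    unfolding faithful_representation_def
    using bounded_op_\<Theta> \<Theta>_clinear \<Theta>_mult \<Theta>_adjoint by blast
qed

end

section \<open>Intertwining relations\<close>

lemma self_adjoint_unitary_bounded: "self_adjoint_unitary U \<Longrightarrow> bounded_op U"
  and self_adjoint_unitary_adjoint: "self_adjoint_unitary U \<Longrightarrow> cinner (U x) y = cinner x (U y)"
  and self_adjoint_unitary_involutive: "self_adjoint_unitary U \<Longrightarrow> U (U x) = x"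
  by (auto simp: self_adjoint_unitary_def is_adjoint_def fun_eq_iff)

lemma self_adjoint_unitary_id: "self_adjoint_unitary id"
  by (simp add: self_adjoint_unitary_def bounded_op_id is_adjoint_def)

lemma anticommute_graphD: "anticommute (graph U) T \<Longrightarrow> (x, w) \<in> T \<Longrightarrow> (U x, - U w) \<in> T"
proof -
  assume a: "anticommute (graph U) T" and "(x, w) \<in> T"
  then have "(x, U w) \<in> graph U \<cdot> T" by (auto simp: op_prod_def graph_def)
  then have "(x, U w) \<in> op_neg (T \<cdot> graph U)" using a by (simp add: anticommute_def)
  then obtain z where "U w = - z" "(U x, z) \<in> T" by (auto simp: op_neg_def op_prod_def graph_def)
  then show "(U x, - U w) \<in> T" by simp
qed

lemma commute_graphD: "commute (graph U) T \<Longrightarrow> (x, w) \<in> T \<Longrightarrow> (U x, U w) \<in> T"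
proof -
  assume a: "commute (graph U) T" and "(x, w) \<in> T"
  then have "(x, U w) \<in> graph U \<cdot> T" by (auto simp: op_prod_def graph_def)
  then have "(x, U w) \<in> T \<cdot> graph U" using a by (simp add: commute_def)
  then show "(U x, U w) \<in> T" by (auto simp: op_prod_def graph_def)
qed

lemma commute_graphI:
  assumes U: "self_adjoint_unitary U" and T: "\<And>x w. (x, w) \<in> T \<Longrightarrow> (U x, U w) \<in> T"
  shows "commute (graph U) T"
  unfolding commute_def op_prod_def graph_def
proof safe
  fix x w assume "(x, w) \<in> T"
  then show "(x, U w) \<in> {(x, U x) |x. True} O T" by (auto intro: T)
next
  fix x z assume "(U x, z) \<in> T"
  then have "(x, U z) \<in> T" using T[of "U x" z] self_adjoint_unitary_involutive[OF U] by simp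
  then have "(x, U (U z)) \<in> T O {(x, U x) |x. True}" by auto
  then show "(x, z) \<in> T O {(x, U x) |x. True}" using self_adjoint_unitary_involutive[OF U] by simp
qed

lemma anticommute_graphI:
  assumes U: "self_adjoint_unitary U" and T: "\<And>x w. (x, w) \<in> T \<Longrightarrow> (U x, - U w) \<in> T"
  shows "anticommute (graph U) T"
  unfolding anticommute_def op_prod_def op_neg_def graph_def
proof safe
  fix x w assume "(x, w) \<in> T"
  then have "(x, - U w) \<in> {(x, U x) |x. True} O T" by (auto intro: T)
  then show "\<exists>x' y. (x, U w) = (x', - y) \<and> (x', y) \<in> {(x, U x) |x. True} O T"
    by (intro exI[of _ x] exI[of _ "- U w"]) simp
next
  note inv = self_adjoint_unitary_involutive[OF U]
    and mn = bounded_op_minus[OF self_adjoint_unitary_bounded[OF U]]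
  fix x z assume "(U x, z) \<in> T"
  then have "(x, - U z) \<in> T" using T[of "U x" z] by (simp add: inv)
  then have "(x, U (- U z)) \<in> T O {(x, U x) |x. True}" by auto
  then show "(x, - z) \<in> T O {(x, U x) |x. True}" by (simp add: inv mn)
qed

section \<open>The graded sum of two operators\<close>

lemma csubspace_op_sum:
  assumes "cvec.subspace S" "cvec.subspace T" shows "cvec.subspace (S \<oplus> T)"
proof -
  have S: "(0, 0) \<in> S" "\<And>x w y z. (x, w) \<in> S \<Longrightarrow> (y, z) \<in> S \<Longrightarrow> (x + y, w + z) \<in> S"
    "\<And>c x w. (x, w) \<in> S \<Longrightarrow> (c *\<^sub>C x, c *\<^sub>C w) \<in> S" using assms(1) by (auto simp: csubspace_rel)
  have T: "(0, 0) \<in> T" "\<And>x w y z. (x, w) \<in> T \<Longrightarrow> (y, z) \<in> T \<Longrightarrow> (x + y, w + z) \<in> T"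
    "\<And>c x w. (x, w) \<in> T \<Longrightarrow> (c *\<^sub>C x, c *\<^sub>C w) \<in> T" using assms(2) by (auto simp: csubspace_rel)
  show ?thesis
    unfolding csubspace_rel
  proof (intro conjI allI impI)
    show "(0, 0) \<in> S \<oplus> T" using S(1) T(1) by (force simp: op_sum_def)
    fix x w y z assume "(x, w) \<in> S \<oplus> T" "(y, z) \<in> S \<oplus> T"
    then obtain a b c d where "w = a + b" "z = c + d" "(x, a) \<in> S" "(x, b) \<in> T" "(y, c) \<in> S" "(y, d) \<in> T"
      by (auto simp: op_sum_def)
    moreover from this have "w + z = (a + c) + (b + d)" by simp
    ultimately show "(x + y, w + z) \<in> S \<oplus> T"
      using S(2)[of x a y c] T(2)[of x b y d] unfolding op_sum_def by blast
  next
    fix c x w assume "(x, w) \<in> S \<oplus> T"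
    then obtain a b where "w = a + b" "(x, a) \<in> S" "(x, b) \<in> T" by (auto simp: op_sum_def)
    moreover from this have "c *\<^sub>C w = c *\<^sub>C a + c *\<^sub>C b" by (simp add: scaleC_simps)
    ultimately show "(c *\<^sub>C x, c *\<^sub>C w) \<in> S \<oplus> T"
      using S(3)[of x a c] T(3)[of x b c] unfolding op_sum_def by blast
  qed
qed

lemma symmetric_op_sum:
  assumes "symmetric_op S" "symmetric_op T" shows "symmetric_op (S \<oplus> T)"
  unfolding symmetric_op_def
proof (intro allI impI)
  fix x w u v assume "(x, w) \<in> S \<oplus> T" "(u, v) \<in> S \<oplus> T"
  then obtain a b c d where "w = a + b" "v = c + d" "(x, a) \<in> S" "(x, b) \<in> T" "(u, c) \<in> S" "(u, d) \<in> T"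
    by (auto simp: op_sum_def)
  then show "cinner w u = cinner x v"
    using symmetric_opD[OF assms(1), of x a u c] symmetric_opD[OF assms(2), of x b u d]
    by (simp add: cinner_linear)
qed

lemma symmetric_op_graph: "self_adjoint_unitary U \<Longrightarrow> symmetric_op (graph U)"
  by (auto simp: symmetric_op_def graph_def self_adjoint_unitary_adjoint)

lemma (in hilbert_tensor_product) symmetric_op_tensor:
  assumes "symmetric_op S" "symmetric_op T" shows "symmetric_op (op_tensor tp S T)"
  unfolding op_tensor_def
proof (rule symmetric_op_span, unfold symmetric_op_def, intro allI impI)
  fix p q r s
  assume "(p, q) \<in> {(tp x y, tp x' y') |x x' y y'. (x, x') \<in> S \<and> (y, y') \<in> T}"
    "(r, s) \<in> {(tp x y, tp x' y') |x x' y y'. (x, x') \<in> S \<and> (y, y') \<in> T}"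
  then obtain x x' y y' u u' v v' where
    "p = tp x y" "q = tp x' y'" "r = tp u v" "s = tp u' v'"
    "(x, x') \<in> S" "(y, y') \<in> T" "(u, u') \<in> S" "(v, v') \<in> T" by auto
  then show "cinner q r = cinner p s"
    using symmetric_opD[OF assms(1), of x x' u u'] symmetric_opD[OF assms(2), of y y' v v']
    by (simp add: cinner_tp)
qed

text \<open>Used twice with the same bases and eigenvalues: \<open>\<alpha> = \<sigma>1\<close>,
  \<open>\<beta> = id\<close> for the first operator and \<open>\<alpha> = \<gamma>1\<close>,
  \<open>\<beta> = \<sigma>2\<close> for the second.\<close>

locale tensor_dirac = hilbert_tensor_bases tp
  for tp :: "'h1::complex_hilbert \<Rightarrow> 'h2::complex_hilbert \<Rightarrow> 'k::complex_hilbert" +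
  fixes D1 :: "'h1 operator" and D2 :: "'h2 operator" and \<alpha> :: "'h1 \<Rightarrow> 'h1" and \<beta> :: "'h2 \<Rightarrow> 'h2"
    and B1 :: "'h1 set" and B2 :: "'h2 set" and l1 :: "'h1 \<Rightarrow> real" and l2 :: "'h2 \<Rightarrow> real"
  assumes self_adjoint1: "essentially_self_adjoint D1" and self_adjoint2: "essentially_self_adjoint D2"
    and \<alpha>: "self_adjoint_unitary \<alpha>" and \<beta>: "self_adjoint_unitary \<beta>"
    and \<alpha>_D1: "anticommute (graph \<alpha>) (closure D1)" and \<beta>_D2: "commute (graph \<beta>) (closure D2)"
    and basis1: "orthonormal_basis B1" and basis2: "orthonormal_basis B2"
    and eigen1: "b \<in> B1 \<Longrightarrow> (b, complex_of_real (l1 b) *\<^sub>C b) \<in> closure D1 \<cdot> closure D1"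
    and eigen2: "c \<in> B2 \<Longrightarrow> (c, complex_of_real (l2 c) *\<^sub>C c) \<in> closure D2 \<cdot> closure D2"
    and nonneg1: "b \<in> B1 \<Longrightarrow> 0 \<le> l1 b" and nonneg2: "c \<in> B2 \<Longrightarrow> 0 \<le> l2 c"
begin

lemmas b\<alpha> = self_adjoint_unitary_bounded[OF \<alpha>] and b\<beta> = self_adjoint_unitary_bounded[OF \<beta>]
lemmas \<alpha>_simps = self_adjoint_unitary_involutive[OF \<alpha>] bounded_op_scaleC[OF b\<alpha>] bounded_op_minus[OF b\<alpha>]
lemmas \<beta>_simps = self_adjoint_unitary_involutive[OF \<beta>] bounded_op_scaleC[OF b\<beta>] bounded_op_minus[OF b\<beta>]

definition dirac :: "'k operator" where
  "dirac = op_tensor tp D1 (graph \<beta>) \<oplus> op_tensor tp (graph \<alpha>) D2"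

text \<open>Built from the closures, because the eigenvectors are known to lie in the domains of
  \<open>closure D1\<close> and \<open>closure D2\<close> only, whereas \<open>dirac\<close> starts
  from the domains of \<open>D1\<close> and \<open>D2\<close>.\<close>

definition generators :: "'k operator" where
  "generators = {(tp x1 x2, tp w1 (\<beta> x2) + tp (\<alpha> x1) w2) | x1 w1 x2 w2.
     (x1, w1) \<in> closure D1 \<and> (x2, w2) \<in> closure D2}"

lemma generatorsI:
  "(x1, w1) \<in> closure D1 \<Longrightarrow> (x2, w2) \<in> closure D2 \<Longrightarrow>
    (tp x1 x2, tp w1 (\<beta> x2) + tp (\<alpha> x1) w2) \<in> generators"
  unfolding generators_def by blast

definition R :: "'k operator" where "R = closure dirac"

definition X :: "'k set" where "X = {tp b c | b c. b \<in> B1 \<and> c \<in> B2}"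

text \<open>The locale \<open>total_eigen\<close> attaches eigenvalues to vectors, so the two
  factors are recovered from \<open>tp b c\<close>; this is legitimate since \<open>tp\<close> is
  injective on pairs of basis vectors.\<close>

definition l :: "'k \<Rightarrow> real" where
  "l u = (let (b, c) = inv_into (B1 \<times> B2) (\<lambda>(b, c). tp b c) u in l1 b + l2 c)"

lemma l_tp: "b \<in> B1 \<Longrightarrow> c \<in> B2 \<Longrightarrow> l (tp b c) = l1 b + l2 c"
  using inv_into_f_f[OF orthonormal_basis_product(2)[OF basis1 basis2], of "(b, c)"]
  by (simp add: l_def)

lemma X_basis: "orthonormal_basis X"
  unfolding X_def by (rule orthonormal_basis_product(1)[OF basis1 basis2])

lemma csubspace_dirac: "cvec.subspace dirac"
  unfolding dirac_def op_tensor_def by (intro csubspace_op_sum cvec.subspace_span)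

lemma csubspace_R: "cvec.subspace R"
  unfolding R_def by (rule closure_csubspace_prod[OF csubspace_dirac])

lemma symmetric_R: "symmetric_op R"
  unfolding R_def dirac_def
  by (intro symmetric_op_closure symmetric_op_sum symmetric_op_tensor symmetric_op_graph \<alpha> \<beta>
      essentially_self_adjoint_closure(3) self_adjoint1 self_adjoint2)

text \<open>The map \<open>\<Phi>\<close> from a pair of graph points to a generator is continuous,
  and the closure of \<open>D1 \<times> D2\<close> is the product of the closures. So generators
  over the closed operators are limits of elements of \<open>dirac\<close>.\<close>

lemma generators_subset: "generators \<subseteq> R"
proof -
  define \<Phi> where "\<Phi> p = (tp (fst (fst p)) (fst (snd p)),
    tp (snd (fst p)) (\<beta> (fst (snd p))) + tp (\<alpha> (fst (fst p))) (snd (snd p)))"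
    for p :: "('h1 \<times> 'h1) \<times> ('h2 \<times> 'h2)"
  have "\<Phi> ` closure (D1 \<times> D2) \<subseteq> closure dirac"
  proof (rule image_closure_subset)
    show "continuous_on (closure (D1 \<times> D2)) \<Phi>"
      unfolding \<Phi>_def
      by (intro continuous_on_Pair continuous_on_add continuous_on_tp bounded_op_continuous[OF b\<alpha>]
          bounded_op_continuous[OF b\<beta>] continuous_on_fst continuous_on_snd continuous_on_id)
    have "(tp x1 x2, tp w1 (\<beta> x2) + tp (\<alpha> x1) w2) \<in> dirac"
      if "(x1, w1) \<in> D1" "(x2, w2) \<in> D2" for x1 w1 x2 w2
    proof -
      have "(tp x1 x2, tp w1 (\<beta> x2)) \<in> op_tensor tp D1 (graph \<beta>)"
        unfolding op_tensor_def graph_def using that by (intro cvec.span_base) blast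
      moreover have "(tp x1 x2, tp (\<alpha> x1) w2) \<in> op_tensor tp (graph \<alpha>) D2"
        unfolding op_tensor_def graph_def using that by (intro cvec.span_base) blast
      ultimately show ?thesis unfolding dirac_def op_sum_def by blast
    qed
    then have "\<Phi> ` (D1 \<times> D2) \<subseteq> dirac" by (auto simp: \<Phi>_def)
    then show "\<Phi> ` (D1 \<times> D2) \<subseteq> closure dirac" using closure_subset[of dirac] by auto
  qed simp
  then have "\<Phi> p \<in> R" if "p \<in> closure D1 \<times> closure D2" for p
    using that by (auto simp: closure_Times R_def)
  from this[of "((x1, w1), (x2, w2))" for x1 w1 x2 w2] show ?thesis
    by (auto simp: generators_def \<Phi>_def)
qed

text \<open>The cross terms cancel because \<open>\<alpha>\<close> anticommutes with the first operator and \<open>\<beta>\<close> commutes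
  with the second.\<close>

lemma total_eigen_generators:
  assumes sub: "cvec.subspace S" and cl: "closed S" and sym: "symmetric_op S" and gen: "generators \<subseteq> S"
  shows "total_eigen S X l"
proof
  show "closure (cvec.span X) = UNIV" by (rule orthonormal_basis_total[OF X_basis])
  fix u assume "u \<in> X"
  then obtain b c where u: "u = tp b c" and b: "b \<in> B1" and c: "c \<in> B2" by (auto simp: X_def)
  show "0 \<le> l u" using nonneg1[OF b] nonneg2[OF c] by (simp add: u l_tp b c)
  obtain b' where b': "(b, b') \<in> closure D1" "(b', complex_of_real (l1 b) *\<^sub>C b) \<in> closure D1"
    using eigen1[OF b] by (auto simp: op_prod_def)
  obtain c' where c': "(c, c') \<in> closure D2" "(c', complex_of_real (l2 c) *\<^sub>C c) \<in> closure D2"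
    using eigen2[OF c] by (auto simp: op_prod_def)
  have G: "(tp x1 x2, tp w1 (\<beta> x2) + tp (\<alpha> x1) w2) \<in> S"
    if "(x1, w1) \<in> closure D1" "(x2, w2) \<in> closure D2" for x1 w1 x2 w2
    using generatorsI[OF that] gen by blast
  \<comment> \<open>The image of \<open>u\<close> has two summands, each again a product vector: one
    over \<open>b'\<close> and \<open>\<beta> c\<close>, the other over \<open>\<alpha> b\<close>
    and \<open>c'\<close>. The operator is applied to them separately.\<close>
  have "(tp b' (\<beta> c), tp (complex_of_real (l1 b) *\<^sub>C b) (\<beta> (\<beta> c)) + tp (\<alpha> b') (\<beta> c')) \<in> S"
    by (rule G[OF b'(2) commute_graphD[OF \<beta>_D2 c'(1)]])
  moreover have "(tp (\<alpha> b) c', tp (- \<alpha> b') (\<beta> c') + tp (\<alpha> (\<alpha> b)) (complex_of_real (l2 c) *\<^sub>C c)) \<in> S"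
    by (rule G[OF anticommute_graphD[OF \<alpha>_D1 b'(1)] c'(2)])
  ultimately have "(tp b' (\<beta> c) + tp (\<alpha> b) c',
      (tp (complex_of_real (l1 b) *\<^sub>C b) (\<beta> (\<beta> c)) + tp (\<alpha> b') (\<beta> c')) +
      (tp (- \<alpha> b') (\<beta> c') + tp (\<alpha> (\<alpha> b)) (complex_of_real (l2 c) *\<^sub>C c))) \<in> S"
    using sub unfolding csubspace_rel by blast
  also have "(tp (complex_of_real (l1 b) *\<^sub>C b) (\<beta> (\<beta> c)) + tp (\<alpha> b') (\<beta> c')) +
      (tp (- \<alpha> b') (\<beta> c') + tp (\<alpha> (\<alpha> b)) (complex_of_real (l2 c) *\<^sub>C c)) = complex_of_real (l u) *\<^sub>C u"
    by (simp add: u l_tp b c \<alpha>_simps \<beta>_simps linear_simps scaleC_simps)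
  finally show "\<exists>v. (u, v) \<in> S \<and> (v, complex_of_real (l u) *\<^sub>C u) \<in> S"
    using G[OF b'(1) c'(1)] u by blast
qed (fact sub cl sym)+

lemma total_eigen_R: "total_eigen R X l"
  by (rule total_eigen_generators[OF csubspace_R _ symmetric_R generators_subset]) (simp add: R_def)

text \<open>The closed span of the generators satisfies the conditions of \<open>total_eigen\<close>
  by itself, hence has no proper symmetric extension, while \<open>R\<close> is a symmetric
  extension of it. Properties of \<open>R\<close> can thus be checked on generators.\<close>

lemma R_core: "closure (cvec.span generators) = R"
proof -
  have le: "closure (cvec.span generators) \<subseteq> R"
    by (intro closure_minimal cvec.span_minimal generators_subset csubspace_R) (simp add: R_def)
  have "total_eigen (closure (cvec.span generators)) X l"
  proof (rule total_eigen_generators)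
    show "cvec.subspace (closure (cvec.span generators))"
      by (intro closure_csubspace_prod cvec.subspace_span)
    show "symmetric_op (closure (cvec.span generators))"
      using symmetric_R le unfolding symmetric_op_def by blast
    show "generators \<subseteq> closure (cvec.span generators)"
      using closure_subset cvec.span_superset by blast
  qed simp
  then show ?thesis using total_eigen.maximal[OF _ le symmetric_R] by simp
qed

text \<open>The shape \<open>(f x, g y + h x)\<close> covers two uses: \<open>g = s f\<close> and
  \<open>h = 0\<close> for operators that commute or anticommute with \<open>R\<close>, and
  \<open>g = f\<close> with \<open>h\<close> the commutator for boundedness of commutators.\<close>

lemma R_induct:
  assumes f: "bounded_op f" "bounded_op g" "bounded_op h"
    and gen: "\<And>x1 w1 x2 w2. (x1, w1) \<in> closure D1 \<Longrightarrow> (x2, w2) \<in> closure D2 \<Longrightarrow>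
      (f (tp x1 x2), g (tp w1 (\<beta> x2) + tp (\<alpha> x1) w2) + h (tp x1 x2)) \<in> R"
    and xy: "(x, y) \<in> R"
  shows "(f x, g y + h x) \<in> R"
proof -
  let ?f = "\<lambda>p. (f (fst p), g (snd p) + h (fst p))"
  have "closed (?f -` R)"
    by (intro closed_vimage continuous_on_Pair continuous_on_add f[THEN bounded_op_continuous]
        continuous_intros) (simp add: R_def)
  moreover have "cvec.subspace (?f -` R)"
  proof (rule cvec.subspaceI)
    show "0 \<in> ?f -` R" using csubspace_R by (simp add: f[THEN bounded_op_0] csubspace_rel)
    show "p + q \<in> ?f -` R" if "p \<in> ?f -` R" "q \<in> ?f -` R" for p q
      using cvec.subspace_add[OF csubspace_R, of "?f p" "?f q"] that
      by (simp add: f[THEN bounded_op_add] algebra_simps)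
    show "c *\<^sub>C p \<in> ?f -` R" if "p \<in> ?f -` R" for c p
      using cvec.subspace_scale[OF csubspace_R, of "?f p" c] that
      by (simp add: f[THEN bounded_op_scaleC] scaleC_simps)
  qed
  moreover have "generators \<subseteq> ?f -` R" using gen by (auto simp: generators_def)
  ultimately have "closure (cvec.span generators) \<subseteq> ?f -` R"
    by (intro closure_minimal cvec.span_minimal)
  then have "(x, y) \<in> ?f -` R" using xy unfolding R_core by blast
  then show ?thesis by simp
qed

lemma essentially_self_adjoint_dirac: "essentially_self_adjoint dirac"
  by (rule total_eigen.essentially_self_adjointI[OF total_eigen_R _ csubspace_dirac]) (simp add: R_def)

text \<open>The same sign has to occur in both factors, since it is pulled out of both summands of a
  generator: \<open>-1\<close> for the grading, and for the Hodge operator \<open>-1\<close> with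
  the first and \<open>1\<close> with the second product operator.\<close>

lemma intertwine:
  assumes U: "bounded_op U1" "bounded_op U2" and s: "s \<in> {1, -1}"
    and U\<alpha>: "U1 \<circ> \<alpha> = \<alpha> \<circ> U1" and U\<beta>: "U2 \<circ> \<beta> = \<beta> \<circ> U2"
    and D1: "\<And>x w. (x, w) \<in> closure D1 \<Longrightarrow> (U1 x, s *\<^sub>C U1 w) \<in> closure D1"
    and D2: "\<And>x w. (x, w) \<in> closure D2 \<Longrightarrow> (U2 x, s *\<^sub>C U2 w) \<in> closure D2"
    and xy: "(x, y) \<in> R"
  shows "(bt U1 U2 x, s *\<^sub>C bt U1 U2 y) \<in> R"
proof -
  have "(bt U1 U2 x, (\<lambda>y. s *\<^sub>C bt U1 U2 y) y + (\<lambda>_. 0) x) \<in> R"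
  proof (rule R_induct[OF _ _ _ _ xy])
    fix x1 w1 x2 w2 assume x: "(x1, w1) \<in> closure D1" "(x2, w2) \<in> closure D2"
    have "(tp (U1 x1) (U2 x2), tp (s *\<^sub>C U1 w1) (\<beta> (U2 x2)) + tp (\<alpha> (U1 x1)) (s *\<^sub>C U2 w2)) \<in> R"
      using generatorsI[OF D1[OF x(1)] D2[OF x(2)]] generators_subset by blast
    then show "(bt U1 U2 (tp x1 x2), s *\<^sub>C bt U1 U2 (tp w1 (\<beta> x2) + tp (\<alpha> x1) w2) + 0) \<in> R"
      using fun_cong[OF U\<alpha>, of x1] fun_cong[OF U\<beta>, of x2]
      by (simp add: bt_tp[OF U] bounded_op_add[OF bounded_op_bt[OF U]] linear_simps scaleC_simps)
  qed (intro bounded_op_bt U bounded_op_scale bounded_op_zero)+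
  then show ?thesis by simp
qed

lemma bounded_commutator_bt:
  assumes a: "bounded_op a1" "bounded_op a2"
    and a\<alpha>: "\<alpha> \<circ> a1 = a1 \<circ> \<alpha>" and a\<beta>: "\<beta> \<circ> a2 = a2 \<circ> \<beta>"
    and "bounded_commutator (closure D1) a1" "bounded_commutator (closure D2) a2"
  shows "bounded_commutator R (bt a1 a2)"
proof -
  obtain C1 where C1: "bounded_op C1" "\<And>x w. (x, w) \<in> closure D1 \<Longrightarrow> (a1 x, a1 w + C1 x) \<in> closure D1"
    using assms(5) unfolding bounded_commutator_def by (smt (verit) case_prodD diff_eq_eq add.commute)
  obtain C2 where C2: "bounded_op C2" "\<And>x w. (x, w) \<in> closure D2 \<Longrightarrow> (a2 x, a2 w + C2 x) \<in> closure D2"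
    using assms(6) unfolding bounded_commutator_def by (smt (verit) case_prodD diff_eq_eq add.commute)
  have o: "bounded_op (\<beta> \<circ> a2)" "bounded_op (\<alpha> \<circ> a1)" by (intro bounded_op_comp a b\<alpha> b\<beta>)+
  \<comment> \<open>\<open>\<beta>\<close> commutes with \<open>a2\<close> and
    \<open>\<alpha>\<close> with \<open>a1\<close>, so each summand of the operator contributes only
    the commutator in the factor that carries \<open>D1\<close> or \<open>D2\<close>.\<close>
  define C where "C x = bt C1 (\<beta> \<circ> a2) x + bt (\<alpha> \<circ> a1) C2 x" for x
  have bC: "bounded_op C"
    unfolding C_def by (intro bounded_op_plus bounded_op_bt C1 C2 o)
  have "(bt a1 a2 x, bt a1 a2 y + C x) \<in> R" if xy: "(x, y) \<in> R" for x y
  proof (rule R_induct[OF _ _ bC _ xy])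
    fix x1 w1 x2 w2 assume x: "(x1, w1) \<in> closure D1" "(x2, w2) \<in> closure D2"
    have "(tp (a1 x1) (a2 x2), tp (a1 w1 + C1 x1) (\<beta> (a2 x2)) + tp (\<alpha> (a1 x1)) (a2 w2 + C2 x2)) \<in> R"
      using generatorsI[OF C1(2)[OF x(1)] C2(2)[OF x(2)]] generators_subset by blast
    then show "(bt a1 a2 (tp x1 x2), bt a1 a2 (tp w1 (\<beta> x2) + tp (\<alpha> x1) w2) + C (tp x1 x2)) \<in> R"
      using fun_cong[OF a\<alpha>, of x1] fun_cong[OF a\<beta>, of x2]
      by (simp add: C_def bt_tp a C1 C2 o bounded_op_add[OF bounded_op_bt[OF a]] linear_simps algebra_simps)
  qed (intro bounded_op_bt a)+
  then show ?thesis
    unfolding bounded_commutator_def using bC by (intro exI[of _ C]) force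
qed

end

section \<open>From elementary tensors to general elements of the algebra\<close>

lemma bounded_commutator_zero: "cvec.subspace T \<Longrightarrow> bounded_commutator T (\<lambda>x. 0)"
  unfolding bounded_commutator_def csubspace_rel
  by (intro exI[of _ "\<lambda>x. 0"]) (auto simp: bounded_op_zero)

lemma bounded_commutator_plus:
  assumes T: "cvec.subspace T" and "bounded_commutator T a" "bounded_commutator T b"
  shows "bounded_commutator T (\<lambda>x. a x + b x)"
proof -
  obtain C where C: "bounded_op C" "\<forall>(x, y)\<in>T. \<exists>z. (a x, z) \<in> T \<and> z - a y = C x"
    using assms by (auto simp: bounded_commutator_def)
  obtain C' where C': "bounded_op C'" "\<forall>(x, y)\<in>T. \<exists>z. (b x, z) \<in> T \<and> z - b y = C' x"
    using assms by (auto simp: bounded_commutator_def)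
  have "\<exists>z. (a x + b x, z) \<in> T \<and> z - (a y + b y) = C x + C' x" if xy: "(x, y) \<in> T" for x y
  proof -
    obtain z where z: "(a x, z) \<in> T" "z - a y = C x" using C xy by blast
    obtain z' where z': "(b x, z') \<in> T" "z' - b y = C' x" using C' xy by blast
    have "(a x + b x, z + z') \<in> T" using T z(1) z'(1) unfolding csubspace_rel by blast
    moreover have "z + z' - (a y + b y) = C x + C' x" by (simp flip: z(2) z'(2))
    ultimately show ?thesis by blast
  qed
  then show ?thesis unfolding bounded_commutator_def
    by (intro exI[of _ "\<lambda>x. C x + C' x"]) (auto intro: bounded_op_plus C C')
qed

lemma bounded_commutator_scale:
  assumes T: "cvec.subspace T" and "bounded_commutator T a"
  shows "bounded_commutator T (\<lambda>x. c *\<^sub>C a x)"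
proof -
  obtain C where C: "bounded_op C" "\<forall>(x, y)\<in>T. \<exists>z. (a x, z) \<in> T \<and> z - a y = C x"
    using assms by (auto simp: bounded_commutator_def)
  have "\<exists>z. (c *\<^sub>C a x, z) \<in> T \<and> z - c *\<^sub>C a y = c *\<^sub>C C x" if xy: "(x, y) \<in> T" for x y
  proof -
    obtain z where z: "(a x, z) \<in> T" "z - a y = C x" using C xy by blast
    have "(c *\<^sub>C a x, c *\<^sub>C z) \<in> T" using T z(1) unfolding csubspace_rel by blast
    moreover have "c *\<^sub>C z - c *\<^sub>C a y = c *\<^sub>C C x" by (simp add: scaleC_simps flip: z(2))
    ultimately show ?thesis by blast
  qed
  then show ?thesis unfolding bounded_commutator_def
    by (intro exI[of _ "\<lambda>x. c *\<^sub>C C x"]) (auto intro: bounded_op_scale C)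
qed

lemma (in tensor_representations) bounded_commutator_\<Theta>:
  assumes T: "cvec.subspace T" and "\<And>a b. bounded_commutator T (\<rho> a b)"
  shows "bounded_commutator T (\<Theta> t)"
proof (rule ta_induct[of "\<lambda>t. bounded_commutator T (\<Theta> t)"])
  have "\<Theta> 0 = (\<lambda>x. 0)" "\<And>s t. \<Theta> (s + t) = (\<lambda>x. \<Theta> s x + \<Theta> t x)" "\<And>c t. \<Theta> (c *\<^sub>C t) = (\<lambda>x. c *\<^sub>C \<Theta> t x)"
    by (auto simp: \<Theta>_0 \<Theta>_add \<Theta>_scaleC)
  then show "cvec.subspace {t. bounded_commutator T (\<Theta> t)}"
    using bounded_commutator_zero[OF T] bounded_commutator_plus[OF T] bounded_commutator_scale[OF T]
    by (auto simp: cvec.subspace_def)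
qed (simp add: \<Theta>_ta assms(2))

text \<open>Anticommutation includes equality of domains, so only one of the two mixed products has
  to be shown to exist. The image \<open>v'\<close> of \<open>b\<close> under
  \<open>closure D'\<close> satisfies the same eigenvalue equation for the common square, hence lies
  in the domain of \<open>closure D\<close>.\<close>

lemma (in N11_spectral_data) eigenvector_mixed:
  assumes b: "(b, c *\<^sub>C b) \<in> closure D \<cdot> closure D"
  obtains v v' p where "(b, v) \<in> closure D" "(v, - p) \<in> closure D'" "(b, v') \<in> closure D'" "(v', p) \<in> closure D"
proof -
  note D = essentially_self_adjoint_closure[OF self_adjoint(1)]
  note D' = essentially_self_adjoint_closure[OF self_adjoint(2)]
  obtain v' where v': "(b, v') \<in> closure D'" "(v', c *\<^sub>C b) \<in> closure D'"
    using b squares_eq by (auto simp: op_prod_def)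
  then have "(c *\<^sub>C b, c *\<^sub>C v') \<in> closure D'" using D'(1) by (simp add: csubspace_rel)
  then have "(v', c *\<^sub>C v') \<in> closure D' \<cdot> closure D'" using v' by (auto simp: op_prod_def)
  then have "(v', c *\<^sub>C v') \<in> closure D \<cdot> closure D" by (simp add: squares_eq)
  then obtain p where p: "(v', p) \<in> closure D" by (auto simp: op_prod_def)
  then have "(b, p) \<in> closure D \<cdot> closure D'" using v' by (auto simp: op_prod_def)
  then have "(b, p) \<in> op_neg (closure D' \<cdot> closure D)" using D_D' by (simp add: anticommute_def)
  then obtain z where "p = - z" "(b, z) \<in> closure D' \<cdot> closure D" by (auto simp: op_neg_def)
  then obtain v where "(b, v) \<in> closure D" "(v, - p) \<in> closure D'" by (auto simp: op_prod_def)
  then show thesis using that v' p by blast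
qed

section \<open>The tensor product of spectral data\<close>

lemma summable_on_product:
  fixes f :: "'a \<Rightarrow> real" and g :: "'b \<Rightarrow> real"
  assumes f: "f summable_on A" "\<And>a. 0 \<le> f a" and g: "g summable_on B" "\<And>b. 0 \<le> g b"
  shows "(\<lambda>(a, b). f a * g b) summable_on A \<times> B"
proof (rule summable_on_SigmaI)
  show "((\<lambda>b. case (a, b) of (a, b) \<Rightarrow> f a * g b) has_sum f a * infsum g B) B" for a
    using has_sum_cmult_right[OF has_sum_infsum[OF g(1)], of "f a"] by simp
  show "(\<lambda>a. f a * infsum g B) summable_on A"
    using f(1) by (rule summable_on_cmult_left)
qed (use f g in auto)

lemma (in tensor_dirac) heat_trace_class_R:
  assumes "\<epsilon> > 0"
    and "(\<lambda>b. exp (- \<epsilon> * l1 b)) summable_on B1" "(\<lambda>c. exp (- \<epsilon> * l2 c)) summable_on B2"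
  shows "\<exists>E. is_function_of (R \<cdot> R) (\<lambda>t. exp (- \<epsilon> * t)) (graph E) \<and> trace_class E"
proof -
  interpret total_eigen R X l by (rule total_eigen_R)
  have X: "X = (\<lambda>(b, c). tp b c) ` (B1 \<times> B2)" by (auto simp: X_def)
  have "(\<lambda>(b, c). exp (- \<epsilon> * l1 b) * exp (- \<epsilon> * l2 c)) summable_on B1 \<times> B2"
    using assms by (intro summable_on_product) auto
  then have "((\<lambda>u. exp (- \<epsilon> * l u)) \<circ> (\<lambda>(b, c). tp b c)) summable_on B1 \<times> B2"
    by (rule summable_on_cong[THEN iffD1, rotated])
       (auto simp: l_tp exp_add[symmetric] algebra_simps)
  then have "(\<lambda>u. exp (- \<epsilon> * l u)) summable_on X"
    unfolding X by (subst summable_on_reindex[OF orthonormal_basis_product(2)[OF basis1 basis2]])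
  then show ?thesis
    unfolding square_eq_diag_operator
    using nonneg assms(1) by (intro heat_trace_class_diag_operator[OF X_basis]) auto
qed

theorem lemma2p12:
  fixes \<pi>1 :: "'a1::complex_star_algebra \<Rightarrow> 'h1::complex_hilbert \<Rightarrow> 'h1"
    and \<pi>2 :: "'a2::complex_star_algebra \<Rightarrow> 'h2::complex_hilbert \<Rightarrow> 'h2"
    and D1 D1' :: "'h1 operator" and D2 D2' :: "'h2 operator"
    and \<gamma>1 \<sigma>1 :: "'h1 \<Rightarrow> 'h1" and \<gamma>2 \<sigma>2 :: "'h2 \<Rightarrow> 'h2"
    and ta :: "'a1 \<Rightarrow> 'a2 \<Rightarrow> 't::complex_star_algebra"
    and tp :: "'h1 \<Rightarrow> 'h2 \<Rightarrow> 'k::complex_hilbert"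
  assumes "N11_spectral_data \<pi>1 D1 D1' \<gamma>1 \<sigma>1"
    and "N11_spectral_data \<pi>2 D2 D2' \<gamma>2 \<sigma>2"
    and "algebra_tensor ta"
    and "hilbert_tensor tp"
  shows "N11_spectral_data
           (tensor_representation ta tp \<pi>1 \<pi>2)
           (op_tensor tp D1 (graph id) \<oplus> op_tensor tp (graph \<sigma>1) D2)
           (op_tensor tp D1' (graph \<sigma>2) \<oplus> op_tensor tp (graph \<gamma>1) D2')
           (bounded_tensor tp \<gamma>1 \<gamma>2)
           (bounded_tensor tp \<sigma>1 \<sigma>2)"
proof -
  interpret d1: N11_spectral_data \<pi>1 D1 D1' \<gamma>1 \<sigma>1 by fact
  interpret d2: N11_spectral_data \<pi>2 D2 D2' \<gamma>2 \<sigma>2 by fact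
  obtain B1 l1 where B1: "orthonormal_basis B1"
    "\<And>b. b \<in> B1 \<Longrightarrow> (b, complex_of_real (l1 b) *\<^sub>C b) \<in> closure D1 \<cdot> closure D1"
    "\<And>b. b \<in> B1 \<Longrightarrow> 0 \<le> l1 b"
    and sum1: "\<And>\<epsilon>. \<epsilon> > 0 \<Longrightarrow> (\<lambda>b. exp (- \<epsilon> * l1 b)) summable_on B1"
    by (rule d1.eigenbasis) blast
  obtain B2 l2 where B2: "orthonormal_basis B2"
    "\<And>b. b \<in> B2 \<Longrightarrow> (b, complex_of_real (l2 b) *\<^sub>C b) \<in> closure D2 \<cdot> closure D2"
    "\<And>b. b \<in> B2 \<Longrightarrow> 0 \<le> l2 b"
    and sum2: "\<And>\<epsilon>. \<epsilon> > 0 \<Longrightarrow> (\<lambda>b. exp (- \<epsilon> * l2 b)) summable_on B2"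
    by (rule d2.eigenbasis) blast
  interpret tensor_representations tp ta \<pi>1 \<pi>2
    using assms(3,4) B1(1) B2(1) d1.faithful d2.faithful by unfold_locales auto
  interpret P: tensor_dirac tp D1 D2 \<sigma>1 id B1 B2 l1 l2
    using d1.self_adjoint d2.self_adjoint d1.hodge d1.hodge_D B1 B2
    by unfold_locales (auto intro: self_adjoint_unitary_id commute_graphI)
  \<comment> \<open>\<open>squares_eq\<close> in both factors makes the same bases and eigenvalues
    valid for \<open>D1'\<close> and \<open>D2'\<close>.\<close>
  interpret Q: tensor_dirac tp D1' D2' \<gamma>1 \<sigma>2 B1 B2 l1 l2
    using d1.self_adjoint d2.self_adjoint d1.grading d1.grading_D d2.hodge d2.hodge_D B1 B2
      d1.squares_eq d2.squares_eq
    by unfold_locales auto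
  have RP: "closure (op_tensor tp D1 (graph id) \<oplus> op_tensor tp (graph \<sigma>1) D2) = P.R"
    by (simp add: P.R_def P.dirac_def)
  have RQ: "closure (op_tensor tp D1' (graph \<sigma>2) \<oplus> op_tensor tp (graph \<gamma>1) D2') = Q.R"
    by (simp add: Q.R_def Q.dirac_def)
  \<comment> \<open>\<open>X\<close> and \<open>l\<close> are built from \<open>tp\<close>, the
    bases and the eigenvalues alone, so they are the same for \<open>P\<close> and
    \<open>Q\<close>.\<close>
  have pair: "total_eigen_pair P.R Q.R P.X P.l"
    by (intro total_eigen_pair.intro P.total_eigen_R Q.total_eigen_R)
  have b: "bounded_op \<gamma>1" "bounded_op \<gamma>2" "bounded_op \<sigma>1" "bounded_op \<sigma>2"
    using d1.grading d2.grading d1.hodge d2.hodge by (auto intro: self_adjoint_unitary_bounded)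
  note sau = bt_self_adjoint_unitary[OF d1.grading d2.grading] bt_self_adjoint_unitary[OF d1.hodge d2.hodge]
  have \<gamma>P: "(bt \<gamma>1 \<gamma>2 x, - bt \<gamma>1 \<gamma>2 y) \<in> P.R" if "(x, y) \<in> P.R" for x y
    using P.intertwine[of \<gamma>1 \<gamma>2 "-1", OF b(1,2) _ _ _ _ _ that] d1.hodge_grading
      anticommute_graphD[OF d1.grading_D(1)] anticommute_graphD[OF d2.grading_D(1)] by simp
  have \<gamma>Q: "(bt \<gamma>1 \<gamma>2 x, - bt \<gamma>1 \<gamma>2 y) \<in> Q.R" if "(x, y) \<in> Q.R" for x y
    using Q.intertwine[of \<gamma>1 \<gamma>2 "-1", OF b(1,2) _ _ _ _ _ that] d2.hodge_grading
      anticommute_graphD[OF d1.grading_D(2)] anticommute_graphD[OF d2.grading_D(2)] by simp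
  have \<sigma>P: "(bt \<sigma>1 \<sigma>2 x, - bt \<sigma>1 \<sigma>2 y) \<in> P.R" if "(x, y) \<in> P.R" for x y
    using P.intertwine[of \<sigma>1 \<sigma>2 "-1", OF b(3,4) _ _ _ _ _ that]
      anticommute_graphD[OF d1.hodge_D(1)] anticommute_graphD[OF d2.hodge_D(1)] by simp
  have \<sigma>Q: "(bt \<sigma>1 \<sigma>2 x, bt \<sigma>1 \<sigma>2 y) \<in> Q.R" if "(x, y) \<in> Q.R" for x y
    using Q.intertwine[of \<sigma>1 \<sigma>2 "1", OF b(3,4) _ _ _ _ _ that] d1.hodge_grading
      commute_graphD[OF d1.hodge_D(2)] commute_graphD[OF d2.hodge_D(2)] by simp
  have anti: "anticommute P.R Q.R"
  proof (rule total_eigen_pair_anticommute[OF pair])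
    fix u assume "u \<in> P.X"
    then obtain b c where u: "u = tp b c" "b \<in> B1" "c \<in> B2" by (auto simp: P.X_def)
    obtain b1 b1' p where bp: "(b, b1) \<in> closure D1" "(b1, - p) \<in> closure D1'"
      "(b, b1') \<in> closure D1'" "(b1', p) \<in> closure D1"
      using d1.eigenvector_mixed[OF B1(2)[OF u(2)]] by blast
    obtain c2 c2' q where cq: "(c, c2) \<in> closure D2" "(c2, - q) \<in> closure D2'"
      "(c, c2') \<in> closure D2'" "(c2', q) \<in> closure D2"
      using d2.eigenvector_mixed[OF B2(2)[OF u(3)]] by blast
    note GP = P.generators_subset[THEN subsetD, OF P.generatorsI]
      and GQ = Q.generators_subset[THEN subsetD, OF Q.generatorsI]
    define v where "v = tp b1 c + tp (\<sigma>1 b) c2"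
    define v' where "v' = tp b1' (\<sigma>2 c) + tp (\<gamma>1 b) c2'"
    \<comment> \<open>The image of \<open>v'\<close> under the first operator; its minus signs come
      from \<open>\<sigma>2\<close> and \<open>\<gamma>1\<close>, which anticommute with
      \<open>closure D2\<close> and \<open>closure D1\<close>. The second operator sends
      \<open>v\<close> to \<open>- y\<close> because \<open>\<sigma>1\<close> commutes with
      \<open>closure D1'\<close> and with \<open>\<gamma>1\<close>.\<close>
    define y where "y = tp p (\<sigma>2 c) - tp (\<sigma>1 b1') (\<sigma>2 c2) - tp (\<gamma>1 b1) c2' + tp (\<sigma>1 (\<gamma>1 b)) q"
    have "(u, v) \<in> P.R" using GP[OF bp(1) cq(1)] by (simp add: u v_def)
    moreover have "(u, v') \<in> Q.R" using GQ[OF bp(3) cq(3)] by (simp add: u v'_def)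
    moreover have "(v', y) \<in> P.R"
      using cvec.subspace_add[OF P.csubspace_R
          GP[OF bp(4) anticommute_graphD[OF d2.hodge_D(1) cq(1)]]
          GP[OF anticommute_graphD[OF d1.grading_D(1) bp(1)] cq(4)]]
      by (simp add: v'_def y_def linear_simps algebra_simps)
    moreover have "(v, - y) \<in> Q.R"
      using cvec.subspace_add[OF Q.csubspace_R GQ[OF bp(2) cq(3)]
          GQ[OF commute_graphD[OF d1.hodge_D(2) bp(3)] cq(2)]] fun_cong[OF d1.hodge_grading, of b]
      by (simp add: v_def y_def linear_simps algebra_simps)
    ultimately show "\<exists>v v' y. (u, v) \<in> P.R \<and> (v, - y) \<in> Q.R \<and> (u, v') \<in> Q.R \<and> (v', y) \<in> P.R"
      by blast
  qed
  show ?thesis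
  proof (unfold_locales, unfold RP RQ)
    obtain X Y where "countable (X :: 'h1 set)" "closure X = UNIV" "countable (Y :: 'h2 set)" "closure Y = UNIV"
      using d1.separable d2.separable by blast
    then show "\<exists>Z :: 'k set. countable Z \<and> closure Z = UNIV" by (rule separable_product)
    show "faithful_representation \<Theta>" by (rule faithful_representation_\<Theta>)
    show "essentially_self_adjoint (op_tensor tp D1 (graph id) \<oplus> op_tensor tp (graph \<sigma>1) D2)"
      using P.essentially_self_adjoint_dirac by (simp add: P.dirac_def)
    show "essentially_self_adjoint (op_tensor tp D1' (graph \<sigma>2) \<oplus> op_tensor tp (graph \<gamma>1) D2')"
      using Q.essentially_self_adjoint_dirac by (simp add: Q.dirac_def)
    show "P.R \<cdot> P.R = Q.R \<cdot> Q.R" by (rule total_eigen_pair.square_eq[OF pair])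
    show "anticommute P.R Q.R" by (rule anti)
    show "bounded_commutator P.R (\<Theta> t)" for t
      by (intro bounded_commutator_\<Theta> P.csubspace_R P.bounded_commutator_bt b1 b2 d1.hodge_algebra
          d1.commutators d2.commutators) simp
    show "bounded_commutator Q.R (\<Theta> t)" for t
      by (intro bounded_commutator_\<Theta> Q.csubspace_R Q.bounded_commutator_bt b1 b2 d1.grading_algebra
          d2.hodge_algebra d1.commutators d2.commutators)
    show "\<exists>E. is_function_of (P.R \<cdot> P.R) (\<lambda>t. exp (- \<epsilon> * t)) (graph E) \<and> trace_class E"
      if "\<epsilon> > 0" for \<epsilon>
      by (rule P.heat_trace_class_R[OF that sum1[OF that] sum2[OF that]])
    show "self_adjoint_unitary (bt \<gamma>1 \<gamma>2)" "self_adjoint_unitary (bt \<sigma>1 \<sigma>2)" by (fact sau)+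
    show "bt \<gamma>1 \<gamma>2 \<circ> \<Theta> t = \<Theta> t \<circ> bt \<gamma>1 \<gamma>2" for t
      by (rule \<Theta>_commute)
         (simp_all add: bounded_op_bt bt_comp b b1 b2 d1.grading_algebra d2.grading_algebra)
    show "bt \<sigma>1 \<sigma>2 \<circ> \<Theta> t = \<Theta> t \<circ> bt \<sigma>1 \<sigma>2" for t
      by (rule \<Theta>_commute)
         (simp_all add: bounded_op_bt bt_comp b b1 b2 d1.hodge_algebra d2.hodge_algebra)
    show "bt \<sigma>1 \<sigma>2 \<circ> bt \<gamma>1 \<gamma>2 = bt \<gamma>1 \<gamma>2 \<circ> bt \<sigma>1 \<sigma>2"
      by (simp add: bt_comp b d1.hodge_grading d2.hodge_grading)
    show "anticommute (graph (bt \<gamma>1 \<gamma>2)) P.R" by (rule anticommute_graphI[OF sau(1) \<gamma>P])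
    show "anticommute (graph (bt \<gamma>1 \<gamma>2)) Q.R" by (rule anticommute_graphI[OF sau(1) \<gamma>Q])
    show "anticommute (graph (bt \<sigma>1 \<sigma>2)) P.R" by (rule anticommute_graphI[OF sau(2) \<sigma>P])
    show "commute (graph (bt \<sigma>1 \<sigma>2)) Q.R" by (rule commute_graphI[OF sau(2) \<sigma>Q])
  qed
qed

end
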